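(* Let $\underline H: T^*\mathbb{R}^{1+d} \to \mathbb{R}$ be a smooth Hamiltonian which is convex in $p$ in the sense that $\partial^2_{pp}\underline H$ is positive definite at each point. Let $(\underline Q(t), \underline P(t))$ be an orbit of $\underline H$ such that $\dot{\underline Q}(0) \neq 0$. (1) There exist a smooth local fibered symplectic diffeomorphism $\psi$ and $\delta >0$ such that the new Hamiltonian $H=\underline H\circ \psi$ and the new orbit $(Q(t), P(t))=\psi^{-1}(\underline Q(t), \underline P(t))$ satisfy, for all $t\in [0, \delta]$, $$Q(t) = te_0,$$ $$P(t) = 0,$$ $$\partial^2_{p_0p_*}H(te_0,P(t)) =0,$$ $$\partial^2_{qp_*} H (te_0, P(t)) = 0,$$ $$\partial^2_{p_*p_*}H(te_0,P(t)) =\mathrm{Id}.$$ (2) Let $\psi,\delta$ be as in (1), and let $H=\underline H\circ\psi$ be the resulting Hamiltonian, with orbit $(Q(t),P(t))=(te_0,0)$, $t\in[0,\delta]$, so that all five equalities hold. If $t\mapsto \partial^2_{q_*p_0} H (te_0, 0)$ does not vanish identically on $[0,\delta]$, then this quantity cannot be reduced to zero by applying an admissible change of coordinates preserving the other equalities. That is, there is no admissible fibered symplectic diffeomorphism $\chi$ such that the Hamiltonian $H\circ\chi$ and its orbit $\chi^{-1}(te_0,0)$ satisfy the five equalities of (1) for all $t\in[0,\delta]$ (with $H\circ \chi$ in place of $H$ and $\chi^{-1}(te_0,0)$ in place of $(Q(t),P(t))$) and such that $\partial^2_{q_*p_0}(H\circ\chi)(te_0,0)=0$ for all $t\in[0,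\delta]$.
   Context: $T^*\mathbb{R}^{1+d}=\mathbb{R}^{1+d}\times(\mathbb{R}^{1+d})^*$ with its standard symplectic structure; points are written $(q,p)$ with $q=(q_0,q_* )\in\mathbb{R}\times\mathbb{R}^d$ and $p=(p_0,p_* )\in\mathbb{R}^*\times(\mathbb{R}^d)^*$. $e_0,\dots,e_d$ denotes the standard basis of $\mathbb{R}^{1+d}$ (and also of its dual). An orbit of a Hamiltonian $H$ is a solution of $\dot Q=\partial_pH(Q,P)$, $\dot P=-\partial_qH(Q,P)$, defined on an interval around $t=0$. Subscripts denote partial derivatives with respect to the corresponding blocks of variables; for instance $\partial^2_{qp_*}H$ is the full matrix of mixed second derivatives in all of $q=(q_0,q_* )$ and in $p_*$. A (local) symplectic diffeomorphism $\psi$ of $T^*\mathbb{R}^{1+d}$ is called fibered if it preserves the vertical fibration, i.e. it is of the form $\psi(q,p)=(\varphi(q),G(q,p))$; equivalently $G(q,p)=\alpha_q+p\circ(d\varphi_q)^{-1}$ for a local diffeomorphism $\varphi$ of the base (the horizontal component of $\psi$) and a closed one-form $\alpha$. "Local" means that $\psi$ is defined on a neighborhood of the relevant orbit segment (in the new coordinates), and is a diffeomorphism onto a neighborhood of the original orbit segment. A fibered symplectic diffeomorphism is called admissible if its horizontal component $\varphi$ is the identity on the segment $[-\delta,\delta]e_0=\{te_0 : t\in[-\delta,\delta]\}$. *)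

theory Defs
  imports "HOL-Analysis.Analysis"
begin

section \<open>Smooth maps and partial derivatives\<close>

text \<open>In finite dimension, a map is of class C^{k+1} on an open set iff it is differentiable there
  and each of its directional derivatives is of class C^k. The recursion has this meaning only on
  open sets, which is why openness is part of \<open>smooth_on\<close>.\<close>

primrec Ck_on :: "nat \<Rightarrow> 'a::euclidean_space set \<Rightarrow> ('a \<Rightarrow> 'b::euclidean_space) \<Rightarrow> bool" where
  "Ck_on 0 S f \<longleftrightarrow> continuous_on S f"
| "Ck_on (Suc k) S f \<longleftrightarrow>
     f differentiable_on S \<and> (\<forall>v. Ck_on k S (\<lambda>x. frechet_derivative f (at x) v))"

definition smooth_on :: "'a::euclidean_space set \<Rightarrow> ('a \<Rightarrow> 'b::euclidean_space) \<Rightarrow> bool" where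
  "smooth_on S f \<longleftrightarrow> open S \<and> (\<forall>k. Ck_on k S f)"

definition partial_deriv :: "'a::euclidean_space \<Rightarrow> ('a \<Rightarrow> real) \<Rightarrow> 'a \<Rightarrow> real" where
  "partial_deriv v f = (\<lambda>x. frechet_derivative f (at x) v)"


section \<open>Phase space\<close>

text \<open>A point of the cotangent bundle is a pair \<open>(q, p)\<close>, covectors being represented by their
  coordinates in the dual basis. The coordinates of \<open>R^{1+d}\<close> are indexed by a finite type with
  \<open>1 + d\<close> elements (\<open>d = 0\<close> included), one of which is named \<open>0\<close>: \<open>q $ 0\<close> is the coordinate
  \<open>q_0\<close>, and the block \<open>q_*\<close> consists of the coordinates \<open>q $ i\<close> with \<open>i \<noteq> 0\<close>.\<close>

type_synonym 'n phase = "(real ^ 'n) \<times> (real ^ 'n)"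

definition e0 :: "real ^ 'n::{finite,zero}" where
  "e0 = axis 0 1"

definition dq :: "'n::finite \<Rightarrow> ('n phase \<Rightarrow> real) \<Rightarrow> 'n phase \<Rightarrow> real" where
  "dq i = partial_deriv (axis i 1, 0)"

definition dp :: "'n::finite \<Rightarrow> ('n phase \<Rightarrow> real) \<Rightarrow> 'n phase \<Rightarrow> real" where
  "dp i = partial_deriv (0, axis i 1)"

definition grad_q :: "('n::finite phase \<Rightarrow> real) \<Rightarrow> 'n phase \<Rightarrow> real ^ 'n" where
  "grad_q H z = (\<chi> i. dq i H z)"

definition grad_p :: "('n::finite phase \<Rightarrow> real) \<Rightarrow> 'n phase \<Rightarrow> real ^ 'n" where
  "grad_p H z = (\<chi> i. dp i H z)"

definition hess_pp :: "('n::finite phase \<Rightarrow> real) \<Rightarrow> 'n phase \<Rightarrow> real ^ 'n ^ 'n" where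
  "hess_pp H z = (\<chi> i j. dp i (dp j H) z)"

definition convex_in_p :: "('n::finite phase \<Rightarrow> real) \<Rightarrow> bool" where
  "convex_in_p H \<longleftrightarrow> (\<forall>z v. v \<noteq> 0 \<longrightarrow> 0 < v \<bullet> (hess_pp H z *v v))"

definition hamiltonian_orbit ::
    "('n::finite phase \<Rightarrow> real) \<Rightarrow> real set \<Rightarrow> (real \<Rightarrow> real ^ 'n) \<Rightarrow> (real \<Rightarrow> real ^ 'n) \<Rightarrow> bool" where
  "hamiltonian_orbit H I Q P \<longleftrightarrow> is_interval I \<and> 0 \<in> interior I \<and>
     (\<forall>t\<in>I. (Q has_vector_derivative grad_p H (Q t, P t)) (at t within I) \<and>
            (P has_vector_derivative - grad_q H (Q t, P t)) (at t within I))"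


section \<open>Fibered symplectic diffeomorphisms\<close>

definition symplectic_form :: "'n::finite phase \<Rightarrow> 'n phase \<Rightarrow> real" where
  "symplectic_form u v = snd u \<bullet> fst v - fst u \<bullet> snd v"

text \<open>Local maps are total functions together with an open domain \<open>W\<close>; their values
  outside \<open>W\<close> are irrelevant.\<close>

definition symplectic_diffeo :: "'n::finite phase set \<Rightarrow> ('n phase \<Rightarrow> 'n phase) \<Rightarrow> bool" where
  "symplectic_diffeo W \<psi> \<longleftrightarrow>
     smooth_on W \<psi> \<and> inj_on \<psi> W \<and> smooth_on (\<psi> ` W) (inv_into W \<psi>) \<and>
     (\<forall>z\<in>W. \<forall>u v. symplectic_form (frechet_derivative \<psi> (at z) u) (frechet_derivative \<psi> (at z) v)
                    = symplectic_form u v)"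

definition horizontal_component ::
    "'n::finite phase set \<Rightarrow> ('n phase \<Rightarrow> 'n phase) \<Rightarrow> (real ^ 'n \<Rightarrow> real ^ 'n) \<Rightarrow> bool" where
  "horizontal_component W \<psi> \<phi> \<longleftrightarrow> (\<forall>z\<in>W. fst (\<psi> z) = \<phi> (fst z))"

definition fibered_symplectic_diffeo ::
    "'n::finite phase set \<Rightarrow> ('n phase \<Rightarrow> 'n phase) \<Rightarrow> bool" where
  "fibered_symplectic_diffeo W \<psi> \<longleftrightarrow>
     symplectic_diffeo W \<psi> \<and> (\<exists>\<phi>. horizontal_component W \<psi> \<phi>)"

definition admissible ::
    "real \<Rightarrow> 'n::{finite,zero} phase set \<Rightarrow> ('n phase \<Rightarrow> 'n phase) \<Rightarrow> bool" where
  "admissible \<delta> W \<psi> \<longleftrightarrow> fibered_symplectic_diffeo W \<psi> \<and>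
     (\<exists>\<phi>. horizontal_component W \<psi> \<phi> \<and>
          (\<forall>t\<in>{-\<delta>..\<delta>}. t *\<^sub>R e0 \<in> fst ` W \<and> \<phi> (t *\<^sub>R e0) = t *\<^sub>R e0))"


section \<open>The normal form along an orbit\<close>

definition five_equalities ::
    "real \<Rightarrow> ('n::{finite,zero} phase \<Rightarrow> real) \<Rightarrow> (real \<Rightarrow> 'n phase) \<Rightarrow> bool" where
  "five_equalities \<delta> H Z \<longleftrightarrow> (\<forall>t\<in>{0..\<delta>}.
     fst (Z t) = t *\<^sub>R e0 \<and>
     snd (Z t) = 0 \<and>
     (\<forall>j. j \<noteq> 0 \<longrightarrow> dp 0 (dp j H) (t *\<^sub>R e0, snd (Z t)) = 0) \<and>
     (\<forall>i j. j \<noteq> 0 \<longrightarrow> dq i (dp j H) (t *\<^sub>R e0, snd (Z t)) = 0) \<and>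
     (\<forall>i j. i \<noteq> 0 \<longrightarrow> j \<noteq> 0 \<longrightarrow>
        dp i (dp j H) (t *\<^sub>R e0, snd (Z t)) = (if i = j then 1 else 0)))"

text \<open>\<open>\<psi>\<close>, with domain \<open>W\<close>, satisfies the equalities for the Hamiltonian \<open>H\<close> and the curve \<open>Z\<close>
  in the original coordinates. As \<open>W\<close> and \<open>\<psi> ` W\<close> are open, the condition \<open>Z t \<in> \<psi> ` W\<close> says that
  they are neighborhoods of the new and of the original orbit segment. It also makes
  \<open>inv_into W \<psi> (Z t)\<close> a genuine preimage.\<close>

definition normalizes ::
    "real \<Rightarrow> ('n::{finite,zero} phase \<Rightarrow> real) \<Rightarrow> (real \<Rightarrow> 'n phase) \<Rightarrow>
     'n phase set \<Rightarrow> ('n phase \<Rightarrow> 'n phase) \<Rightarrow> bool" where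
  "normalizes \<delta> H Z W \<psi> \<longleftrightarrow>
     fibered_symplectic_diffeo W \<psi> \<and> (\<forall>t\<in>{0..\<delta>}. Z t \<in> \<psi> ` W) \<and>
     five_equalities \<delta> (H \<circ> \<psi>) (\<lambda>t. inv_into W \<psi> (Z t))"

definition mixed_qstar_p0_vanishes ::
    "real \<Rightarrow> ('n::{finite,zero} phase \<Rightarrow> real) \<Rightarrow> bool" where
  "mixed_qstar_p0_vanishes \<delta> H \<longleftrightarrow>
     (\<forall>t\<in>{0..\<delta>}. \<forall>i. i \<noteq> 0 \<longrightarrow> dq i (dp 0 H) (t *\<^sub>R e0, 0) = 0)"

end

theory Submission
  imports Defs
begin

text \<open>
Existence. Let \<open>G\<close> be the fibre Hessian of \<open>H\<close> along the orbit and \<open>\<Gamma>\<close> its inverse, a Riemannian metric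
along the base curve \<open>Q\<close>. The change of coordinates is a cotangent lift translated by a closed one-form,
\<open>\<psi> (x, y) = (\<phi> x, D\<phi>\<^sub>x\<^sup>-\<^sup>T (y + \<beta> x))\<close>, over a tubular map \<open>\<phi> x = Q x\<^sub>0 + A x\<^sub>0 x\<close> with \<open>A t e\<^sub>0 = 0\<close>.
Since \<open>\<psi>\<close> respects the fibres and the symplectic form, \<open>K = H \<circ> \<psi>\<close> satisfies
\<open>D\<phi> (\<partial>\<^sub>p K) = (\<partial>\<^sub>p H) \<circ> \<psi>\<close> (\<open>grad_p_fibered\<close>), and differentiating this identity
(\<open>derivative_grad_p_fibered\<close>, \<open>hess_pp_fibered\<close>) turns the five equalities into conditions on \<open>A\<close> and \<open>\<beta>\<close>.

The orbit becomes \<open>(t e\<^sub>0, 0)\<close> once \<open>\<beta>\<close> restricts to \<open>D\<phi>\<^sup>T P\<close> along the segment. The two conditions on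
\<open>\<partial>\<^sub>p\<^sub>p K\<close> say that the columns \<open>A e\<^sub>j\<close> are \<open>\<Gamma>\<close>-orthonormal and \<open>\<Gamma>\<close>-orthogonal to \<open>Q'\<close>. As
\<open>\<partial>\<^sub>p K = e\<^sub>0\<close> all along the segment, its derivative in \<open>q\<^sub>0\<close> vanishes, so only the transverse block of
\<open>\<partial>\<^sub>q\<^sub>p K\<close> is left; it equals \<open>A\<^sup>T \<Gamma> (H\<^sub>q\<^sub>p A - A') + B\<close>, where \<open>B\<close> is the transverse derivative of \<open>\<beta>\<close>. Closedness
forces \<open>B\<close> to be symmetric, so \<open>B\<close> can absorb the symmetric part only, and the antisymmetric part must be
removed by the choice of \<open>A\<close>. This prescribes \<open>A'\<close> through a linear differential equation, a parallel
transport, and its free terms can be chosen so that the equation preserves all the orthogonality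
relations (\<open>adapted_frame_exists\<close>).

Obstruction. Let \<open>\<eta>\<close> be a fibered change of coordinates between two Hamiltonians in normal form, fixing the
segment, and let \<open>M\<close> be the differential of its base map at \<open>t e\<^sub>0\<close>. Then \<open>M e\<^sub>0 = e\<^sub>0\<close>, and the shape of the two
fibre Hessians gives \<open>M\<^sup>T e\<^sub>0 = e\<^sub>0\<close> as well (\<open>adjoint_fixes_e0\<close>). In the \<open>0\<close>-component of the differentiated
gradient identity every term but the mixed derivatives drops out: they are transformed by the
invertible transverse block of \<open>M\<^sup>T\<close>, hence vanish in both coordinate systems or in neither
(\<open>mixed_derivatives_obstruction\<close>).
\<close>

section \<open>Calculus of smooth maps\<close>

lemma frechet_derivative_cong_open:
  assumes "open S" "x \<in> S" "\<And>y. y \<in> S \<Longrightarrow> f y = g y"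
  shows "frechet_derivative f (at x) = frechet_derivative g (at x)"
proof -
  have "(f has_derivative D) (at x) \<longleftrightarrow> (g has_derivative D) (at x)" for D
    using assms by (metis has_derivative_transform_within_open)
  then show ?thesis
    unfolding frechet_derivative_def by simp
qed

lemma Ck_on_cong:
  assumes "open S" "\<And>x. x \<in> S \<Longrightarrow> f x = g x"
  shows "Ck_on k S f \<longleftrightarrow> Ck_on k S g"
  using assms(2)
proof (induction k arbitrary: f g)
  case 0
  then show ?case by (simp cong: continuous_on_cong)
next
  case (Suc k)
  have "Ck_on k S (\<lambda>x. frechet_derivative f (at x) v) \<longleftrightarrow> Ck_on k S (\<lambda>x. frechet_derivative g (at x) v)" for v
    by (rule Suc.IH) (simp add: frechet_derivative_cong_open[OF assms(1) _ Suc.prems])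
  moreover have "f differentiable_on S \<longleftrightarrow> g differentiable_on S"
    using Suc.prems by (auto simp: differentiable_on_def intro: differentiable_transform_within[OF _ zero_less_one])
  ultimately show ?case by simp
qed

lemma Ck_on_Suc_imp_Ck_on: "Ck_on (Suc k) S f \<Longrightarrow> Ck_on k S f"
proof (induction k arbitrary: f)
  case 0
  then show ?case by (simp add: differentiable_imp_continuous_on)
next
  case (Suc k)
  have "f differentiable_on S" "\<And>v. Ck_on (Suc k) S (\<lambda>x. frechet_derivative f (at x) v)"
    using Suc.prems by simp_all
  then show ?case
    using Suc.IH by simp
qed

lemma Ck_on_Suc_has_derivative:
  assumes "open S" "Ck_on (Suc k) S f" "x \<in> S"
  shows "(f has_derivative frechet_derivative f (at x)) (at x)"
  using assms by (simp add: differentiable_on_eq_differentiable_at frechet_derivative_works)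

lemma Ck_on_SucI:
  assumes "open S" and D: "\<And>x. x \<in> S \<Longrightarrow> (f has_derivative f' x) (at x)"
    and C: "\<And>v. Ck_on k S (\<lambda>x. f' x v)"
  shows "Ck_on (Suc k) S f"
proof -
  have "frechet_derivative f (at x) = f' x" if "x \<in> S" for x
    using frechet_derivative_at[OF D[OF that]] by simp
  then have "Ck_on k S (\<lambda>x. frechet_derivative f (at x) v)" for v
    using C Ck_on_cong[OF assms(1), of "\<lambda>x. frechet_derivative f (at x) v" "\<lambda>x. f' x v"] by simp
  then show ?thesis
    using D by (auto simp: differentiable_on_eq_differentiable_at[OF assms(1)] differentiable_def)
qed

lemma Ck_on_const: "open S \<Longrightarrow> Ck_on k S (\<lambda>x. c)"
  by (induction k arbitrary: c) (simp, rule Ck_on_SucI, auto intro: derivative_eq_intros)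

lemma Ck_on_add:
  assumes "open S"
  shows "Ck_on k S f \<Longrightarrow> Ck_on k S g \<Longrightarrow> Ck_on k S (\<lambda>x. f x + g x)"
proof (induction k arbitrary: f g)
  case 0
  then show ?case by (simp add: continuous_on_add)
next
  case (Suc k)
  show ?case
  proof (rule Ck_on_SucI[OF assms])
    show "((\<lambda>x. f x + g x) has_derivative
        (\<lambda>v. frechet_derivative f (at x) v + frechet_derivative g (at x) v)) (at x)" if "x \<in> S" for x
      by (intro has_derivative_add Ck_on_Suc_has_derivative[OF assms _ that]) (fact Suc.prems)+
  qed (use Suc in auto)
qed


lemma Ck_on_bilinear:
  fixes prod :: "'a::euclidean_space \<Rightarrow> 'b::euclidean_space \<Rightarrow> 'c::euclidean_space"
  assumes "bounded_bilinear prod" "open S"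
  shows "Ck_on k S f \<Longrightarrow> Ck_on k S g \<Longrightarrow> Ck_on k S (\<lambda>x. prod (f x) (g x))"
proof (induction k arbitrary: f g)
  case 0
  then show ?case by (simp add: bounded_bilinear.continuous_on[OF assms(1)])
next
  case (Suc k)
  show ?case
  proof (rule Ck_on_SucI[OF assms(2)])
    show "((\<lambda>x. prod (f x) (g x)) has_derivative
        (\<lambda>v. prod (f x) (frechet_derivative g (at x) v) + prod (frechet_derivative f (at x) v) (g x))) (at x)"
      if "x \<in> S" for x
      by (intro bounded_bilinear.FDERIV[OF assms(1)] Ck_on_Suc_has_derivative[OF assms(2) _ that]) (fact Suc.prems)+
    show "Ck_on k S (\<lambda>x. prod (f x) (frechet_derivative g (at x) v) + prod (frechet_derivative f (at x) v) (g x))"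
      for v
      using Suc.prems Suc.prems[THEN Ck_on_Suc_imp_Ck_on]
      by (intro Ck_on_add assms Suc.IH) simp_all
  qed
qed

lemma Ck_on_linear:
  fixes L :: "'a::euclidean_space \<Rightarrow> 'b::euclidean_space"
  assumes "bounded_linear L" "open S"
  shows "Ck_on k S f \<Longrightarrow> Ck_on k S (\<lambda>x. L (f x))"
proof (induction k arbitrary: f)
  case 0
  then show ?case by (simp add: bounded_linear.continuous_on[OF assms(1)])
next
  case (Suc k)
  show ?case
  proof (rule Ck_on_SucI[OF assms(2)])
    show "((\<lambda>x. L (f x)) has_derivative (\<lambda>v. L (frechet_derivative f (at x) v))) (at x)" if "x \<in> S" for x
      by (intro bounded_linear.has_derivative[OF assms(1)] Ck_on_Suc_has_derivative[OF assms(2) _ that]) (fact Suc.prems)+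
    show "Ck_on k S (\<lambda>x. L (frechet_derivative f (at x) v))" for v
      using Suc.prems by (intro Suc.IH) simp
  qed
qed

lemma Ck_on_id: "open S \<Longrightarrow> Ck_on k S (\<lambda>x. x)"
proof (cases k)
  case (Suc m)
  assume "open S"
  then show ?thesis
    unfolding Suc by (rule Ck_on_SucI[where f' = "\<lambda>x v. v"]) (auto intro: Ck_on_const \<open>open S\<close>)
qed simp

lemma Ck_on_sum:
  assumes "open S" "\<And>i. i \<in> A \<Longrightarrow> Ck_on k S (f i)"
  shows "Ck_on k S (\<lambda>x. \<Sum>i\<in>A. f i x)"
  using assms(2)
  by (induction A rule: infinite_finite_induct) (auto intro: Ck_on_const Ck_on_add assms(1))

lemma Ck_on_subset:
  assumes "open S" "T \<subseteq> S" "open T"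
  shows "Ck_on k S f \<Longrightarrow> Ck_on k T f"
  by (induction k arbitrary: f) (use assms in \<open>auto intro: continuous_on_subset differentiable_on_subset\<close>)

lemma Ck_on_compose:
  assumes "open S" "open T" "\<And>x. x \<in> S \<Longrightarrow> f x \<in> T"
  shows "Ck_on k S f \<Longrightarrow> Ck_on k T g \<Longrightarrow> Ck_on k S (\<lambda>x. g (f x))"
proof (induction k arbitrary: g)
  case 0
  then show ?case
    using continuous_on_compose2[of T g S f] assms(3) by auto
next
  case (Suc k)
  have g: "(g has_derivative frechet_derivative g (at (f x))) (at (f x))" if "x \<in> S" for x
    using Ck_on_Suc_has_derivative[OF assms(2) Suc.prems(2)] assms(3) that by blast
  show ?case
  proof (rule Ck_on_SucI[OF assms(1)])
    \<comment> \<open>Expanding the inner derivative in a basis turns the chain rule into a sum of products of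
      directional derivatives, to which the induction hypothesis applies.\<close>
    show "((\<lambda>x. g (f x)) has_derivative (\<lambda>v. \<Sum>b\<in>Basis.
        (frechet_derivative f (at x) v \<bullet> b) *\<^sub>R frechet_derivative g (at (f x)) b)) (at x)"
      if "x \<in> S" for x
    proof -
      have "((\<lambda>x. g (f x)) has_derivative (\<lambda>v. frechet_derivative g (at (f x)) (frechet_derivative f (at x) v))) (at x)"
        by (rule has_derivative_compose[OF Ck_on_Suc_has_derivative[OF assms(1) Suc.prems(1) that] g[OF that]])
      then show ?thesis
      proof (rule has_derivative_eq_rhs, intro ext)
        fix v
        let ?w = "frechet_derivative f (at x) v"
        have lin: "linear (frechet_derivative g (at (f x)))"
          using g[OF that] by (rule has_derivative_linear)
        have "frechet_derivative g (at (f x)) ?w = frechet_derivative g (at (f x)) (\<Sum>b\<in>Basis. (?w \<bullet> b) *\<^sub>R b)"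
          by (simp only: euclidean_representation)
        also have "\<dots> = (\<Sum>b\<in>Basis. frechet_derivative g (at (f x)) ((?w \<bullet> b) *\<^sub>R b))"
          by (rule linear_sum[OF lin])
        finally show "frechet_derivative g (at (f x)) ?w =
            (\<Sum>b\<in>Basis. (?w \<bullet> b) *\<^sub>R frechet_derivative g (at (f x)) b)"
          by (simp only: linear_scale[OF lin])
      qed
    qed
    show "Ck_on k S (\<lambda>x. \<Sum>b\<in>Basis.
        (frechet_derivative f (at x) v \<bullet> b) *\<^sub>R frechet_derivative g (at (f x)) b)" for v
    proof (intro Ck_on_sum assms Ck_on_bilinear[OF bounded_bilinear_scaleR] Ck_on_bilinear[OF bounded_bilinear_inner])
      fix b :: 'b
      show "Ck_on k S (\<lambda>x. frechet_derivative g (at (f x)) b)"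
        by (rule Suc.IH[of "\<lambda>y. frechet_derivative g (at y) b"]) (use Suc.prems Ck_on_Suc_imp_Ck_on in auto)
    qed (use Suc.prems Ck_on_const assms in auto)
  qed
qed

lemma Ck_on_inverse:
  fixes f :: "'a::euclidean_space \<Rightarrow> real"
  assumes "open S" "\<And>x. x \<in> S \<Longrightarrow> f x \<noteq> 0"
  shows "Ck_on k S f \<Longrightarrow> Ck_on k S (\<lambda>x. inverse (f x))"
proof (induction k)
  case 0
  then show ?case using assms by (simp add: continuous_on_inverse)
next
  case (Suc k)
  show ?case
  proof (rule Ck_on_SucI[OF assms(1)])
    show "((\<lambda>x. inverse (f x)) has_derivative
       (\<lambda>v. - (inverse (f x) * frechet_derivative f (at x) v * inverse (f x)))) (at x)" if "x \<in> S" for x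
      by (intro Deriv.has_derivative_inverse Ck_on_Suc_has_derivative[OF assms(1) Suc.prems that] assms(2) that)
    show "Ck_on k S (\<lambda>x. - (inverse (f x) * frechet_derivative f (at x) v * inverse (f x)))" for v
      using Suc Ck_on_Suc_imp_Ck_on[OF Suc.prems]
      by (intro Ck_on_linear[OF bounded_linear_minus[OF bounded_linear_ident]]
            Ck_on_bilinear[OF bounded_bilinear_mult] assms) auto
  qed
qed


lemma smooth_on_open: "smooth_on S f \<Longrightarrow> open S"
  by (simp add: smooth_on_def)

lemma smooth_on_Ck: "smooth_on S f \<Longrightarrow> Ck_on k S f"
  by (simp add: smooth_on_def)

lemma smooth_on_has_derivative:
  "smooth_on S f \<Longrightarrow> x \<in> S \<Longrightarrow> (f has_derivative frechet_derivative f (at x)) (at x)"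
  using Ck_on_Suc_has_derivative smooth_on_Ck smooth_on_open by blast

lemma smooth_on_directional_derivative:
  "smooth_on S f \<Longrightarrow> smooth_on S (\<lambda>x. frechet_derivative f (at x) v)"
  unfolding smooth_on_def using Ck_on.simps(2) by blast

lemma smooth_on_continuous: "smooth_on S f \<Longrightarrow> continuous_on S f"
  using smooth_on_Ck[of S f 0] by simp

lemma smooth_on_subset: "smooth_on S f \<Longrightarrow> open T \<Longrightarrow> T \<subseteq> S \<Longrightarrow> smooth_on T f"
  unfolding smooth_on_def by (metis Ck_on_subset)

lemma smooth_on_cong:
  "(\<And>x. x \<in> S \<Longrightarrow> f x = g x) \<Longrightarrow> smooth_on S f \<longleftrightarrow> smooth_on S g"
  using Ck_on_cong[of S f g] by (auto simp: smooth_on_def)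

lemma smooth_on_const: "open S \<Longrightarrow> smooth_on S (\<lambda>x. c)"
  by (simp add: smooth_on_def Ck_on_const)

lemma smooth_on_id: "open S \<Longrightarrow> smooth_on S (\<lambda>x. x)"
  by (simp add: smooth_on_def Ck_on_id)

lemma smooth_on_linear: "bounded_linear L \<Longrightarrow> smooth_on S f \<Longrightarrow> smooth_on S (\<lambda>x. L (f x))"
  by (simp add: smooth_on_def Ck_on_linear)

lemma smooth_on_bilinear:
  "bounded_bilinear prod \<Longrightarrow> smooth_on S f \<Longrightarrow> smooth_on S g \<Longrightarrow> smooth_on S (\<lambda>x. prod (f x) (g x))"
  for prod :: "'a::euclidean_space \<Rightarrow> 'b::euclidean_space \<Rightarrow> 'c::euclidean_space"
  by (simp add: smooth_on_def Ck_on_bilinear)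

lemma smooth_on_compose:
  "smooth_on T g \<Longrightarrow> smooth_on S f \<Longrightarrow> (\<And>x. x \<in> S \<Longrightarrow> f x \<in> T) \<Longrightarrow> smooth_on S (\<lambda>x. g (f x))"
  unfolding smooth_on_def using Ck_on_compose by blast

lemma smooth_on_inverse:
  "smooth_on S f \<Longrightarrow> (\<And>x. x \<in> S \<Longrightarrow> f x \<noteq> 0) \<Longrightarrow> smooth_on S (\<lambda>x. inverse (f x :: real))"
  by (simp add: smooth_on_def Ck_on_inverse)

lemma smooth_on_sum:
  "open S \<Longrightarrow> (\<And>i. i \<in> A \<Longrightarrow> smooth_on S (f i)) \<Longrightarrow> smooth_on S (\<lambda>x. \<Sum>i\<in>A. f i x)"
  by (simp add: smooth_on_def Ck_on_sum)

lemma smooth_on_add: "smooth_on S f \<Longrightarrow> smooth_on S g \<Longrightarrow> smooth_on S (\<lambda>x. f x + g x)"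
  by (simp add: smooth_on_def Ck_on_add)

lemma smooth_on_minus: "smooth_on S f \<Longrightarrow> smooth_on S (\<lambda>x. - f x)"
  by (rule smooth_on_linear[OF bounded_linear_minus[OF bounded_linear_ident]])

lemma smooth_on_diff: "smooth_on S f \<Longrightarrow> smooth_on S g \<Longrightarrow> smooth_on S (\<lambda>x. f x - g x)"
  using smooth_on_add[of S f "\<lambda>x. - g x"] smooth_on_minus[of S g] by simp

lemmas smooth_on_inner = smooth_on_bilinear[OF bounded_bilinear_inner]
  and smooth_on_scaleR = smooth_on_bilinear[OF bounded_bilinear_scaleR]
  and smooth_on_mult = smooth_on_bilinear[OF bounded_bilinear_mult[where 'a = real]]
  and smooth_on_fst = smooth_on_linear[OF bounded_linear_fst]
  and smooth_on_snd = smooth_on_linear[OF bounded_linear_snd]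
  and smooth_on_vec_nth = smooth_on_linear[OF bounded_linear_vec_nth]

lemma smooth_on_Pair:
  fixes f :: "'a::euclidean_space \<Rightarrow> 'b::euclidean_space" and g :: "'a \<Rightarrow> 'c::euclidean_space"
  assumes "smooth_on S f" "smooth_on S g"
  shows "smooth_on S (\<lambda>x. (f x, g x))"
proof -
  have 1: "bounded_linear (\<lambda>y::'b. (y, 0::'c))" and 2: "bounded_linear (\<lambda>y::'c. (0::'b, y))"
    by (auto intro!: bounded_linear_Pair bounded_linear_ident bounded_linear_zero)
  have "smooth_on S (\<lambda>x. (f x, 0) + (0, g x))"
    by (intro smooth_on_add smooth_on_linear[OF 1] smooth_on_linear[OF 2] assms)
  then show ?thesis by simp
qed

lemma smooth_on_vecI:
  fixes f :: "'a::euclidean_space \<Rightarrow> 'b::euclidean_space ^ 'n"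
  assumes "open S" "\<And>i. smooth_on S (\<lambda>x. f x $ i)"
  shows "smooth_on S f"
proof -
  have L: "bounded_linear (\<lambda>y::'b. axis i y :: 'b ^ 'n)" for i
    by (intro linear_conv_bounded_linear[THEN iffD1] linearI)
      (auto simp: vec_eq_iff axis_def)
  have "smooth_on S (\<lambda>x. \<Sum>i\<in>UNIV. axis i (f x $ i))"
    by (intro smooth_on_sum smooth_on_linear[OF L] assms)
  moreover have "(\<Sum>i\<in>UNIV. axis i (f x $ i)) = f x" for x
    by (simp add: vec_eq_iff axis_def if_distrib[of "\<lambda>g. g _"] if_distrib cong: if_cong)
  ultimately show ?thesis by simp
qed

lemma smooth_on_prod:
  fixes f :: "'i \<Rightarrow> 'a::euclidean_space \<Rightarrow> real"
  assumes "open S" "\<And>i. i \<in> A \<Longrightarrow> smooth_on S (f i)"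
  shows "smooth_on S (\<lambda>x. \<Prod>i\<in>A. f i x)"
  using assms(2)
  by (induction A rule: infinite_finite_induct) (auto intro: smooth_on_const smooth_on_mult assms(1))

lemma smooth_on_det:
  fixes M :: "'a::euclidean_space \<Rightarrow> real ^ 'n ^ 'n"
  assumes "smooth_on S M"
  shows "smooth_on S (\<lambda>x. det (M x))"
  unfolding det_def
  by (intro smooth_on_sum smooth_on_mult smooth_on_prod smooth_on_const smooth_on_vec_nth
      smooth_on_open[OF assms] assms)

lemma bounded_bilinear_matrix_vector_mult:
  "bounded_bilinear ((*v) :: real ^ 'n ^ 'm \<Rightarrow> real ^ 'n \<Rightarrow> real ^ 'm)"
  by (intro bilinear_conv_bounded_bilinear[THEN iffD1])
    (auto simp: bilinear_def intro!: linearI simp: matrix_vector_mult_add_rdistrib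
      matrix_vector_right_distrib matrix_vector_mult_scaleR scaleR_matrix_vector_assoc)

lemma bounded_bilinear_matrix_matrix_mult:
  "bounded_bilinear ((**) :: real ^ 'n ^ 'm \<Rightarrow> real ^ 'k ^ 'n \<Rightarrow> real ^ 'k ^ 'm)"
  by (intro bilinear_conv_bounded_bilinear[THEN iffD1])
    (auto simp: bilinear_def intro!: linearI simp: matrix_add_ldistrib matrix_scaleR
      matrix_matrix_mult_def vec_eq_iff sum.distrib algebra_simps sum_distrib_left)

lemma bounded_linear_transpose: "bounded_linear (transpose :: real ^ 'n ^ 'm \<Rightarrow> real ^ 'm ^ 'n)"
  by (intro linear_conv_bounded_linear[THEN iffD1] linearI) (auto simp: transpose_def vec_eq_iff)

lemmas smooth_on_matrix_vector = smooth_on_bilinear[OF bounded_bilinear_matrix_vector_mult]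
  and smooth_on_matrix_matrix = smooth_on_bilinear[OF bounded_bilinear_matrix_matrix_mult]
  and smooth_on_transpose = smooth_on_linear[OF bounded_linear_transpose]

lemma matrix_inv_works:
  fixes A :: "real ^ 'n ^ 'n"
  assumes "invertible A"
  shows "A ** matrix_inv A = mat 1" "matrix_inv A ** A = mat 1"
  using someI_ex[OF assms[unfolded invertible_def]] by (simp_all add: matrix_inv_def)

text \<open>Cramer's rule writes the inverse matrix as a rational expression in the entries.\<close>

lemma smooth_on_matrix_inv:
  fixes M :: "'a::euclidean_space \<Rightarrow> real ^ 'n ^ 'n"
  assumes "smooth_on S M" "\<And>x. x \<in> S \<Longrightarrow> invertible (M x)"
  shows "smooth_on S (\<lambda>x. matrix_inv (M x))"
proof (intro smooth_on_vecI smooth_on_open[OF assms(1)])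
  fix i j :: 'n
  let ?C = "\<lambda>x. (\<chi> k l. if l = i then axis j 1 $ k else M x $ k $ l) :: real ^ 'n ^ 'n"
  have "smooth_on S (\<lambda>x. if l = i then axis j 1 $ k else M x $ k $ l)" for k l
    using smooth_on_open[OF assms(1)]
    by (cases "l = i") (auto intro!: smooth_on_const smooth_on_vec_nth assms(1))
  then have "smooth_on S ?C"
    using smooth_on_open[OF assms(1)] by (intro smooth_on_vecI) simp_all
  then have "smooth_on S (\<lambda>x. det (?C x) * inverse (det (M x)))"
    using assms by (intro smooth_on_mult smooth_on_det smooth_on_inverse) (auto simp: invertible_det_nz)
  moreover have "det (?C x) * inverse (det (M x)) = matrix_inv (M x) $ i $ j" if "x \<in> S" for x
  proof -
    have "M x *v (matrix_inv (M x) *v axis j 1) = axis j 1"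
      using assms(2)[OF that] by (simp add: matrix_vector_mul_assoc matrix_inv_works)
    then have "matrix_inv (M x) *v axis j 1 =
        (\<chi> k. det (\<chi> r l. if l = k then axis j 1 $ r else M x $ r $ l) / det (M x))"
      using cramer assms(2)[OF that] invertible_det_nz by blast
    then have "(matrix_inv (M x) *v axis j 1) $ i = det (?C x) / det (M x)"
      by simp
    then show ?thesis
      by (simp add: matrix_vector_mul_component inner_axis divide_inverse)
  qed
  ultimately show "smooth_on S (\<lambda>x. matrix_inv (M x) $ i $ j)"
    by (simp cong: smooth_on_cong)
qed

text \<open>A map whose derivative is at least as regular as the map itself is smooth. Solutions of differential
equations and inverses of smooth maps are of this kind.\<close>

lemma smooth_onI_bootstrap:
  assumes "open S" "\<And>x. x \<in> S \<Longrightarrow> (f has_derivative f' x) (at x)"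
    and "\<And>k v. Ck_on k S f \<Longrightarrow> Ck_on k S (\<lambda>x. f' x v)"
  shows "smooth_on S f"
proof -
  have "Ck_on k S f" for k
  proof (induction k)
    case 0
    show ?case
      using assms(2)[THEN has_derivative_continuous] by (simp add: continuous_on_eq_continuous_at assms(1))
  next
    case (Suc k)
    then show ?case
      using Ck_on_SucI assms by blast
  qed
  then show ?thesis
    using assms(1) by (simp add: smooth_on_def)
qed

section \<open>Symmetry of second derivatives\<close>

text \<open>Two applications of the mean value theorem, along \<open>u\<close> and then along \<open>v\<close>. The second difference on
the left is unchanged when \<open>u\<close> and \<open>v\<close> are exchanged, the expression on the right is not.\<close>

lemma second_difference_mean_value:
  fixes f :: "'a::euclidean_space \<Rightarrow> real"
  assumes "smooth_on S f" "0 < h"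
    and sub: "\<And>s t. 0 \<le> s \<Longrightarrow> s \<le> h \<Longrightarrow> 0 \<le> t \<Longrightarrow> t \<le> h \<Longrightarrow> x + s *\<^sub>R u + t *\<^sub>R v \<in> S"
  obtains s t where "0 < s" "s < h" "0 < t" "t < h"
    "f (x + h *\<^sub>R u + h *\<^sub>R v) - f (x + h *\<^sub>R u) - f (x + h *\<^sub>R v) + f x
      = h * h * frechet_derivative (\<lambda>y. frechet_derivative f (at y) u) (at (x + s *\<^sub>R u + t *\<^sub>R v)) v"
proof -
  let ?D = "\<lambda>y. frechet_derivative f (at y) u"
  have line: "((\<lambda>s. g (a + s *\<^sub>R w)) has_real_derivative frechet_derivative g (at (a + s *\<^sub>R w)) w) (at s)"
    if "smooth_on S g" "a + s *\<^sub>R w \<in> S" for g :: "'a \<Rightarrow> real" and a w s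
  proof -
    have "((\<lambda>s. g (a + s *\<^sub>R w)) has_derivative (\<lambda>r. frechet_derivative g (at (a + s *\<^sub>R w)) (r *\<^sub>R w))) (at s)"
      by (rule has_derivative_compose[where f = "\<lambda>s. a + s *\<^sub>R w", OF _ smooth_on_has_derivative[OF that]])
        (auto intro!: derivative_eq_intros)
    moreover have "frechet_derivative g (at (a + s *\<^sub>R w)) (r *\<^sub>R w) = frechet_derivative g (at (a + s *\<^sub>R w)) w * r" for r
      using linear_scale[OF has_derivative_linear[OF smooth_on_has_derivative[OF that]]] by simp
    ultimately show ?thesis
      by (simp add: has_field_derivative_def)
  qed
  have "\<exists>s>0. s < h \<and>
     (f (x + h *\<^sub>R v + h *\<^sub>R u) - f (x + h *\<^sub>R u)) - (f (x + h *\<^sub>R v + 0 *\<^sub>R u) - f (x + 0 *\<^sub>R u))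
     = (h - 0) * (?D (x + h *\<^sub>R v + s *\<^sub>R u) - ?D (x + s *\<^sub>R u))"
  proof (rule MVT2[OF \<open>0 < h\<close>])
    fix s assume "0 \<le> s" "s \<le> h"
    then show "((\<lambda>s. f (x + h *\<^sub>R v + s *\<^sub>R u) - f (x + s *\<^sub>R u)) has_real_derivative
        ?D (x + h *\<^sub>R v + s *\<^sub>R u) - ?D (x + s *\<^sub>R u)) (at s)"
      using sub[of s h] sub[of s 0] \<open>0 < h\<close>
      by (intro DERIV_diff line[OF assms(1)]) (simp_all add: algebra_simps)
  qed
  then obtain s where s: "0 < s" "s < h"
    "(f (x + h *\<^sub>R v + h *\<^sub>R u) - f (x + h *\<^sub>R u)) - (f (x + h *\<^sub>R v) - f x)
     = h * (?D (x + h *\<^sub>R v + s *\<^sub>R u) - ?D (x + s *\<^sub>R u))"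
    by auto
  have "\<exists>t>0. t < h \<and> ?D (x + s *\<^sub>R u + h *\<^sub>R v) - ?D (x + s *\<^sub>R u + 0 *\<^sub>R v)
     = (h - 0) * frechet_derivative ?D (at (x + s *\<^sub>R u + t *\<^sub>R v)) v"
    using s sub by (intro MVT2[OF \<open>0 < h\<close>] line smooth_on_directional_derivative assms(1)) auto
  then obtain t where t: "0 < t" "t < h"
    "?D (x + s *\<^sub>R u + h *\<^sub>R v) - ?D (x + s *\<^sub>R u)
     = h * frechet_derivative ?D (at (x + s *\<^sub>R u + t *\<^sub>R v)) v"
    by auto
  show ?thesis
    by (rule that[OF s(1,2) t(1,2)]) (use s(3) t(3) in \<open>simp add: algebra_simps\<close>)
qed

text \<open>If the two iterated derivatives differed at \<open>x\<close>, then by continuity they would differ by more than a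
fixed amount on a neighbourhood, whereas the symmetric second difference produces nearby points at
which they agree.\<close>

lemma second_derivative_symmetric_real:
  fixes f :: "'a::euclidean_space \<Rightarrow> real"
  assumes f: "smooth_on S f" and "x \<in> S"
  shows "frechet_derivative (\<lambda>y. frechet_derivative f (at y) u) (at x) v
       = frechet_derivative (\<lambda>y. frechet_derivative f (at y) v) (at x) u"
proof (rule ccontr)
  let ?F = "\<lambda>u v y. frechet_derivative (\<lambda>y. frechet_derivative f (at y) u) (at y) v"
  assume "?F u v x \<noteq> ?F v u x"
  define e where "e = \<bar>?F u v x - ?F v u x\<bar> / 2"
  have "e > 0"
    using \<open>?F u v x \<noteq> ?F v u x\<close> by (simp add: e_def)
  have "isCont (?F u v) x" for u v
    using smooth_on_continuous[OF smooth_on_directional_derivative[OF smooth_on_directional_derivative[OF f]]]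
      smooth_on_open[OF f] \<open>x \<in> S\<close> continuous_on_eq_continuous_at by blast
  then have "\<exists>d>0. \<forall>y. dist y x < d \<longrightarrow> \<bar>?F u v y - ?F u v x\<bar> < e" for u v
    using \<open>e > 0\<close> by (simp add: continuous_at_eps_delta dist_real_def)
  then obtain d1 d2 where d: "d1 > 0" "d2 > 0"
    "\<And>y. dist y x < d1 \<Longrightarrow> \<bar>?F u v y - ?F u v x\<bar> < e"
    "\<And>y. dist y x < d2 \<Longrightarrow> \<bar>?F v u y - ?F v u x\<bar> < e"
    by meson
  obtain d3 where d3: "d3 > 0" "ball x d3 \<subseteq> S"
    using smooth_on_open[OF f] \<open>x \<in> S\<close> open_contains_ball by blast
  define d where "d = min d1 (min d2 d3)"
  define h where "h = d / (norm u + norm v + 1)"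
  have "d > 0" "h > 0"
    using d d3 by (auto simp: d_def h_def intro!: divide_pos_pos add_nonneg_pos)
  have near: "dist (x + s *\<^sub>R a + t *\<^sub>R b) x < d" if "0 \<le> s" "s \<le> h" "0 \<le> t" "t \<le> h"
      and ab: "norm a + norm b = norm u + norm v" for s t a b
  proof -
    have "dist (x + s *\<^sub>R a + t *\<^sub>R b) x = norm (s *\<^sub>R a + t *\<^sub>R b)"
      by (simp add: dist_norm add.assoc)
    also have "\<dots> \<le> s * norm a + t * norm b"
      using norm_triangle_ineq[of "s *\<^sub>R a" "t *\<^sub>R b"] that by simp
    also have "\<dots> \<le> h * norm a + h * norm b"
      using that by (intro add_mono mult_right_mono) auto
    also have "\<dots> = h * (norm u + norm v)"
      using ab by (simp flip: distrib_left)
    also have "\<dots> < h * (norm u + norm v + 1)"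
      using \<open>h > 0\<close> by simp
    also have "\<dots> = d"
      using norm_ge_zero[of u] norm_ge_zero[of v] unfolding h_def by (simp add: add_nonneg_eq_0_iff)
    finally show ?thesis .
  qed
  have inS: "y \<in> S" if "dist y x < d" for y
    using d3 that by (auto simp: d_def dist_commute subset_iff)
  have 1: "norm u + norm v = norm u + norm v" "norm v + norm u = norm u + norm v"
    by simp_all
  obtain s t where st: "0 < s" "s < h" "0 < t" "t < h"
    "f (x + h *\<^sub>R u + h *\<^sub>R v) - f (x + h *\<^sub>R u) - f (x + h *\<^sub>R v) + f x
      = h * h * ?F u v (x + s *\<^sub>R u + t *\<^sub>R v)"
    using second_difference_mean_value[OF f \<open>0 < h\<close> inS[OF near[OF _ _ _ _ 1(1)]]] by blast
  obtain s' t' where st': "0 < s'" "s' < h" "0 < t'" "t' < h"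
    "f (x + h *\<^sub>R v + h *\<^sub>R u) - f (x + h *\<^sub>R v) - f (x + h *\<^sub>R u) + f x
      = h * h * ?F v u (x + s' *\<^sub>R v + t' *\<^sub>R u)"
    using second_difference_mean_value[OF f \<open>0 < h\<close> inS[OF near[OF _ _ _ _ 1(2)]]] by blast
  have "h * h * ?F u v (x + s *\<^sub>R u + t *\<^sub>R v) = h * h * ?F v u (x + s' *\<^sub>R v + t' *\<^sub>R u)"
    using st(5) st'(5) by (simp add: algebra_simps)
  then have "?F u v (x + s *\<^sub>R u + t *\<^sub>R v) = ?F v u (x + s' *\<^sub>R v + t' *\<^sub>R u)"
    using \<open>h > 0\<close> by simp
  moreover have "\<bar>?F u v (x + s *\<^sub>R u + t *\<^sub>R v) - ?F u v x\<bar> < e"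
    using near[OF _ _ _ _ 1(1), of s t] st by (intro d) (simp add: d_def)
  moreover have "\<bar>?F v u (x + s' *\<^sub>R v + t' *\<^sub>R u) - ?F v u x\<bar> < e"
    using near[OF _ _ _ _ 1(2), of s' t'] st' by (intro d) (simp add: d_def)
  ultimately have "\<bar>?F u v x - ?F v u x\<bar> < 2 * e"
    by linarith
  then show False
    by (simp add: e_def)
qed

lemma frechet_derivative_linear_compose:
  assumes "bounded_linear L" "f differentiable (at x)"
  shows "frechet_derivative (\<lambda>x. L (f x)) (at x) v = L (frechet_derivative f (at x) v)"
  using bounded_linear.has_derivative[OF assms(1) assms(2)[unfolded frechet_derivative_works]]
  by (metis frechet_derivative_at)

lemma smooth_on_differentiable: "smooth_on S f \<Longrightarrow> x \<in> S \<Longrightarrow> f differentiable (at x)"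
  using smooth_on_has_derivative differentiable_def by blast

text \<open>The vector-valued case is the scalar case applied to the components.\<close>

lemma second_derivative_symmetric:
  fixes f :: "'a::euclidean_space \<Rightarrow> 'b::euclidean_space"
  assumes f: "smooth_on S f" and "x \<in> S"
  shows "frechet_derivative (\<lambda>y. frechet_derivative f (at y) u) (at x) v
       = frechet_derivative (\<lambda>y. frechet_derivative f (at y) v) (at x) u"
proof (rule euclidean_eqI)
  fix b :: 'b
  have L: "bounded_linear (\<lambda>y. y \<bullet> b)"
    by (rule bounded_linear_inner_left)
  have fst_order: "frechet_derivative (\<lambda>y. f y \<bullet> b) (at y) u = frechet_derivative f (at y) u \<bullet> b" if "y \<in> S" for y u
    by (rule frechet_derivative_linear_compose[OF L smooth_on_differentiable[OF f that]])
  have "frechet_derivative (\<lambda>y. frechet_derivative f (at y) u) (at x) v \<bullet> b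
      = frechet_derivative (\<lambda>y. frechet_derivative (\<lambda>y. f y \<bullet> b) (at y) u) (at x) v" for u v
  proof -
    have "frechet_derivative (\<lambda>y. frechet_derivative f (at y) u) (at x) v \<bullet> b
        = frechet_derivative (\<lambda>y. frechet_derivative f (at y) u \<bullet> b) (at x) v"
      by (rule frechet_derivative_linear_compose[OF L, symmetric])
        (rule smooth_on_differentiable[OF smooth_on_directional_derivative[OF f] \<open>x \<in> S\<close>])
    also have "\<dots> = frechet_derivative (\<lambda>y. frechet_derivative (\<lambda>y. f y \<bullet> b) (at y) u) (at x) v"
      by (rule fun_cong[OF frechet_derivative_cong_open[OF smooth_on_open[OF f] \<open>x \<in> S\<close>]])
        (simp add: fst_order)
    finally show ?thesis .
  qed
  then show "frechet_derivative (\<lambda>y. frechet_derivative f (at y) u) (at x) v \<bullet> b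
      = frechet_derivative (\<lambda>y. frechet_derivative f (at y) v) (at x) u \<bullet> b"
    using second_derivative_symmetric_real[OF smooth_on_linear[OF L f] \<open>x \<in> S\<close>] by simp
qed

section \<open>Linear differential equations\<close>

text \<open>Picard iteration. The integral operator acts on bounded continuous functions on the whole line, the
time being clamped to the compact interval \<open>[-h, h]\<close>, so that the fixed point theorem applies in a
complete metric space.\<close>

lemma linear_ode_local_solution:
  fixes prod :: "'b::real_normed_vector \<Rightarrow> 'a::euclidean_space \<Rightarrow> 'a" and \<Lambda> :: "real \<Rightarrow> 'b"
  assumes prod: "bounded_bilinear prod" and "open J" "0 \<in> J" and cont: "continuous_on J \<Lambda>"
  obtains h f where "0 < h" "{-h<..<h} \<subseteq> J" "f 0 = a"
    "\<And>t. t \<in> {-h<..<h} \<Longrightarrow> (f has_vector_derivative prod (\<Lambda> t) (f t)) (at t)"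
proof -
  interpret bounded_bilinear prod by (fact prod)
  obtain r where r: "r > 0" "{-r..r} \<subseteq> J"
  proof -
    obtain e where "e > 0" "cball 0 e \<subseteq> J"
      using \<open>open J\<close> \<open>0 \<in> J\<close> open_contains_cball by blast
    then show ?thesis
      by (intro that[of e]) (auto simp: cball_eq_atLeastAtMost)
  qed
  have "bounded (\<Lambda> ` {-r..r})"
    using compact_continuous_image[OF continuous_on_subset[OF cont r(2)]] compact_imp_bounded by blast
  then obtain B where B: "B > 0" "\<And>t. t \<in> {-r..r} \<Longrightarrow> norm (\<Lambda> t) \<le> B"
    unfolding bounded_pos by blast
  obtain K where K: "K > 0" "\<And>x y. norm (prod x y) \<le> norm x * norm y * K"
    using pos_bounded by blast
  \<comment> \<open>Each of the two integrals in the operator below runs over an interval of length at most \<open>2 h\<close>, which makes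
      \<open>4 h B K\<close> a Lipschitz constant.\<close>
  define h where "h = min r (1 / (8 * (B * K)))"
  have "h > 0" "h \<le> r" "4 * h * (B * K) \<le> 1 / 2"
    using r B K by (auto simp: h_def min_def field_simps)
  have contF: "continuous_on {-h..h} (\<lambda>s. prod (\<Lambda> s) (apply_bcontfun f s))" for f :: "real \<Rightarrow>\<^sub>C 'a"
    using r \<open>h \<le> r\<close> by (intro continuous_on continuous_on_subset[OF cont]) auto
  define c where "c t = max (-h) (min h t)" for t
  have c: "c t \<in> {-h..h}" for t
    using \<open>h > 0\<close> by (auto simp: c_def)
  define T where "T f t = a + integral {-h..c t} (\<lambda>s. prod (\<Lambda> s) (apply_bcontfun f s))
      - integral {-h..0} (\<lambda>s. prod (\<Lambda> s) (apply_bcontfun f s))" for f :: "real \<Rightarrow>\<^sub>C 'a" and t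
  have "continuous_on UNIV (T f)" for f
  proof -
    have "continuous_on UNIV (\<lambda>t. integral {-h..c t} (\<lambda>s. prod (\<Lambda> s) (apply_bcontfun f s)))"
      by (rule continuous_on_compose2[OF indefinite_integral_continuous_1[OF integrable_continuous_real[OF contF]]])
        (use c in \<open>auto simp: c_def intro!: continuous_intros\<close>)
    then show ?thesis
      unfolding T_def by (intro continuous_intros)
  qed
  moreover have "bounded (range (T f))" for f
  proof -
    have "T f t \<in> T f ` {-h..h}" for t
    proof (rule image_eqI[of _ _ "c t"])
      have "c (c t) = c t"
        using c by (auto simp: c_def)
      then show "T f t = T f (c t)"
        by (simp add: T_def)
    qed (rule c)
    moreover have "bounded (T f ` {-h..h})"
      using compact_continuous_image[OF continuous_on_subset[OF \<open>continuous_on UNIV (T f)\<close>]] compact_imp_bounded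
      by blast
    ultimately show ?thesis
      by (metis bounded_subset image_subsetI)
  qed
  ultimately have T_bcontfun: "T f \<in> bcontfun" for f
    by (simp add: bcontfun_def)
  have lip: "dist (Bcontfun (T f)) (Bcontfun (T g)) \<le> 1 / 2 * dist f g" for f g
  proof (rule dist_bound)
    fix t
    let ?D = "\<lambda>s. prod (\<Lambda> s) (apply_bcontfun f s) - prod (\<Lambda> s) (apply_bcontfun g s)"
    have bnd: "norm (integral {-h..u} ?D) \<le> dist f g * (B * K) * (2 * h)" if "u \<in> {-h..h}" for u
    proof -
      have "norm (?D s) \<le> dist f g * (B * K)" if "s \<in> {-h..u}" for s
      proof -
        have s: "s \<in> {-r..r}"
          using that \<open>u \<in> _\<close> \<open>h \<le> r\<close> by auto
        have "norm (?D s) = norm (prod (\<Lambda> s) (apply_bcontfun f s - apply_bcontfun g s))"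
          by (simp add: diff_right)
        also have "\<dots> \<le> norm (\<Lambda> s) * norm (apply_bcontfun f s - apply_bcontfun g s) * K"
          by (rule K)
        also have "\<dots> \<le> B * dist f g * K"
          using dist_bounded[of f s g] K B(1) B(2)[OF s] by (intro mult_mono) (auto simp: dist_norm)
        finally show ?thesis
          by (simp add: mult_ac)
      qed
      then have "norm (integral {-h..u} ?D) \<le> dist f g * (B * K) * (u - (-h))"
        using that contF by (intro integral_bound continuous_on_diff) (auto intro: continuous_on_subset[OF contF])
      also have "\<dots> \<le> dist f g * (B * K) * (2 * h)"
        using that B K by (intro mult_left_mono) auto
      finally show ?thesis .
    qed
    have int: "integral {-h..u} ?D = integral {-h..u} (\<lambda>s. prod (\<Lambda> s) (apply_bcontfun f s))
        - integral {-h..u} (\<lambda>s. prod (\<Lambda> s) (apply_bcontfun g s))" if "u \<in> {-h..h}" for u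
      using that by (intro Henstock_Kurzweil_Integration.integral_diff integrable_continuous_real)
        (auto intro: continuous_on_subset[OF contF])
    have "dist (T f t) (T g t) = norm (integral {-h..c t} ?D - integral {-h..0} ?D)"
      using \<open>h > 0\<close> by (simp add: dist_norm T_def int[OF c] int algebra_simps)
    also have "\<dots> \<le> norm (integral {-h..c t} ?D) + norm (integral {-h..0} ?D)"
      by (rule norm_triangle_ineq4)
    also have "\<dots> \<le> dist f g * (B * K) * (2 * h) + dist f g * (B * K) * (2 * h)"
      using \<open>h > 0\<close> by (intro add_mono bnd c) auto
    also have "\<dots> = (4 * h * (B * K)) * dist f g"
      by (simp add: algebra_simps)
    also have "\<dots> \<le> 1 / 2 * dist f g"
      using \<open>4 * h * (B * K) \<le> 1 / 2\<close> by (intro mult_right_mono) auto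
    finally show "dist (apply_bcontfun (Bcontfun (T f)) t) (apply_bcontfun (Bcontfun (T g)) t) \<le> 1 / 2 * dist f g"
      by (simp add: Bcontfun_inverse T_bcontfun)
  qed
  have "\<exists>!f. Bcontfun (T f) = f"
  proof (rule banach_fix_type[of "1 / 2"])
    show "\<forall>f g. dist (Bcontfun (T f)) (Bcontfun (T g)) \<le> 1 / 2 * dist f g"
      using lip by blast
  qed simp_all
  then obtain f where "Bcontfun (T f) = f"
    by blast
  then have fixpoint: "apply_bcontfun f t = T f t" for t
    by (metis Bcontfun_inverse T_bcontfun)
  show ?thesis
  proof (rule that[of h "apply_bcontfun f"])
    show "{-h<..<h} \<subseteq> J"
      using r \<open>h \<le> r\<close> by auto
    show "apply_bcontfun f 0 = a"
      using \<open>h > 0\<close> by (subst fixpoint) (simp add: T_def c_def)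
    have eq: "a + integral {-h..t} (\<lambda>s. prod (\<Lambda> s) (apply_bcontfun f s))
        - integral {-h..0} (\<lambda>s. prod (\<Lambda> s) (apply_bcontfun f s)) = apply_bcontfun f t"
      if "t \<in> {-h<..<h}" for t
    proof -
      have "c t = t"
        using that by (simp add: c_def)
      then show ?thesis
        using fixpoint[of t] unfolding T_def by (simp only:)
    qed
    fix t :: real assume t: "t \<in> {-h<..<h}"
    have "((\<lambda>t. integral {-h..t} (\<lambda>s. prod (\<Lambda> s) (apply_bcontfun f s))) has_vector_derivative
        prod (\<Lambda> t) (apply_bcontfun f t)) (at t within {-h..h})"
      using t by (intro integral_has_vector_derivative contF) auto
    then have "((\<lambda>t. integral {-h..t} (\<lambda>s. prod (\<Lambda> s) (apply_bcontfun f s))) has_vector_derivative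
        prod (\<Lambda> t) (apply_bcontfun f t)) (at t)"
      using t at_within_interior[of t "{-h..h}"] by simp
    then have "((\<lambda>t. a + integral {-h..t} (\<lambda>s. prod (\<Lambda> s) (apply_bcontfun f s))
        - integral {-h..0} (\<lambda>s. prod (\<Lambda> s) (apply_bcontfun f s))) has_vector_derivative
        0 + prod (\<Lambda> t) (apply_bcontfun f t) - 0) (at t)"
      by (intro has_vector_derivative_add has_vector_derivative_diff has_vector_derivative_const)
    then have "((\<lambda>t. a + integral {-h..t} (\<lambda>s. prod (\<Lambda> s) (apply_bcontfun f s))
        - integral {-h..0} (\<lambda>s. prod (\<Lambda> s) (apply_bcontfun f s))) has_vector_derivative
        prod (\<Lambda> t) (apply_bcontfun f t)) (at t)"
      by simp
    then show "(apply_bcontfun f has_vector_derivative prod (\<Lambda> t) (apply_bcontfun f t)) (at t)"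
      by (rule has_vector_derivative_transform_within_open[where S = "{-h<..<h}"])
        (use t eq in simp_all)
  qed fact
qed

text \<open>Fewer than \<open>CARD('n)\<close> linear conditions have a nonzero common solution; vectors are added one at a
time and normalized for the form \<open>\<Gamma>\<close>.\<close>

lemma orthonormal_frame_exists:
  fixes \<Gamma> :: "real ^ 'n ^ 'n" and v :: "real ^ 'n"
  assumes pos: "\<And>u. u \<noteq> 0 \<Longrightarrow> 0 < u \<bullet> (\<Gamma> *v u)" and sym: "transpose \<Gamma> = \<Gamma>" and "card (J :: 'n set) < CARD('n)"
  shows "\<exists>a. \<forall>i\<in>J. a i \<bullet> (\<Gamma> *v v) = 0 \<and> (\<forall>j\<in>J. a i \<bullet> (\<Gamma> *v a j) = (if i = j then 1 else 0))"
proof -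
  have "finite J"
    by simp
  have sym': "x \<bullet> (\<Gamma> *v y) = y \<bullet> (\<Gamma> *v x)" for x y
    by (metis dot_lmul_matrix inner_commute matrix_vector_mul_component sym transpose_matrix_vector)
  show ?thesis
    using \<open>finite J\<close> assms(3)
  proof (induction J)
    case empty
    then show ?case by simp
  next
    case (insert k J)
    then obtain a where a: "\<And>i. i \<in> J \<Longrightarrow> a i \<bullet> (\<Gamma> *v v) = 0"
      "\<And>i j. i \<in> J \<Longrightarrow> j \<in> J \<Longrightarrow> a i \<bullet> (\<Gamma> *v a j) = (if i = j then 1 else 0)"
      by auto
    let ?S = "insert (\<Gamma> *v v) ((\<lambda>j. \<Gamma> *v a j) ` J)"
    have "dim ?S \<le> card ?S"
      using insert.hyps by (intro dim_le_card') auto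
    also have "\<dots> \<le> Suc (card J)"
      using insert.hyps by (intro order_trans[OF card_insert_le_m1] card_insert_le_m1) (auto intro: card_image_le)
    also have "\<dots> < DIM(real ^ 'n)"
      using insert by simp
    finally obtain w where w: "w \<noteq> 0" "\<And>y. y \<in> span ?S \<Longrightarrow> orthogonal w y"
      using orthogonal_to_subspace_exists by blast
    define b where "b = (1 / sqrt (w \<bullet> (\<Gamma> *v w))) *\<^sub>R w"
    have b: "b \<bullet> (\<Gamma> *v v) = 0" "\<And>j. j \<in> J \<Longrightarrow> b \<bullet> (\<Gamma> *v a j) = 0"
      using w(2) by (auto simp: b_def orthogonal_def intro: span_base)
    have bb: "b \<bullet> (\<Gamma> *v b) = 1"
      using pos[OF w(1)] by (simp add: b_def matrix_vector_mult_scaleR field_simps)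
    have "b \<bullet> (\<Gamma> *v a j) = 0 \<and> a j \<bullet> (\<Gamma> *v b) = 0" if "j \<in> J" for j
      using b(2)[OF that] sym'[of "a j" b] by simp
    then have "\<forall>i\<in>insert k J. (a(k := b)) i \<bullet> (\<Gamma> *v v) = 0 \<and>
        (\<forall>j\<in>insert k J. (a(k := b)) i \<bullet> (\<Gamma> *v (a(k := b)) j) = (if i = j then 1 else 0))"
      using insert.hyps a b(1) bb by (simp add: fun_upd_def)
    then show ?case
      by blast
  qed
qed

section \<open>Fibered symplectic maps\<close>

text \<open>Products with a transpose are kept in the form \<open>transpose A *v x\<close>, to which the adjointness rules
below apply.\<close>

declare transpose_matrix_vector [simp del]

lemma inner_transpose_left: "(transpose A *v x) \<bullet> y = x \<bullet> (A *v y)"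
  for A :: "real ^ 'n ^ 'm"
  by (simp add: transpose_matrix_vector dot_lmul_matrix)

lemma inner_transpose_right: "x \<bullet> (transpose A *v y) = (A *v x) \<bullet> y"
  for A :: "real ^ 'n ^ 'm"
  using inner_transpose_left[of A y x] by (simp add: inner_commute)

lemma inner_eq_leftI: "(\<And>z. z \<bullet> x = z \<bullet> y) \<Longrightarrow> x = y"
  for x y :: "'a::real_inner"
  by (metis vector_eq_ldot)

lemma linear_horizontal_vertical:
  fixes f :: "'a::real_vector \<times> 'b::real_vector \<Rightarrow> 'c::real_vector"
  assumes "linear f"
  shows "linear (\<lambda>u. f (u, 0))" "linear (\<lambda>v. f (0, v))"
proof -
  have "linear (\<lambda>u :: 'a. (u, 0 :: 'b))" "linear (\<lambda>v :: 'b. (0 :: 'a, v))"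
    by (auto intro!: linearI)
  from this[THEN linear_compose, OF assms]
  show "linear (\<lambda>u. f (u, 0))" "linear (\<lambda>v. f (0, v))"
    by (simp_all add: o_def)
qed

lemma derivative_vertical:
  assumes "(F has_derivative F') (at z)"
  shows "F' (0, v) = grad_p F z \<bullet> v"
proof -
  have F': "frechet_derivative F (at z) = F'"
    using frechet_derivative_at[OF assms] by simp
  have lin: "linear (\<lambda>v. F' (0, v))"
    by (rule linear_horizontal_vertical(2)[OF has_derivative_linear[OF assms]])
  have "F' (0, v) = F' (0, \<Sum>i\<in>UNIV. v $ i *\<^sub>R axis i 1)"
    using basis_expansion[of v] by (simp add: scalar_mult_eq_scaleR)
  also have "\<dots> = (\<Sum>i\<in>UNIV. v $ i *\<^sub>R F' (0, axis i 1))"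
    by (simp add: linear_sum[OF lin] linear_scale[OF lin])
  finally show ?thesis
    by (simp add: grad_p_def dp_def partial_deriv_def F' inner_vec_def mult.commute)
qed

lemma smooth_on_dp: "smooth_on S F \<Longrightarrow> smooth_on S (dp i F)"
  unfolding dp_def partial_deriv_def by (rule smooth_on_directional_derivative)

lemma smooth_on_grad_p: "smooth_on S F \<Longrightarrow> smooth_on S (grad_p F)"
  by (intro smooth_on_vecI) (simp_all add: grad_p_def smooth_on_dp smooth_on_open)

lemma derivative_vec_nth:
  assumes "f differentiable (at x)"
  shows "frechet_derivative f (at x) v $ i = frechet_derivative (\<lambda>x. f x $ i) (at x) v"
  using frechet_derivative_linear_compose[OF bounded_linear_vec_nth assms] by simp

lemma derivative_grad_p:
  assumes "smooth_on S F" "z \<in> S"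
  shows "frechet_derivative (grad_p F) (at z) u $ j = frechet_derivative (dp j F) (at z) u"
  using derivative_vec_nth[OF smooth_on_differentiable[OF smooth_on_grad_p[OF assms(1)] assms(2)]]
  by (simp add: grad_p_def)

lemma hess_pp_symmetric:
  assumes "smooth_on S F" "z \<in> S"
  shows "transpose (hess_pp F z) = hess_pp F z"
  using second_derivative_symmetric[OF assms]
  by (simp add: hess_pp_def transpose_def vec_eq_iff dp_def partial_deriv_def)

text \<open>The rows and the columns of \<open>hess_pp\<close> play different roles (outer and inner derivative), so that the
symmetry of second derivatives enters here.\<close>

lemma derivative_grad_p_vertical:
  assumes "smooth_on S F" "z \<in> S"
  shows "frechet_derivative (grad_p F) (at z) (0, v) = hess_pp F z *v v"
proof (subst vec_eq_iff, intro allI)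
  fix j
  have "frechet_derivative (grad_p F) (at z) (0, v) $ j = grad_p (dp j F) z \<bullet> v"
    using derivative_vertical[OF smooth_on_has_derivative[OF smooth_on_dp[OF assms(1)] assms(2)]]
    by (simp add: derivative_grad_p[OF assms])
  also have "\<dots> = (hess_pp F z *v v) $ j"
    using hess_pp_symmetric[OF assms]
    by (simp add: grad_p_def hess_pp_def transpose_def vec_eq_iff matrix_vector_mult_def inner_vec_def)
  finally show "frechet_derivative (grad_p F) (at z) (0, v) $ j = (hess_pp F z *v v) $ j" .
qed

definition base_jacobian :: "('n::finite phase \<Rightarrow> 'n phase) \<Rightarrow> 'n phase \<Rightarrow> real ^ 'n ^ 'n" where
  "base_jacobian \<psi> z = matrix (\<lambda>\<xi>. fst (frechet_derivative \<psi> (at z) (\<xi>, 0)))"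

definition fibre_jacobian :: "('n::finite phase \<Rightarrow> 'n phase) \<Rightarrow> 'n phase \<Rightarrow> real ^ 'n ^ 'n" where
  "fibre_jacobian \<psi> z = matrix (\<lambda>\<eta>. snd (frechet_derivative \<psi> (at z) (0, \<eta>)))"

context
  fixes W and \<psi> :: "'n::finite phase \<Rightarrow> 'n phase"
  assumes fib: "fibered_symplectic_diffeo W \<psi>"
begin

lemma fibered_smooth: "smooth_on W \<psi>"
  using fib by (simp add: fibered_symplectic_diffeo_def symplectic_diffeo_def)

lemma fibered_linear:
  assumes "z \<in> W"
  shows "linear (frechet_derivative \<psi> (at z))"
  using smooth_on_has_derivative[OF fibered_smooth assms] has_derivative_linear by blast

lemma base_jacobian_works:
  assumes "z \<in> W"
  shows "fst (frechet_derivative \<psi> (at z) (\<xi>, 0)) = base_jacobian \<psi> z *v \<xi>"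
proof -
  have "linear (\<lambda>\<xi>. fst (frechet_derivative \<psi> (at z) (\<xi>, 0)))"
    by (rule linear_compose[OF linear_horizontal_vertical(1)[OF fibered_linear[OF assms]] linear_fst, unfolded o_def])
  then show ?thesis
    by (simp add: base_jacobian_def matrix_works linear_matrix_vector_mul_eq)
qed

text \<open>A fibered map is constant in its base component along each fibre, so its derivative maps vertical
directions to vertical directions.\<close>

lemma fibered_derivative_vertical:
  assumes "z \<in> W"
  shows "frechet_derivative \<psi> (at z) (0, \<eta>) = (0, fibre_jacobian \<psi> z *v \<eta>)"
proof -
  have "linear (\<lambda>\<eta>. snd (frechet_derivative \<psi> (at z) (0, \<eta>)))"
    by (rule linear_compose[OF linear_horizontal_vertical(2)[OF fibered_linear[OF assms]] linear_snd, unfolded o_def])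
  then have "snd (frechet_derivative \<psi> (at z) (0, \<eta>)) = fibre_jacobian \<psi> z *v \<eta>"
    by (simp add: fibre_jacobian_def matrix_works linear_matrix_vector_mul_eq)
  moreover have "fst (frechet_derivative \<psi> (at z) (0, \<eta>)) = 0"
  proof -
    obtain \<phi> where \<phi>: "\<And>z. z \<in> W \<Longrightarrow> fst (\<psi> z) = \<phi> (fst z)"
      using fib by (auto simp: fibered_symplectic_diffeo_def horizontal_component_def)
    let ?l = "\<lambda>t::real. z + t *\<^sub>R (0, \<eta>)"
    have op: "open (?l -` W)"
      using smooth_on_open[OF fibered_smooth] by (intro open_vimage continuous_intros)
    have "((\<lambda>t. fst (\<psi> (?l t))) has_derivative (\<lambda>t. fst (frechet_derivative \<psi> (at z) (t *\<^sub>R (0, \<eta>))))) (at 0)"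
    proof -
      have "(\<psi> has_derivative frechet_derivative \<psi> (at z)) (at (?l 0))"
        using smooth_on_has_derivative[OF fibered_smooth assms] by (simp flip: zero_prod_def)
      then show ?thesis
        by (intro has_derivative_fst has_derivative_compose[where f = ?l and g = \<psi>])
          (auto intro!: derivative_eq_intros)
    qed
    moreover have "((\<lambda>t. fst (\<psi> (?l t))) has_derivative (\<lambda>t. 0)) (at 0)"
      by (rule has_derivative_transform_within_open[OF has_derivative_const op, of 0 "\<phi> (fst z)"])
        (use assms \<phi> in \<open>auto simp flip: zero_prod_def\<close>)
    ultimately have "(\<lambda>t. fst (frechet_derivative \<psi> (at z) (t *\<^sub>R (0, \<eta>)))) = (\<lambda>t. 0)"
      by (rule has_derivative_unique)
    then show ?thesis
      by (metis scaleR_one)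
  qed
  ultimately show ?thesis
    by (metis prod.collapse)
qed

lemma fibered_symplectic:
  assumes "z \<in> W"
  shows "symplectic_form (frechet_derivative \<psi> (at z) u) (frechet_derivative \<psi> (at z) v) = symplectic_form u v"
  using fib assms unfolding fibered_symplectic_diffeo_def symplectic_diffeo_def by blast

text \<open>The symplectic form pairs vertical with horizontal directions, which makes the derivative along
  the fibre the contragredient of the derivative of the base map.\<close>

lemma fibre_jacobian_contragredient:
  assumes "z \<in> W"
  shows "transpose (fibre_jacobian \<psi> z) ** base_jacobian \<psi> z = mat 1"
    "base_jacobian \<psi> z ** transpose (fibre_jacobian \<psi> z) = mat 1"
proof -
  have "(fibre_jacobian \<psi> z *v \<eta>) \<bullet> (base_jacobian \<psi> z *v \<xi>) = \<eta> \<bullet> \<xi>" for \<eta> \<xi>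
    using fibered_symplectic[OF assms, of "(0, \<eta>)" "(\<xi>, 0)"]
    by (simp add: symplectic_form_def fibered_derivative_vertical[OF assms] base_jacobian_works[OF assms])
  then have "\<eta> \<bullet> ((transpose (fibre_jacobian \<psi> z) ** base_jacobian \<psi> z) *v \<xi>) = \<eta> \<bullet> (mat 1 *v \<xi>)" for \<eta> \<xi>
    by (simp add: inner_transpose_right flip: matrix_vector_mul_assoc)
  from inner_eq_leftI[OF this] show "transpose (fibre_jacobian \<psi> z) ** base_jacobian \<psi> z = mat 1"
    by (simp add: matrix_eq)
  then show "base_jacobian \<psi> z ** transpose (fibre_jacobian \<psi> z) = mat 1"
    by (simp add: matrix_left_right_inverse)
qed

lemma base_jacobian_injective:
  assumes "z \<in> W" "base_jacobian \<psi> z *v u = base_jacobian \<psi> z *v v"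
  shows "u = v"
  using arg_cong[OF assms(2), of "(*v) (transpose (fibre_jacobian \<psi> z))"]
  by (simp add: matrix_vector_mul_assoc fibre_jacobian_contragredient(1)[OF assms(1)])

text \<open>The fibre derivative of a function is a velocity, that is a tangent vector of the base, and therefore
transforms by the differential of the base map.\<close>

lemma grad_p_fibered:
  assumes "z \<in> W" "F differentiable (at (\<psi> z))"
  shows "base_jacobian \<psi> z *v grad_p (F \<circ> \<psi>) z = grad_p F (\<psi> z)"
proof -
  have F: "(F has_derivative frechet_derivative F (at (\<psi> z))) (at (\<psi> z))"
    using assms(2) frechet_derivative_works by blast
  have comp: "((F \<circ> \<psi>) has_derivative frechet_derivative F (at (\<psi> z)) \<circ> frechet_derivative \<psi> (at z)) (at z)"
    using diff_chain_at[OF smooth_on_has_derivative[OF fibered_smooth assms(1)] F] .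
  have "\<eta> \<bullet> grad_p (F \<circ> \<psi>) z = \<eta> \<bullet> (transpose (fibre_jacobian \<psi> z) *v grad_p F (\<psi> z))" for \<eta>
    using derivative_vertical[OF comp, of \<eta>] derivative_vertical[OF F, of "fibre_jacobian \<psi> z *v \<eta>"]
    by (simp add: fibered_derivative_vertical[OF assms(1)] inner_transpose_right inner_commute)
  then have "grad_p (F \<circ> \<psi>) z = transpose (fibre_jacobian \<psi> z) *v grad_p F (\<psi> z)"
    by (rule inner_eq_leftI)
  then show ?thesis
    by (simp add: matrix_vector_mul_assoc fibre_jacobian_contragredient[OF assms(1)])
qed

lemma smooth_on_base_jacobian: "smooth_on W (base_jacobian \<psi>)"
proof (intro smooth_on_vecI smooth_on_open[OF fibered_smooth])
  fix i j
  have "smooth_on W (\<lambda>z. fst (frechet_derivative \<psi> (at z) (axis j 1, 0)) $ i)"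
    by (intro smooth_on_vec_nth smooth_on_fst smooth_on_directional_derivative fibered_smooth)
  then show "smooth_on W (\<lambda>z. base_jacobian \<psi> z $ i $ j)"
    by (simp add: base_jacobian_def matrix_def)
qed

lemma derivative_base_jacobian:
  assumes "z \<in> W"
  shows "frechet_derivative (base_jacobian \<psi>) (at z) u *v \<xi>
       = fst (frechet_derivative (\<lambda>z. frechet_derivative \<psi> (at z) (\<xi>, 0)) (at z) u)"
proof -
  have L: "bounded_linear (\<lambda>M :: real ^ 'n ^ 'n. M *v \<xi>)"
    by (rule bounded_bilinear.bounded_linear_left[OF bounded_bilinear_matrix_vector_mult])
  have "frechet_derivative (base_jacobian \<psi>) (at z) u *v \<xi> = frechet_derivative (\<lambda>z. base_jacobian \<psi> z *v \<xi>) (at z) u"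
    using frechet_derivative_linear_compose[OF L smooth_on_differentiable[OF smooth_on_base_jacobian assms]] by simp
  also have "\<dots> = frechet_derivative (\<lambda>z. fst (frechet_derivative \<psi> (at z) (\<xi>, 0))) (at z) u"
    by (rule fun_cong[OF frechet_derivative_cong_open[OF smooth_on_open[OF fibered_smooth] assms]])
      (simp add: base_jacobian_works)
  also have "\<dots> = fst (frechet_derivative (\<lambda>z. frechet_derivative \<psi> (at z) (\<xi>, 0)) (at z) u)"
    by (intro frechet_derivative_linear_compose bounded_linear_fst
        smooth_on_differentiable[OF smooth_on_directional_derivative[OF fibered_smooth] assms])
  finally show ?thesis .
qed

text \<open>Both sides are the second derivative of the base map in the directions \<open>\<zeta>\<close> and \<open>\<xi>\<close>.\<close>

lemma derivative_base_jacobian_symmetric: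
  assumes "z \<in> W"
  shows "frechet_derivative (base_jacobian \<psi>) (at z) (\<zeta>, 0) *v \<xi>
       = frechet_derivative (base_jacobian \<psi>) (at z) (\<xi>, 0) *v \<zeta>"
  by (simp add: derivative_base_jacobian[OF assms] second_derivative_symmetric[OF fibered_smooth assms])

text \<open>The differential of the base map depends on the base point only.\<close>

lemma derivative_base_jacobian_vertical:
  assumes "z \<in> W"
  shows "frechet_derivative (base_jacobian \<psi>) (at z) (0, \<eta>) *v \<xi> = 0"
proof -
  have "frechet_derivative (base_jacobian \<psi>) (at z) (0, \<eta>) *v \<xi>
      = fst (frechet_derivative (\<lambda>z. frechet_derivative \<psi> (at z) (0, \<eta>)) (at z) (\<xi>, 0))"
    by (simp add: derivative_base_jacobian[OF assms] second_derivative_symmetric[OF fibered_smooth assms])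
  also have "\<dots> = frechet_derivative (\<lambda>z. fst (frechet_derivative \<psi> (at z) (0, \<eta>))) (at z) (\<xi>, 0)"
    by (intro frechet_derivative_linear_compose[symmetric] bounded_linear_fst
        smooth_on_differentiable[OF smooth_on_directional_derivative[OF fibered_smooth] assms])
  also have "\<dots> = frechet_derivative (\<lambda>z. 0) (at z) (\<xi>, 0)"
    by (rule fun_cong[OF frechet_derivative_cong_open[OF smooth_on_open[OF fibered_smooth] assms]])
      (simp add: fibered_derivative_vertical)
  finally show ?thesis
    by simp
qed

lemma open_vimage_fibered: "open T \<Longrightarrow> open (W \<inter> \<psi> -` T)"
  using continuous_open_preimage[OF smooth_on_continuous[OF fibered_smooth] smooth_on_open[OF fibered_smooth]] .

lemma smooth_on_comp_fibered:
  assumes "smooth_on T F"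
  shows "smooth_on (W \<inter> \<psi> -` T) (F \<circ> \<psi>)"
  using smooth_on_compose[OF assms smooth_on_subset[OF fibered_smooth open_vimage_fibered[OF smooth_on_open[OF assms]]]]
  by (simp add: o_def)

text \<open>The derivative of the transformation law of velocities. All second-order conditions of the normal
form are read off from this identity, in vertical and in horizontal directions.\<close>

lemma derivative_grad_p_fibered:
  assumes F: "smooth_on T F" and z: "z \<in> W" "\<psi> z \<in> T"
  shows "frechet_derivative (base_jacobian \<psi>) (at z) u *v grad_p (F \<circ> \<psi>) z
       + base_jacobian \<psi> z *v frechet_derivative (grad_p (F \<circ> \<psi>)) (at z) u
       = frechet_derivative (grad_p F) (at (\<psi> z)) (frechet_derivative \<psi> (at z) u)"
proof -
  let ?S = "W \<inter> \<psi> -` T"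
  have zS: "z \<in> ?S"
    using z by simp
  have opS: "open ?S"
    by (rule open_vimage_fibered[OF smooth_on_open[OF F]])
  note K = smooth_on_grad_p[OF smooth_on_comp_fibered[OF F]]
  have "((\<lambda>z. base_jacobian \<psi> z *v grad_p (F \<circ> \<psi>) z) has_derivative
      (\<lambda>u. base_jacobian \<psi> z *v frechet_derivative (grad_p (F \<circ> \<psi>)) (at z) u
        + frechet_derivative (base_jacobian \<psi>) (at z) u *v grad_p (F \<circ> \<psi>) z)) (at z)"
    by (rule bounded_bilinear.FDERIV[OF bounded_bilinear_matrix_vector_mult
          smooth_on_has_derivative[OF smooth_on_base_jacobian z(1)] smooth_on_has_derivative[OF K zS]])
  then have "((\<lambda>z. grad_p F (\<psi> z)) has_derivative
      (\<lambda>u. base_jacobian \<psi> z *v frechet_derivative (grad_p (F \<circ> \<psi>)) (at z) u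
        + frechet_derivative (base_jacobian \<psi>) (at z) u *v grad_p (F \<circ> \<psi>) z)) (at z)"
    by (rule has_derivative_transform_within_open[OF _ opS zS])
      (auto intro!: grad_p_fibered smooth_on_differentiable[OF F])
  moreover have "((\<lambda>z. grad_p F (\<psi> z)) has_derivative
      (\<lambda>u. frechet_derivative (grad_p F) (at (\<psi> z)) (frechet_derivative \<psi> (at z) u))) (at z)"
    by (rule has_derivative_compose[OF smooth_on_has_derivative[OF fibered_smooth z(1)]
          smooth_on_has_derivative[OF smooth_on_grad_p[OF F] z(2)]])
  ultimately have "(\<lambda>u. base_jacobian \<psi> z *v frechet_derivative (grad_p (F \<circ> \<psi>)) (at z) u
        + frechet_derivative (base_jacobian \<psi>) (at z) u *v grad_p (F \<circ> \<psi>) z)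
     = (\<lambda>u. frechet_derivative (grad_p F) (at (\<psi> z)) (frechet_derivative \<psi> (at z) u))"
    by (rule has_derivative_unique)
  from fun_cong[OF this, of u] show ?thesis
    by (simp add: add.commute)
qed

text \<open>In a vertical direction the term with the second derivative of the base map disappears, and the fibre
Hessian transforms as a contravariant two-tensor.\<close>

lemma hess_pp_fibered:
  assumes F: "smooth_on T F" and z: "z \<in> W" "\<psi> z \<in> T"
  shows "base_jacobian \<psi> z ** hess_pp (F \<circ> \<psi>) z ** transpose (base_jacobian \<psi> z) = hess_pp F (\<psi> z)"
proof -
  let ?M = "base_jacobian \<psi> z" and ?N = "fibre_jacobian \<psi> z"
  have zS: "z \<in> W \<inter> \<psi> -` T"
    using z by simp
  have vert: "?M *v (hess_pp (F \<circ> \<psi>) z *v \<eta>) = hess_pp F (\<psi> z) *v (?N *v \<eta>)" for \<eta>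
    using derivative_grad_p_fibered[OF assms, of "(0, \<eta>)"]
    by (simp add: derivative_base_jacobian_vertical[OF z(1)] fibered_derivative_vertical[OF z(1)]
        derivative_grad_p_vertical[OF smooth_on_comp_fibered[OF F] zS] derivative_grad_p_vertical[OF F z(2)])
  have "?N ** transpose ?M = mat 1"
    using arg_cong[OF fibre_jacobian_contragredient(2)[OF z(1)], of transpose]
    by (simp add: matrix_transpose_mul transpose_mat)
  then show ?thesis
    using vert[of "transpose ?M *v _"]
    by (subst matrix_eq) (simp add: matrix_vector_mul_assoc flip: matrix_mul_assoc)
qed

end

section \<open>Lifting a change of base coordinates\<close>

definition jacobian :: "(real ^ 'n \<Rightarrow> real ^ 'm) \<Rightarrow> real ^ 'n \<Rightarrow> real ^ 'n ^ 'm" where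
  "jacobian \<phi> x = matrix (frechet_derivative \<phi> (at x))"

lemma jacobian_works:
  assumes "smooth_on U \<phi>" "x \<in> U"
  shows "frechet_derivative \<phi> (at x) \<xi> = jacobian \<phi> x *v \<xi>"
  using has_derivative_linear[OF smooth_on_has_derivative[OF assms]]
  by (simp add: jacobian_def matrix_works linear_matrix_vector_mul_eq)

lemma smooth_on_jacobian:
  fixes \<phi> :: "real ^ 'n \<Rightarrow> real ^ 'm"
  assumes "smooth_on U \<phi>"
  shows "smooth_on U (jacobian \<phi>)"
proof (intro smooth_on_vecI smooth_on_open[OF assms])
  fix i j
  have "smooth_on U (\<lambda>x. frechet_derivative \<phi> (at x) (axis j 1) $ i)"
    by (intro smooth_on_vec_nth smooth_on_directional_derivative assms)
  then show "smooth_on U (\<lambda>x. jacobian \<phi> x $ i $ j)"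
    by (simp add: jacobian_def matrix_def)
qed

text \<open>The inverse \<open>g\<close> given by the inverse function theorem has derivative
\<open>matrix_inv (jacobian \<phi> (g y))\<close>, which is as regular as \<open>g\<close>; bootstrapping makes it smooth.\<close>

lemma smooth_local_inverse:
  fixes \<phi> :: "real ^ 'n \<Rightarrow> real ^ 'n"
  assumes \<phi>: "smooth_on U \<phi>" and "x0 \<in> U" and inv: "invertible (jacobian \<phi> x0)"
  obtains U' V g where "open U'" "U' \<subseteq> U" "x0 \<in> U'" "smooth_on V g" "homeomorphism U' V \<phi> g"
    "\<And>x. x \<in> U' \<Longrightarrow> invertible (jacobian \<phi> x)"
proof -
  define D where "D x = Blinfun (frechet_derivative \<phi> (at x))" for x
  have bl: "bounded_linear (frechet_derivative \<phi> (at x))" if "x \<in> U" for x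
    using smooth_on_has_derivative[OF \<phi> that] by (rule has_derivative_bounded_linear)
  have D: "blinfun_apply (D x) = frechet_derivative \<phi> (at x)" if "x \<in> U" for x
    unfolding D_def by (rule bounded_linear_Blinfun_apply[OF bl[OF that]])
  have "continuous_on U D"
  proof (rule continuous_on_blinfun_componentwise)
    fix i :: "real ^ 'n"
    have "continuous_on U (\<lambda>x. frechet_derivative \<phi> (at x) i)"
      by (rule smooth_on_continuous[OF smooth_on_directional_derivative[OF \<phi>]])
    then show "continuous_on U (\<lambda>x. blinfun_apply (D x) i)"
      by (simp add: D cong: continuous_on_cong)
  qed
  moreover have "Blinfun ((*v) (matrix_inv (jacobian \<phi> x0))) o\<^sub>L D x0 = id_blinfun"
  proof (rule blinfun_eqI)
    fix v
    show "blinfun_apply (Blinfun ((*v) (matrix_inv (jacobian \<phi> x0))) o\<^sub>L D x0) v = blinfun_apply id_blinfun v"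
      by (simp add: bounded_linear_Blinfun_apply matrix_vector_mul_bounded_linear D[OF \<open>x0 \<in> U\<close>]
          jacobian_works[OF \<phi> \<open>x0 \<in> U\<close>] matrix_vector_mul_assoc matrix_inv_works[OF inv])
  qed
  ultimately obtain U' V g g' where IFT: "open U'" "U' \<subseteq> U" "x0 \<in> U'" "open V" "\<phi> x0 \<in> V"
      "homeomorphism U' V \<phi> g" "\<And>y. y \<in> V \<Longrightarrow> (g has_derivative g' y) (at y)"
      "\<And>y. y \<in> V \<Longrightarrow> g' y = inv (blinfun_apply (D (g y)))"
      "\<And>y. y \<in> V \<Longrightarrow> bij (blinfun_apply (D (g y)))"
    using inverse_function_theorem[of U \<phi> D x0 "Blinfun ((*v) (matrix_inv (jacobian \<phi> x0)))"]
      smooth_on_open[OF \<phi>] smooth_on_has_derivative[OF \<phi>] \<open>x0 \<in> U\<close> D by metis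
  have gV: "g y \<in> U'" if "y \<in> V" for y
    using IFT(6) that by (auto simp: homeomorphism_def)
  have Dg: "blinfun_apply (D (g y)) = (*v) (jacobian \<phi> (g y))" if "y \<in> V" for y
    using D[of "g y"] jacobian_works[OF \<phi>, of "g y"] gV[OF that] IFT(2) by (auto simp: fun_eq_iff)
  have inv': "invertible (jacobian \<phi> (g y))" if "y \<in> V" for y
    using IFT(9)[OF that] by (simp add: Dg[OF that] invertible_eq_bij)
  have g': "g' y = (*v) (matrix_inv (jacobian \<phi> (g y)))" if "y \<in> V" for y
    unfolding IFT(8)[OF that] Dg[OF that]
    by (rule inv_unique_comp) (auto simp: fun_eq_iff matrix_vector_mul_assoc matrix_inv_works[OF inv'[OF that]])
  have sm: "smooth_on U' (\<lambda>x. matrix_inv (jacobian \<phi> x))"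
  proof (rule smooth_on_matrix_inv)
    show "smooth_on U' (jacobian \<phi>)"
      by (rule smooth_on_subset[OF smooth_on_jacobian[OF \<phi>] IFT(1,2)])
    show "invertible (jacobian \<phi> x)" if "x \<in> U'" for x
    proof -
      have "\<phi> x \<in> V" "g (\<phi> x) = x"
        using IFT(6) that by (auto simp: homeomorphism_def)
      then show ?thesis
        using inv' by metis
    qed
  qed
  have "smooth_on V g"
  proof (rule smooth_onI_bootstrap[OF IFT(4)])
    show "(g has_derivative (\<lambda>v. matrix_inv (jacobian \<phi> (g y)) *v v)) (at y)" if "y \<in> V" for y
      using IFT(7)[OF that] by (simp add: g'[OF that])
    show "Ck_on k V (\<lambda>y. matrix_inv (jacobian \<phi> (g y)) *v v)" if "Ck_on k V g" for k v
      by (intro Ck_on_bilinear[OF bounded_bilinear_matrix_vector_mult] Ck_on_const IFT(4)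
          Ck_on_compose[OF IFT(4,1) gV that smooth_on_Ck[OF sm]])
  qed
  moreover have "invertible (jacobian \<phi> x)" if "x \<in> U'" for x
    using IFT(6) that inv' unfolding homeomorphism_def by (metis image_eqI)
  ultimately show ?thesis
    using that IFT by blast
qed

text \<open>Translation by the one-form \<open>\<beta>\<close> followed by the action of \<open>\<phi>\<close> on covectors.\<close>

definition cotangent_lift ::
    "(real ^ 'n \<Rightarrow> real ^ 'n) \<Rightarrow> (real ^ 'n \<Rightarrow> real ^ 'n) \<Rightarrow> 'n phase \<Rightarrow> 'n::finite phase" where
  "cotangent_lift \<phi> \<beta> z = (\<phi> (fst z), transpose (matrix_inv (jacobian \<phi> (fst z))) *v (snd z + \<beta> (fst z)))"

context
  fixes U V :: "(real ^ 'n::finite) set" and \<phi> g \<beta> :: "real ^ 'n \<Rightarrow> real ^ 'n"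
  assumes \<phi>: "smooth_on U \<phi>" and \<beta>: "smooth_on U \<beta>" and g: "smooth_on V g"
    and hom: "homeomorphism U V \<phi> g"
    and inv: "\<And>x. x \<in> U \<Longrightarrow> invertible (jacobian \<phi> x)"
    and closed: "\<And>x \<xi> \<zeta>. x \<in> U \<Longrightarrow>
      frechet_derivative \<beta> (at x) \<xi> \<bullet> \<zeta> = frechet_derivative \<beta> (at x) \<zeta> \<bullet> \<xi>"
begin

lemma open_cylinder: "open (U \<times> (UNIV :: (real ^ 'n) set))"
  by (intro open_Times smooth_on_open[OF \<phi>]) simp

lemma smooth_on_lift: "smooth_on (U \<times> UNIV) (cotangent_lift \<phi> \<beta>)"
proof -
  have f: "smooth_on (U \<times> UNIV) (\<lambda>z :: 'n phase. F (fst z))" if "smooth_on U F"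
    for F :: "real ^ 'n \<Rightarrow> 'b::euclidean_space"
    by (rule smooth_on_compose[OF that smooth_on_fst[OF smooth_on_id[OF open_cylinder]]]) auto
  show ?thesis
    unfolding cotangent_lift_def[abs_def]
    by (intro smooth_on_Pair smooth_on_matrix_vector smooth_on_transpose smooth_on_add f smooth_on_matrix_inv
        smooth_on_jacobian smooth_on_snd smooth_on_id open_cylinder \<phi> \<beta>) (auto intro: inv)
qed

lemma transpose_jacobian_lift:
  assumes "z \<in> U \<times> UNIV"
  shows "transpose (jacobian \<phi> (fst z)) *v snd (cotangent_lift \<phi> \<beta> z) = snd z + \<beta> (fst z)"
proof -
  have "transpose (jacobian \<phi> (fst z)) ** transpose (matrix_inv (jacobian \<phi> (fst z))) = mat 1"
    using assms by (simp add: matrix_inv_works inv mem_Times_iff transpose_mat flip: matrix_transpose_mul)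
  then show ?thesis
    by (simp add: cotangent_lift_def matrix_vector_mul_assoc)
qed

lemma fst_derivative_lift:
  assumes "z \<in> U \<times> UNIV"
  shows "fst (frechet_derivative (cotangent_lift \<phi> \<beta>) (at z) u) = jacobian \<phi> (fst z) *v fst u"
proof -
  have z: "fst z \<in> U"
    using assms by auto
  have "((\<lambda>z. \<phi> (fst z)) has_derivative (\<lambda>u. jacobian \<phi> (fst z) *v fst u)) (at z)"
    using has_derivative_compose[OF has_derivative_fst[OF has_derivative_ident] smooth_on_has_derivative[OF \<phi> z]]
    by (simp add: jacobian_works[OF \<phi> z])
  moreover have "((\<lambda>z. \<phi> (fst z)) has_derivative (\<lambda>u. fst (frechet_derivative (cotangent_lift \<phi> \<beta>) (at z) u))) (at z)"
    using has_derivative_fst[OF smooth_on_has_derivative[OF smooth_on_lift assms]] by (simp add: cotangent_lift_def)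
  ultimately show ?thesis
    using has_derivative_unique by metis
qed

text \<open>The momentum component \<open>p\<close> is determined by \<open>p \<bullet> (D\<phi> \<zeta>) = (y + \<beta> x) \<bullet> \<zeta>\<close> for all \<open>\<zeta>\<close>.
Differentiating this relation avoids the derivative of an inverse matrix.\<close>

lemma snd_derivative_lift:
  assumes "z \<in> U \<times> UNIV"
  shows "snd (frechet_derivative (cotangent_lift \<phi> \<beta>) (at z) u) \<bullet> (jacobian \<phi> (fst z) *v \<zeta>)
    = snd u \<bullet> \<zeta> + frechet_derivative \<beta> (at (fst z)) (fst u) \<bullet> \<zeta>
      - snd (cotangent_lift \<phi> \<beta> z) \<bullet> frechet_derivative (\<lambda>x. frechet_derivative \<phi> (at x) \<zeta>) (at (fst z)) (fst u)"
proof -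
  have z: "fst z \<in> U"
    using assms by auto
  let ?D = "\<lambda>x. frechet_derivative \<phi> (at x) \<zeta>"
  have fst': "(fst has_derivative fst) (at z)"
    by (rule has_derivative_fst[OF has_derivative_ident])
  have 1: "((\<lambda>z. snd (cotangent_lift \<phi> \<beta> z) \<bullet> ?D (fst z)) has_derivative
     (\<lambda>u. snd (cotangent_lift \<phi> \<beta> z) \<bullet> frechet_derivative ?D (at (fst z)) (fst u)
        + snd (frechet_derivative (cotangent_lift \<phi> \<beta>) (at z) u) \<bullet> ?D (fst z))) (at z)"
    by (intro has_derivative_inner has_derivative_snd smooth_on_has_derivative[OF smooth_on_lift assms]
        has_derivative_compose[OF fst' smooth_on_has_derivative[OF smooth_on_directional_derivative[OF \<phi>] z]])
  have 2: "((\<lambda>z. (snd z + \<beta> (fst z)) \<bullet> \<zeta>) has_derivative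
     (\<lambda>u. (snd u + frechet_derivative \<beta> (at (fst z)) (fst u)) \<bullet> \<zeta>)) (at z)"
    by (intro has_derivative_inner_left has_derivative_add has_derivative_snd has_derivative_ident
        has_derivative_compose[OF fst' smooth_on_has_derivative[OF \<beta> z]])
  have "((\<lambda>z. snd (cotangent_lift \<phi> \<beta> z) \<bullet> ?D (fst z)) has_derivative
     (\<lambda>u. (snd u + frechet_derivative \<beta> (at (fst z)) (fst u)) \<bullet> \<zeta>)) (at z)"
  proof (rule has_derivative_transform_within_open[OF 2 open_cylinder assms])
    fix z' assume z': "z' \<in> U \<times> (UNIV :: (real ^ 'n) set)"
    then have "fst z' \<in> U"
      by auto
    then show "(snd z' + \<beta> (fst z')) \<bullet> \<zeta> = snd (cotangent_lift \<phi> \<beta> z') \<bullet> ?D (fst z')"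
      by (simp add: jacobian_works[OF \<phi>] inner_transpose_left flip: transpose_jacobian_lift[OF z'])
  qed
  from fun_cong[OF has_derivative_unique[OF 1 this], of u] show ?thesis
    by (simp add: jacobian_works[OF \<phi> z] inner_add_left algebra_simps)
qed

lemma image_lift: "cotangent_lift \<phi> \<beta> ` (U \<times> UNIV) = V \<times> UNIV" (is ?image)
  and inj_on_lift: "inj_on (cotangent_lift \<phi> \<beta>) (U \<times> UNIV)" (is ?inj)
  and smooth_on_inv_lift: "smooth_on (V \<times> UNIV) (inv_into (U \<times> UNIV) (cotangent_lift \<phi> \<beta>))" (is ?smooth)
proof -
  let ?g = "\<lambda>w. (g (fst w), transpose (jacobian \<phi> (g (fst w))) *v snd w - \<beta> (g (fst w)))"
  have gV: "g y \<in> U" "\<phi> (g y) = y" if "y \<in> V" for y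
    using hom that by (auto simp: homeomorphism_def)
  have \<phi>U: "\<phi> x \<in> V" "g (\<phi> x) = x" if "x \<in> U" for x
    using hom that by (auto simp: homeomorphism_def)
  have left: "?g (cotangent_lift \<phi> \<beta> z) = z" if "z \<in> U \<times> UNIV" for z
    using transpose_jacobian_lift[OF that] that by (auto simp: cotangent_lift_def \<phi>U prod_eq_iff)
  have right: "cotangent_lift \<phi> \<beta> (?g w) = w" if "w \<in> V \<times> UNIV" for w
  proof -
    have w: "fst w \<in> V"
      using that by auto
    have "transpose (matrix_inv (jacobian \<phi> (g (fst w)))) ** transpose (jacobian \<phi> (g (fst w))) = mat 1"
      using gV[OF w] by (simp add: matrix_inv_works inv transpose_mat flip: matrix_transpose_mul)
    then show ?thesis
      using w by (simp add: cotangent_lift_def gV prod_eq_iff matrix_vector_mul_assoc)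
  qed
  show im: ?image
  proof
    show "cotangent_lift \<phi> \<beta> ` (U \<times> UNIV) \<subseteq> V \<times> UNIV"
      by (auto simp: cotangent_lift_def \<phi>U)
    show "V \<times> UNIV \<subseteq> cotangent_lift \<phi> \<beta> ` (U \<times> UNIV)"
    proof
      fix w :: "'n phase" assume "w \<in> V \<times> UNIV"
      then show "w \<in> cotangent_lift \<phi> \<beta> ` (U \<times> UNIV)"
        by (intro image_eqI[of _ _ "?g w"]) (auto simp: right gV simp del: split_paired_All)
    qed
  qed
  show ?inj
    by (rule inj_on_inverseI[of _ ?g]) (rule left)
  have opV: "open (V \<times> (UNIV :: (real ^ 'n) set))"
    by (intro open_Times smooth_on_open[OF g]) simp
  have comp: "smooth_on (V \<times> UNIV) (\<lambda>w :: 'n phase. F (g (fst w)))" if "smooth_on U F"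
    for F :: "real ^ 'n \<Rightarrow> 'b::euclidean_space"
    by (intro smooth_on_compose[OF that] smooth_on_compose[OF g] smooth_on_fst smooth_on_id opV)
      (auto simp: gV)
  have "smooth_on (V \<times> UNIV) ?g"
    by (intro smooth_on_Pair smooth_on_diff smooth_on_matrix_vector smooth_on_transpose comp
        smooth_on_jacobian \<phi> \<beta> smooth_on_snd smooth_on_id opV comp[OF smooth_on_id[OF smooth_on_open[OF \<phi>]], simplified])
  moreover have "inv_into (U \<times> UNIV) (cotangent_lift \<phi> \<beta>) w = ?g w" if "w \<in> V \<times> UNIV" for w
    using right[OF that] that gV by (intro inv_into_f_eq \<open>?inj\<close>) auto
  ultimately show ?smooth
    using smooth_on_cong[of "V \<times> UNIV" "inv_into (U \<times> UNIV) (cotangent_lift \<phi> \<beta>)" ?g] by blast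
qed

text \<open>Differentiating the defining relation of the lift, all terms other than the canonical pairing
  are symmetric in the two arguments: the second derivative of the base map and, by closedness, the
  derivative of the one-form.\<close>

lemma fibered_symplectic_lift: "fibered_symplectic_diffeo (U \<times> UNIV) (cotangent_lift \<phi> \<beta>)"
  unfolding fibered_symplectic_diffeo_def symplectic_diffeo_def
proof (intro conjI ballI allI)
  show "smooth_on (U \<times> UNIV) (cotangent_lift \<phi> \<beta>)" "inj_on (cotangent_lift \<phi> \<beta>) (U \<times> UNIV)"
    by (rule smooth_on_lift inj_on_lift)+
  show "smooth_on (cotangent_lift \<phi> \<beta> ` (U \<times> UNIV)) (inv_into (U \<times> UNIV) (cotangent_lift \<phi> \<beta>))"
    using smooth_on_inv_lift by (simp add: image_lift)
  show "\<exists>f. horizontal_component (U \<times> UNIV) (cotangent_lift \<phi> \<beta>) f"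
    by (auto simp: horizontal_component_def cotangent_lift_def)
  fix z :: "'n phase" and u v assume z: "z \<in> U \<times> UNIV"
  then have "fst z \<in> U"
    by auto
  then show "symplectic_form (frechet_derivative (cotangent_lift \<phi> \<beta>) (at z) u) (frechet_derivative (cotangent_lift \<phi> \<beta>) (at z) v) = symplectic_form u v"
    using closed[of "fst z" "fst u" "fst v"] second_derivative_symmetric[OF \<phi>, of "fst z" "fst u" "fst v"]
    by (simp add: symplectic_form_def fst_derivative_lift[OF z] snd_derivative_lift[OF z]
        inner_commute[of "jacobian \<phi> (fst z) *v fst u"] inner_commute[of "fst u" "snd v"])
qed

end

section \<open>The mixed second derivatives as an obstruction\<close>

lemma derivative_horizontal:
  assumes "(F has_derivative F') (at z)"
  shows "F' (u, 0) = grad_q F z \<bullet> u"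
proof -
  have F': "frechet_derivative F (at z) = F'"
    using frechet_derivative_at[OF assms] by simp
  have lin: "linear (\<lambda>u. F' (u, 0))"
    by (rule linear_horizontal_vertical(1)[OF has_derivative_linear[OF assms]])
  have "F' (u, 0) = F' (\<Sum>i\<in>UNIV. u $ i *\<^sub>R axis i 1, 0)"
    using basis_expansion[of u] by (simp add: scalar_mult_eq_scaleR)
  also have "\<dots> = (\<Sum>i\<in>UNIV. u $ i *\<^sub>R F' (axis i 1, 0))"
    by (simp add: linear_sum[OF lin] linear_scale[OF lin])
  finally show ?thesis
    by (simp add: grad_q_def dq_def partial_deriv_def F' inner_vec_def mult.commute)
qed

text \<open>At the ends of \<open>[0, \<delta>]\<close> the values on the segment determine a one-sided derivative only, and that
suffices, since \<open>F\<close> is differentiable there.\<close>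

lemma derivative_along_segment:
  fixes F :: "'n::{finite,zero} phase \<Rightarrow> 'b::euclidean_space"
  assumes "smooth_on S F" "(t *\<^sub>R e0, 0) \<in> S" "0 < \<delta>" "t \<in> {0..\<delta>}"
    and eq: "\<And>s. s \<in> {0..\<delta>} \<Longrightarrow> F (s *\<^sub>R e0, 0) = c s"
    and c: "(c has_vector_derivative c') (at t within {0..\<delta>})"
  shows "frechet_derivative F (at (t *\<^sub>R e0, 0)) (e0, 0) = c'"
proof -
  let ?F' = "frechet_derivative F (at (t *\<^sub>R e0, 0))"
  have F: "(F has_derivative ?F') (at (t *\<^sub>R e0, 0))"
    by (rule smooth_on_has_derivative[OF assms(1,2)])
  have "((\<lambda>s. (s *\<^sub>R e0, 0)) has_derivative (\<lambda>r. (r *\<^sub>R e0, 0))) (at t within {0..\<delta>})"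
    by (intro has_derivative_Pair has_derivative_const has_derivative_scaleR_left has_derivative_ident)
  then have "((\<lambda>s. F (s *\<^sub>R e0, 0)) has_derivative (\<lambda>r. ?F' (r *\<^sub>R e0, 0))) (at t within {0..\<delta>})"
    by (rule has_derivative_compose) (rule F)
  moreover have "?F' (r *\<^sub>R e0, 0) = r *\<^sub>R ?F' (e0, 0)" for r
    using linear_scale[OF has_derivative_linear[OF F], of r "(e0, 0)"] by simp
  ultimately have "((\<lambda>s. F (s *\<^sub>R e0, 0)) has_vector_derivative ?F' (e0, 0)) (at t within {0..\<delta>})"
    by (simp add: has_vector_derivative_def)
  then have "(c has_vector_derivative ?F' (e0, 0)) (at t within {0..\<delta>})"
    by (rule has_vector_derivative_transform[OF assms(4), rotated]) (simp add: eq)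
  then show ?thesis
    using vector_derivative_unique_within_closed_interval[of 0 \<delta> t c] assms(3,4) c by simp
qed

lemma normalizes_fibered: "normalizes \<delta> F Z W \<psi> \<Longrightarrow> fibered_symplectic_diffeo W \<psi>"
  by (simp add: normalizes_def)

lemma normalizes_segment:
  assumes "normalizes \<delta> F Z W \<psi>" "t \<in> {0..\<delta>}"
  shows "(t *\<^sub>R e0, 0) \<in> W" "\<psi> (t *\<^sub>R e0, 0) = Z t"
    "inv_into W \<psi> (Z t) = (t *\<^sub>R e0, 0)"
proof -
  have Z: "Z t \<in> \<psi> ` W"
    using assms by (simp add: normalizes_def)
  show eq: "inv_into W \<psi> (Z t) = (t *\<^sub>R e0, 0)"
    using assms by (simp add: normalizes_def five_equalities_def prod_eq_iff)
  show "(t *\<^sub>R e0, 0) \<in> W" "\<psi> (t *\<^sub>R e0, 0) = Z t"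
    using inv_into_into[OF Z] f_inv_into_f[OF Z] by (simp_all add: eq)
qed

lemma hess_pp_axis:
  "(hess_pp F z *v axis j 1) $ i = dp i (dp j F) z"
  by (simp add: matrix_vector_mult_basis column_def hess_pp_def)

text \<open>The equalities for \<open>\<partial>\<^sub>p\<^sub>0\<^sub>p\<^sub>*\<close> and \<open>\<partial>\<^sub>p\<^sub>*\<^sub>p\<^sub>*\<close> taken together: the fibre Hessian is
the identity on the hyperplane \<open>x $ 0 = 0\<close>.\<close>

lemma normalizes_hess_pp:
  fixes F :: "'n::{finite,zero} phase \<Rightarrow> real"
  assumes "normalizes \<delta> F Z W \<psi>" "t \<in> {0..\<delta>}" "x $ 0 = 0"
  shows "hess_pp (F \<circ> \<psi>) (t *\<^sub>R e0, 0) *v x = x"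
proof -
  let ?K = "hess_pp (F \<circ> \<psi>) (t *\<^sub>R e0, 0)"
  have axis: "?K *v axis j 1 = axis j 1" if "j \<noteq> 0" for j
  proof -
    have "dp i (dp j (F \<circ> \<psi>)) (t *\<^sub>R e0, 0) = (if i = j then 1 else 0)" for i
      using bspec[OF assms(1)[unfolded normalizes_def five_equalities_def, THEN conjunct2, THEN conjunct2] assms(2)]
        that normalizes_segment(3)[OF assms(1,2)]
      by (cases "i = 0") simp_all
    then have "(?K *v axis j 1) $ i = axis j 1 $ i" for i
      by (subst hess_pp_axis) (simp add: axis_def)
    then show ?thesis
      by (simp add: vec_eq_iff)
  qed
  have "?K *v x = (\<Sum>j\<in>UNIV. x $ j *\<^sub>R (?K *v axis j 1))"
  proof -
    have "?K *v x = ?K *v (\<Sum>j\<in>UNIV. x $ j *\<^sub>R axis j 1)"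
      using basis_expansion[of x] by (simp add: scalar_mult_eq_scaleR)
    then show ?thesis
      by (simp add: linear_sum[OF matrix_vector_mul_linear] matrix_vector_mult_scaleR)
  qed
  also have "\<dots> = (\<Sum>j\<in>UNIV. x $ j *\<^sub>R axis j 1)"
    using axis assms(3) by (intro sum.cong) (metis scaleR_zero_left)+
  also have "\<dots> = x"
    using basis_expansion[of x] by (simp add: scalar_mult_eq_scaleR)
  finally show ?thesis .
qed

text \<open>Both the base curve in the new coordinates and the fibre gradient are carried by the injective
differential of the base map to the velocity of the original base curve.\<close>

lemma velocity_along_segment:
  fixes F :: "'n::{finite,zero} phase \<Rightarrow> real"
  assumes fib: "fibered_symplectic_diffeo W \<psi>" and F: "smooth_on T F" and "0 < \<delta>" and t: "t \<in> {0..\<delta>}"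
    and seg: "\<And>s. s \<in> {0..\<delta>} \<Longrightarrow> (s *\<^sub>R e0, 0) \<in> W \<and> \<psi> (s *\<^sub>R e0, 0) = Z s"
    and "Z t \<in> T" and Z: "((\<lambda>s. fst (Z s)) has_vector_derivative grad_p F (Z t)) (at t within {0..\<delta>})"
  shows "grad_p (F \<circ> \<psi>) (t *\<^sub>R e0, 0) = e0"
proof -
  let ?z = "(t *\<^sub>R e0, 0) :: 'n phase"
  have zW: "?z \<in> W"
    using seg[OF t] by simp
  have "frechet_derivative (\<lambda>z. fst (\<psi> z)) (at ?z) (e0, 0) = grad_p F (Z t)"
    by (rule derivative_along_segment[OF smooth_on_fst[OF fibered_smooth[OF fib]] zW \<open>0 < \<delta>\<close> t _ Z])
      (simp add: seg)
  moreover have "frechet_derivative (\<lambda>z. fst (\<psi> z)) (at ?z) (e0, 0) = fst (frechet_derivative \<psi> (at ?z) (e0, 0))"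
    by (rule frechet_derivative_linear_compose[OF bounded_linear_fst smooth_on_differentiable[OF fibered_smooth[OF fib] zW]])
  ultimately have "base_jacobian \<psi> ?z *v e0 = grad_p F (Z t)"
    by (simp add: base_jacobian_works[OF fib zW])
  also have "\<dots> = base_jacobian \<psi> ?z *v grad_p (F \<circ> \<psi>) ?z"
    using grad_p_fibered[OF fib zW, of F] smooth_on_differentiable[OF F] \<open>Z t \<in> T\<close> by (simp add: seg[OF t])
  finally show ?thesis
    by (rule base_jacobian_injective[OF fib zW, symmetric])
qed

lemma inner_e0: "x \<bullet> e0 = x $ 0" "e0 \<bullet> x = x $ 0"
  by (simp_all add: e0_def inner_axis inner_axis')

lemma e0_nth: "e0 $ i = (if i = 0 then 1 else 0)"
  by (simp add: e0_def axis_def)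

text \<open>On the hyperplane orthogonal to \<open>e0\<close>, which the adjoint of \<open>M\<close> preserves because \<open>M\<close> fixes \<open>e0\<close>, the
relation \<open>M K M\<^sup>T = G\<close> reduces to \<open>M M\<^sup>T = 1\<close>. Hence the vector \<open>v = M\<^sup>T e0 - e0\<close> has an image parallel to
\<open>e0\<close>; then \<open>v\<close> is parallel to \<open>e0\<close>, to which it is also orthogonal.\<close>

lemma adjoint_fixes_e0:
  fixes M K G :: "real ^ ('n::{finite,zero}) ^ ('n::{finite,zero})"
  assumes M: "M *v e0 = e0" "N ** M = mat 1"
    and K: "\<And>x. x $ 0 = 0 \<Longrightarrow> K *v x = x" and G: "\<And>x. x $ 0 = 0 \<Longrightarrow> G *v x = x"
    and MKM: "M ** K ** transpose M = G"
  shows "transpose M *v e0 = e0"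
proof -
  define v where "v = transpose M *v e0 - e0"
  have v0: "v $ 0 = 0"
  proof -
    have "v $ 0 = v \<bullet> e0"
      by (simp add: inner_e0)
    then show ?thesis
      by (simp add: v_def inner_diff_left inner_transpose_left M(1))
  qed
  have "(M *v v) $ j = 0" if "j \<noteq> 0" for j
  proof -
    let ?x = "axis j 1 :: real ^ 'n::{finite,zero}"
    have x0: "?x $ 0 = 0"
      using that by (simp add: axis_def)
    have u0: "(transpose M *v ?x) $ 0 = 0"
      using inner_transpose_left[of M ?x e0] by (simp add: M(1) inner_e0 x0)
    have "M *v (transpose M *v ?x) = M *v (K *v (transpose M *v ?x))"
      by (simp add: K[OF u0])
    also have "\<dots> = ?x"
      using G[OF x0] by (simp add: matrix_vector_mul_assoc matrix_mul_assoc MKM)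
    finally have MM: "M *v (transpose M *v ?x) = ?x" .
    have "(M *v v) $ j = (transpose M *v ?x) \<bullet> v"
      by (simp add: inner_transpose_left inner_axis')
    also have "\<dots> = (M *v (transpose M *v ?x)) \<bullet> e0 - (transpose M *v ?x) \<bullet> e0"
      by (simp add: v_def inner_diff_right inner_transpose_right)
    also have "\<dots> = 0"
      by (simp only: MM inner_e0 u0 x0)
    finally show ?thesis .
  qed
  then have "M *v v = (M *v v) $ 0 *\<^sub>R e0"
    by (auto simp: vec_eq_iff e0_nth)
  also have "\<dots> = M *v ((M *v v) $ 0 *\<^sub>R e0)"
    by (simp add: matrix_vector_mult_scaleR M(1))
  finally have "N *v (M *v v) = N *v (M *v ((M *v v) $ 0 *\<^sub>R e0))"
    by simp
  then have "v = (M *v v) $ 0 *\<^sub>R e0"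
    by (simp add: matrix_vector_mul_assoc M(2))
  then have "v = 0"
    using v0 by (metis e0_nth mult.right_neutral scaleR_zero_left vector_scaleR_component real_scaleR_def)
  then show ?thesis
    by (simp add: v_def)
qed

text \<open>For a transverse direction \<open>axis l 1\<close>, the vector \<open>\<xi>\<close> is its preimage under \<open>M\<close>. In the \<open>0\<close>-component of
the differentiated transformation law, applied to \<open>(\<xi>, 0)\<close>, the second derivative of the base map
vanishes because \<open>M\<^sup>T e0 = e0\<close> along the segment, and the fibre Hessian contributes nothing because the
momentum part \<open>w\<close> of the image of \<open>(\<xi>, 0)\<close> satisfies \<open>w $ 0 = 0\<close>. What remains equates
\<open>dq l (dp 0 F)\<close> with a combination of mixed derivatives of \<open>F \<circ> \<eta>\<close>.\<close>

lemma mixed_derivatives_obstruction: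
  fixes F :: "'n::{finite,zero} phase \<Rightarrow> real"
  assumes F: "smooth_on S F" and "0 < \<delta>"
    and F_seg: "\<And>t. t \<in> {0..\<delta>} \<Longrightarrow> (t *\<^sub>R e0, 0) \<in> S"
    and F_vel: "\<And>t. t \<in> {0..\<delta>} \<Longrightarrow> grad_p F (t *\<^sub>R e0, 0) = e0"
    and F_hess: "\<And>t x. t \<in> {0..\<delta>} \<Longrightarrow> x $ 0 = 0 \<Longrightarrow> hess_pp F (t *\<^sub>R e0, 0) *v x = x"
    and norm: "normalizes \<delta> F (\<lambda>t. (t *\<^sub>R e0, 0)) V \<eta>"
    and vanish: "mixed_qstar_p0_vanishes \<delta> (F \<circ> \<eta>)"
  shows "mixed_qstar_p0_vanishes \<delta> F"
  unfolding mixed_qstar_p0_vanishes_def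
proof (intro ballI allI impI)
  fix t l assume t: "t \<in> {0..\<delta>}" and l: "(l :: 'n) \<noteq> 0"
  note fib = normalizes_fibered[OF norm] and seg = normalizes_segment[OF norm]
  define z :: "real \<Rightarrow> 'n phase" where "z s = (s *\<^sub>R e0, 0)" for s
  define M where "M s = base_jacobian \<eta> (z s)" for s
  have zV: "z s \<in> V" "\<eta> (z s) = z s" "z s \<in> S" if "s \<in> {0..\<delta>}" for s
    using seg[OF that] F_seg[OF that] by (simp_all add: z_def)
  have De0: "frechet_derivative \<eta> (at (z s)) (e0, 0) = (e0, 0)" if "s \<in> {0..\<delta>}" for s
    unfolding z_def
  proof (rule derivative_along_segment[OF fibered_smooth[OF fib] _ \<open>0 < \<delta>\<close> that])
    show "(s *\<^sub>R e0, 0) \<in> V"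
      using zV[OF that] by (simp add: z_def)
    show "\<eta> (r *\<^sub>R e0, 0) = (r *\<^sub>R e0, 0)" if "r \<in> {0..\<delta>}" for r
      using seg[OF that] by simp
    show "((\<lambda>r. (r *\<^sub>R e0, 0)) has_vector_derivative (e0, 0 :: real ^ 'n::{finite,zero})) (at s within {0..\<delta>})"
      by (auto intro!: derivative_eq_intros simp: has_vector_derivative_def)
  qed
  have Me0: "M s *v e0 = e0" if "s \<in> {0..\<delta>}" for s
    using base_jacobian_works[OF fib zV(1)[OF that], of e0] De0[OF that] by (simp add: M_def)
  have MTe0: "transpose (M s) *v e0 = e0" if s: "s \<in> {0..\<delta>}" for s
  proof (rule adjoint_fixes_e0)
    show "M s ** hess_pp (F \<circ> \<eta>) (z s) ** transpose (M s) = hess_pp F (z s)"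
      using hess_pp_fibered[OF fib F zV(1)[OF s]] zV[OF s] by (simp add: M_def)
    show "hess_pp (F \<circ> \<eta>) (z s) *v x = x" if "x $ 0 = 0" for x
      using normalizes_hess_pp[OF norm s that] by (simp add: z_def)
    show "hess_pp F (z s) *v x = x" if "x $ 0 = 0" for x
      using F_hess[OF s that] by (simp add: z_def)
    show "transpose (fibre_jacobian \<eta> (z s)) ** M s = mat 1"
      using fibre_jacobian_contragredient(1)[OF fib zV(1)[OF s]] by (simp add: M_def)
  qed (rule Me0[OF s])
  let ?DM = "frechet_derivative (base_jacobian \<eta>) (at (z t))"
  have DM0: "transpose (?DM (e0, 0)) *v e0 = 0"
  proof -
    have L: "bounded_linear (\<lambda>A :: real ^ ('n::{finite,zero}) ^ ('n::{finite,zero}). transpose A *v e0)"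
      by (rule bounded_linear_compose[OF bounded_bilinear.bounded_linear_left[OF bounded_bilinear_matrix_vector_mult]
            bounded_linear_transpose])
    have "frechet_derivative (\<lambda>y. transpose (base_jacobian \<eta> y) *v e0) (at (t *\<^sub>R e0, 0)) (e0, 0) = 0"
      using seg(1)[OF t] MTe0 M_def z_def
      by (intro derivative_along_segment[OF smooth_on_linear[OF L smooth_on_base_jacobian[OF fib]] _ \<open>0 < \<delta>\<close> t _
            has_vector_derivative_const[of e0]]) auto
    then show ?thesis
      using frechet_derivative_linear_compose[OF L smooth_on_differentiable[OF smooth_on_base_jacobian[OF fib] zV(1)[OF t]]]
      by (simp add: z_def)
  qed
  let ?N = "transpose (fibre_jacobian \<eta> (z t))"
  define \<xi> where "\<xi> = ?N *v axis l 1"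
  have M\<xi>: "M t *v \<xi> = axis l 1"
    using fibre_jacobian_contragredient(2)[OF fib zV(1)[OF t]] by (simp add: \<xi>_def M_def matrix_vector_mul_assoc)
  have \<xi>0: "\<xi> $ 0 = 0"
  proof -
    have "\<xi> $ 0 = \<xi> \<bullet> (transpose (M t) *v e0)"
      by (simp add: MTe0[OF t] inner_e0)
    then show ?thesis
      using l by (simp add: inner_transpose_right M\<xi> inner_e0 axis_def)
  qed
  define w where "w = snd (frechet_derivative \<eta> (at (z t)) (\<xi>, 0))"
  have D\<xi>: "frechet_derivative \<eta> (at (z t)) (\<xi>, 0) = (axis l 1, w)"
    using base_jacobian_works[OF fib zV(1)[OF t], of \<xi>] M\<xi> by (simp add: w_def M_def prod_eq_iff)
  \<comment> \<open>The image of \<open>(e0, 0)\<close> is \<open>(e0, 0)\<close>, so that \<open>- w $ 0\<close> is the symplectic product of two images of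
      horizontal vectors.\<close>
  have w0: "w $ 0 = 0"
    using fibered_symplectic[OF fib zV(1)[OF t], of "(e0, 0)" "(\<xi>, 0)"]
    by (simp add: symplectic_form_def De0[OF t] D\<xi> inner_e0)
  have K: "smooth_on (V \<inter> \<eta> -` S) (F \<circ> \<eta>)"
    by (rule smooth_on_comp_fibered[OF fib F])
  have zK: "z t \<in> V \<inter> \<eta> -` S"
    using zV[OF t] by simp
  have "grad_p (F \<circ> \<eta>) (z t) = e0"
    unfolding z_def
    by (rule velocity_along_segment[OF fib F \<open>0 < \<delta>\<close> t, of "\<lambda>t. (t *\<^sub>R e0, 0)"])
      (use seg F_seg[OF t] F_vel[OF t] in \<open>auto intro!: derivative_eq_intros simp: has_vector_derivative_def\<close>)
  then have "?DM (\<xi>, 0) *v e0 + M t *v frechet_derivative (grad_p (F \<circ> \<eta>)) (at (z t)) (\<xi>, 0)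
      = frechet_derivative (grad_p F) (at (z t)) (axis l 1, w)"
    using derivative_grad_p_fibered[OF fib F zV(1)[OF t], of "(\<xi>, 0)"] zV[OF t] by (simp add: D\<xi> M_def)
  from arg_cong[OF this, of "\<lambda>v. v \<bullet> e0"]
  have "(?DM (\<xi>, 0) *v e0) \<bullet> e0 + (M t *v frechet_derivative (grad_p (F \<circ> \<eta>)) (at (z t)) (\<xi>, 0)) \<bullet> e0
      = frechet_derivative (grad_p F) (at (z t)) (axis l 1, w) \<bullet> e0"
    by (simp only: inner_add_left)
  moreover have "(?DM (\<xi>, 0) *v e0) \<bullet> e0 = 0"
    using DM0 by (simp add: derivative_base_jacobian_symmetric[OF fib zV(1)[OF t], of \<xi>] flip: inner_transpose_right)
  moreover have "(M t *v frechet_derivative (grad_p (F \<circ> \<eta>)) (at (z t)) (\<xi>, 0)) \<bullet> e0 = 0"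
  proof -
    have "(M t *v frechet_derivative (grad_p (F \<circ> \<eta>)) (at (z t)) (\<xi>, 0)) \<bullet> e0
        = frechet_derivative (grad_p (F \<circ> \<eta>)) (at (z t)) (\<xi>, 0) \<bullet> e0"
      by (simp only: MTe0[OF t] flip: inner_transpose_right)
    also have "\<dots> = frechet_derivative (dp 0 (F \<circ> \<eta>)) (at (z t)) (\<xi>, 0)"
      by (simp only: inner_e0 derivative_grad_p[OF K zK])
    also have "\<dots> = grad_q (dp 0 (F \<circ> \<eta>)) (z t) \<bullet> \<xi>"
      by (rule derivative_horizontal[OF smooth_on_has_derivative[OF smooth_on_dp[OF K] zK]])
    also have "\<dots> = 0"
      using vanish t \<xi>0 unfolding inner_vec_def
      by (intro sum.neutral) (metis (mono_tags, lifting) grad_q_def inner_zero_left inner_zero_right mixed_qstar_p0_vanishes_def vec_lambda_beta z_def)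
    finally show ?thesis .
  qed
  moreover have "frechet_derivative (grad_p F) (at (z t)) (axis l 1, w) \<bullet> e0 = dq l (dp 0 F) (z t)"
  proof -
    have lin: "linear (frechet_derivative (grad_p F) (at (z t)))"
      using has_derivative_linear[OF smooth_on_has_derivative[OF smooth_on_grad_p[OF F] zV(3)[OF t]]] .
    have "frechet_derivative (grad_p F) (at (z t)) (axis l 1, w)
        = frechet_derivative (grad_p F) (at (z t)) (axis l 1, 0) + hess_pp F (z t) *v w"
      using linear_add[OF lin, of "(axis l 1, 0)" "(0, w)"]
      by (simp add: derivative_grad_p_vertical[OF F zV(3)[OF t]])
    also have "hess_pp F (z t) *v w = w"
      using F_hess[OF t w0] by (simp add: z_def)
    finally show ?thesis
      by (simp add: inner_add_left inner_e0 w0 derivative_grad_p[OF F zV(3)[OF t]] dq_def partial_deriv_def)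
  qed
  ultimately show "dq l (dp 0 F) (t *\<^sub>R e0, 0) = 0"
    by (simp add: z_def)
qed

section \<open>A frame along the orbit\<close>

text \<open>As a directional derivative in the sense of \<open>Ck_on\<close>, the velocity of a smooth curve is smooth by
definition.\<close>

definition velocity :: "(real \<Rightarrow> 'a::euclidean_space) \<Rightarrow> real \<Rightarrow> 'a" where
  "velocity c t = frechet_derivative c (at t) 1"

lemma velocity_works:
  assumes "smooth_on J c" "t \<in> J"
  shows "(c has_vector_derivative velocity c t) (at t)"
proof -
  have "(c has_derivative frechet_derivative c (at t)) (at t)"
    by (rule smooth_on_has_derivative[OF assms])
  moreover from this have "frechet_derivative c (at t) r = r *\<^sub>R velocity c t" for r
    using linear_scale[OF has_derivative_linear[of c _ "at t"], of _ r 1] by (simp add: velocity_def)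
  ultimately show ?thesis
    unfolding has_vector_derivative_def by (metis (no_types, lifting) ext)
qed

lemma smooth_on_velocity: "smooth_on J c \<Longrightarrow> smooth_on J (velocity c)"
  unfolding velocity_def by (rule smooth_on_directional_derivative)

lemma velocity_eqI: "(c has_vector_derivative c') (at t) \<Longrightarrow> velocity c t = c'"
  unfolding velocity_def has_vector_derivative_def by (metis frechet_derivative_at scaleR_one)

text \<open>Pointwise linear relations, such as symmetry or vanishing on a vector, are inherited by the velocity.\<close>

lemma velocity_linear_eq:
  assumes "smooth_on J c" "t \<in> J" "bounded_linear L" "bounded_linear L'" "\<And>t. t \<in> J \<Longrightarrow> L (c t) = L' (c t)"
  shows "L (velocity c t) = L' (velocity c t)"
proof -
  have D: "((\<lambda>t. L (c t)) has_vector_derivative L (velocity c t)) (at t)" if "bounded_linear L" for L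
    by (rule bounded_linear.has_vector_derivative[OF that velocity_works[OF assms(1,2)]])
  have "((\<lambda>t. L' (c t)) has_vector_derivative L (velocity c t)) (at t)"
    by (rule has_vector_derivative_transform_within_open[OF D[OF assms(3)] smooth_on_open[OF assms(1)] assms(2)])
      (simp add: assms(5))
  then show ?thesis
    using D[OF assms(4)] vector_derivative_unique_at by blast
qed

lemma constant_on_interval:
  fixes f :: "real \<Rightarrow> 'a::real_normed_vector"
  assumes "\<And>t. t \<in> {-h<..<h} \<Longrightarrow> (f has_vector_derivative 0) (at t)" "0 < h" "t \<in> {-h<..<h}"
  shows "f t = f 0"
proof -
  have "\<exists>c. \<forall>x\<in>{-h<..<h}. f x = c"
    using assms(1) by (intro has_derivative_zero_constant)
      (auto simp: has_vector_derivative_def intro: has_derivative_at_withinI)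
  then show ?thesis
    using assms(2,3) by auto
qed

lemma posdef_invertible:
  fixes A :: "real ^ 'n ^ 'n"
  assumes "\<And>u. u \<noteq> 0 \<Longrightarrow> 0 < u \<bullet> (A *v u)"
  shows "invertible A"
proof -
  have "x = 0" if "A *v x = 0" for x
    using assms[of x] that by force
  then show ?thesis
    using matrix_left_invertible_ker invertible_left_inverse by blast
qed

definition outer :: "real ^ 'm \<Rightarrow> real ^ 'n \<Rightarrow> real ^ 'n ^ 'm" where
  "outer u v = (\<chi> i j. u $ i * v $ j)"

lemma outer_works: "outer u v *v x = (v \<bullet> x) *\<^sub>R u"
  by (simp add: outer_def matrix_vector_mult_def vec_eq_iff inner_vec_def sum_distrib_left mult_ac)

lemma smooth_on_outer: "smooth_on S u \<Longrightarrow> smooth_on S v \<Longrightarrow> smooth_on S (\<lambda>x. outer (u x) (v x))"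
  unfolding outer_def
  by (intro smooth_on_vecI) (auto intro!: smooth_on_mult smooth_on_vec_nth intro: smooth_on_open)

lemma has_vector_derivative_matrix_vector:
  fixes A :: "real \<Rightarrow> real ^ 'n ^ 'm"
  assumes "(A has_vector_derivative A') (at t)" "(v has_vector_derivative v') (at t)"
  shows "((\<lambda>t. A t *v v t) has_vector_derivative A t *v v' + A' *v v t) (at t)"
  using bounded_bilinear.has_vector_derivative[OF bounded_bilinear_matrix_vector_mult assms] .

lemma has_vector_derivative_inner:
  fixes u v :: "real \<Rightarrow> 'a::euclidean_space"
  assumes "(u has_vector_derivative u') (at t)" "(v has_vector_derivative v') (at t)"
  shows "((\<lambda>t. u t \<bullet> v t) has_vector_derivative u t \<bullet> v' + u' \<bullet> v t) (at t)"
  using bounded_bilinear.has_vector_derivative[OF bounded_bilinear_inner assms] .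

lemma initial_frame_exists:
  fixes \<Gamma> :: "real ^ ('n::{finite,zero}) ^ ('n::{finite,zero})" and v :: "real ^ ('n::{finite,zero})"
  assumes pos: "\<And>u. u \<noteq> 0 \<Longrightarrow> 0 < u \<bullet> (\<Gamma> *v u)" and sym: "transpose \<Gamma> = \<Gamma>"
  obtains A :: "real ^ ('n::{finite,zero}) ^ ('n::{finite,zero})" where
    "A *v e0 = 0" "\<And>x. (A *v x) \<bullet> (\<Gamma> *v v) = 0"
    "\<And>x y. (A *v x) \<bullet> (\<Gamma> *v (A *v y)) = x \<bullet> y - x $ 0 * y $ 0"
proof -
  have "card {j :: 'n. j \<noteq> 0} < CARD('n)"
    by (rule psubset_card_mono) auto
  from orthonormal_frame_exists[OF pos sym this, of v] obtain a
    where a': "\<forall>i\<in>{j :: 'n. j \<noteq> 0}. a i \<bullet> (\<Gamma> *v v) = 0 \<and>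
      (\<forall>j\<in>{j. j \<noteq> 0}. a i \<bullet> (\<Gamma> *v a j) = (if i = j then 1 else 0))" ..
  have a: "i \<noteq> 0 \<Longrightarrow> a i \<bullet> (\<Gamma> *v v) = 0"
    "i \<noteq> 0 \<Longrightarrow> j \<noteq> 0 \<Longrightarrow> a i \<bullet> (\<Gamma> *v a j) = (if i = j then 1 else 0)" for i j
    using a' by blast+
  define A :: "real ^ ('n::{finite,zero}) ^ ('n::{finite,zero})" where "A = (\<chi> i j. if j = 0 then 0 else a j $ i)"
  have col: "A *v axis j 1 = (if j = 0 then 0 else a j)" for j
    by (simp add: matrix_vector_mult_basis column_def A_def vec_eq_iff)
  have exp: "A *v x = (\<Sum>j\<in>UNIV. x $ j *\<^sub>R (A *v axis j 1))" for x
  proof -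
    have "A *v x = A *v (\<Sum>j\<in>UNIV. x $ j *\<^sub>R axis j 1)"
      using basis_expansion[of x] by (simp add: scalar_mult_eq_scaleR)
    then show ?thesis
      by (simp add: linear_sum[OF matrix_vector_mul_linear] matrix_vector_mult_scaleR)
  qed
  have orth: "(A *v axis i 1) \<bullet> (\<Gamma> *v (A *v y)) = (if i = 0 then 0 else y $ i)" for i y
  proof -
    have "(A *v axis i 1) \<bullet> (\<Gamma> *v (A *v y))
        = (\<Sum>j\<in>UNIV. y $ j * ((A *v axis i 1) \<bullet> (\<Gamma> *v (A *v axis j 1))))"
      by (subst exp[of y]) (simp add: linear_sum[OF matrix_vector_mul_linear] matrix_vector_mult_scaleR inner_sum_right)
    also have "\<dots> = (\<Sum>j\<in>UNIV. if j = i then (if i = 0 then 0 else y $ i) else 0)"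
      by (intro sum.cong) (auto simp: col a)
    finally show ?thesis
      by simp
  qed
  show ?thesis
  proof (rule that)
    show "A *v e0 = 0"
      by (simp add: e0_def col)
    show "(A *v x) \<bullet> (\<Gamma> *v v) = 0" for x
      by (subst exp) (auto simp: inner_sum_left col a intro!: sum.neutral)
    show "(A *v x) \<bullet> (\<Gamma> *v (A *v y)) = x \<bullet> y - x $ 0 * y $ 0" for x y
    proof -
      have "(A *v x) \<bullet> (\<Gamma> *v (A *v y)) = (\<Sum>i\<in>UNIV. x $ i * (if i = 0 then 0 else y $ i))"
        by (subst exp[of x]) (simp add: inner_sum_left orth)
      also have "\<dots> = (\<Sum>i\<in>UNIV. x $ i * y $ i - (if i = 0 then x $ 0 * y $ 0 else 0))"
        by (intro sum.cong) auto
      finally show ?thesis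
        by (simp add: sum_subtractf inner_vec_def)
    qed
  qed
qed

text \<open>The frame solves \<open>A' = \<Lambda> A\<close> with \<open>\<Lambda> = L + q m\<^sup>T\<close>. Write \<open>X = \<Gamma> L\<close>. Conservation of the \<open>\<Gamma>\<close>-products of the
columns requires \<open>X + X\<^sup>T = - \<Gamma>'\<close>, and symmetry of \<open>B\<close> requires that \<open>C - X\<close> be symmetric; these fix the symmetric
and the antisymmetric part of \<open>X\<close>. The component along \<open>q\<close> affects neither condition, because the columns
are \<open>\<Gamma>\<close>-orthogonal to \<open>q\<close>, and \<open>m\<close> is chosen so that this orthogonality persists.\<close>

lemma adapted_frame_exists:
  fixes \<Gamma> C :: "real \<Rightarrow> real ^ ('n::{finite,zero}) ^ ('n::{finite,zero})" and q :: "real \<Rightarrow> real ^ ('n::{finite,zero})"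
  assumes J: "open J" "0 \<in> J" and smooth: "smooth_on J \<Gamma>" "smooth_on J C" "smooth_on J q"
    and pos: "\<And>t u. t \<in> J \<Longrightarrow> u \<noteq> 0 \<Longrightarrow> 0 < u \<bullet> (\<Gamma> t *v u)"
    and sym: "\<And>t. t \<in> J \<Longrightarrow> transpose (\<Gamma> t) = \<Gamma> t"
    and q: "\<And>t. t \<in> J \<Longrightarrow> q t \<noteq> 0"
  obtains h and A B :: "real \<Rightarrow> real ^ ('n::{finite,zero}) ^ ('n::{finite,zero})" where
    "0 < h" "{-h<..<h} \<subseteq> J" "smooth_on {-h<..<h} A" "smooth_on {-h<..<h} B"
    "\<And>t. t \<in> {-h<..<h} \<Longrightarrow> A t *v e0 = 0"
    "\<And>t x. t \<in> {-h<..<h} \<Longrightarrow> (A t *v x) \<bullet> (\<Gamma> t *v q t) = 0"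
    "\<And>t x y. t \<in> {-h<..<h} \<Longrightarrow> (A t *v x) \<bullet> (\<Gamma> t *v (A t *v y)) = x \<bullet> y - x $ 0 * y $ 0"
    "\<And>t. t \<in> {-h<..<h} \<Longrightarrow> transpose (B t) = B t"
    "\<And>t x y. t \<in> {-h<..<h} \<Longrightarrow>
      (B t *v x) \<bullet> y = - ((A t *v y) \<bullet> (C t *v (A t *v x) - \<Gamma> t *v (velocity A t *v x)))"
proof -
  note inv = posdef_invertible[OF pos]
  define \<Gamma>' where "\<Gamma>' = velocity \<Gamma>"
  define X where "X t = - (1 / 2) *\<^sub>R \<Gamma>' t + (1 / 2) *\<^sub>R (C t - transpose (C t))" for t
  define L where "L t = matrix_inv (\<Gamma> t) ** X t" for t
  define p where "p t = \<Gamma> t *v q t" for t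
  define m where "m t = - (inverse (q t \<bullet> p t) *\<^sub>R (transpose (L t) *v p t + velocity p t))" for t
  define \<Lambda> where "\<Lambda> t = L t + outer (q t) (m t)" for t
  have sm_p: "smooth_on J p"
    unfolding p_def by (intro smooth_on_matrix_vector smooth)
  have qp: "q t \<bullet> p t \<noteq> 0" if "t \<in> J" for t
    using pos[OF that q[OF that]] by (simp add: p_def)
  have sm_\<Gamma>': "smooth_on J \<Gamma>'"
    unfolding \<Gamma>'_def by (rule smooth_on_velocity[OF smooth(1)])
  have sm_scaleR: "smooth_on J (\<lambda>t. r *\<^sub>R F t)" if "smooth_on J F" for r and F :: "real \<Rightarrow> real ^ ('n::{finite,zero}) ^ ('n::{finite,zero})"
    using smooth_on_scaleR[OF smooth_on_const[OF J(1)] that] .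
  have sm_L: "smooth_on J L"
    unfolding L_def X_def
    by (intro smooth_on_matrix_matrix smooth_on_matrix_inv smooth inv smooth_on_add sm_scaleR sm_\<Gamma>'
        smooth_on_diff smooth_on_transpose)
  have sm_\<Lambda>: "smooth_on J \<Lambda>"
    unfolding \<Lambda>_def m_def
    by (intro smooth_on_add sm_L smooth_on_outer smooth smooth_on_minus smooth_on_scaleR smooth_on_inverse
        smooth_on_inner sm_p qp smooth_on_matrix_vector smooth_on_transpose smooth_on_velocity)
  \<comment> \<open>With the fundamental matrix \<open>\<Phi>\<close>, the relation \<open>A e0 = 0\<close> holds at all times because it holds for \<open>A0\<close>.\<close>
  obtain h \<Phi> where h: "0 < h" "{-h<..<h} \<subseteq> J" and \<Phi>0: "\<Phi> 0 = mat 1"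
    and \<Phi>: "\<And>t. t \<in> {-h<..<h} \<Longrightarrow> (\<Phi> has_vector_derivative \<Lambda> t ** \<Phi> t) (at t)"
    using linear_ode_local_solution[OF bounded_bilinear_matrix_matrix_mult J smooth_on_continuous[OF sm_\<Lambda>],
        where a = "mat 1 :: real ^ ('n::{finite,zero}) ^ ('n::{finite,zero})"] by metis
  let ?K = "{-h<..<h}"
  have KJ: "t \<in> J" if "t \<in> ?K" for t
    using h that by blast
  have sm: "smooth_on ?K F" if "smooth_on J F" for F :: "real \<Rightarrow> 'b::euclidean_space"
    using smooth_on_subset[OF that] h by simp
  have sm_\<Phi>: "smooth_on ?K \<Phi>"
  proof (rule smooth_onI_bootstrap)
    show "(\<Phi> has_derivative (\<lambda>r. r *\<^sub>R (\<Lambda> t ** \<Phi> t))) (at t)" if "t \<in> ?K" for t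
      using \<Phi>[OF that] by (simp add: has_vector_derivative_def)
    show "Ck_on k ?K (\<lambda>t. r *\<^sub>R (\<Lambda> t ** \<Phi> t))" if "Ck_on k ?K \<Phi>" for k r
      by (intro Ck_on_bilinear[OF bounded_bilinear_scaleR] Ck_on_bilinear[OF bounded_bilinear_matrix_matrix_mult]
          Ck_on_const smooth_on_Ck[OF sm[OF sm_\<Lambda>]] that) simp_all
  qed simp
  obtain A0 :: "real ^ ('n::{finite,zero}) ^ ('n::{finite,zero})" where A0: "A0 *v e0 = 0" "\<And>x. (A0 *v x) \<bullet> (\<Gamma> 0 *v q 0) = 0"
    "\<And>x y. (A0 *v x) \<bullet> (\<Gamma> 0 *v (A0 *v y)) = x \<bullet> y - x $ 0 * y $ 0"
    using initial_frame_exists[OF pos[OF J(2)] sym[OF J(2)]] by blast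
  define A where "A t = \<Phi> t ** A0" for t
  have sm_A: "smooth_on ?K A"
    unfolding A_def by (intro smooth_on_matrix_matrix sm_\<Phi> smooth_on_const) simp
  have Ax: "((\<lambda>t. A t *v x) has_vector_derivative \<Lambda> t *v (A t *v x)) (at t)" if "t \<in> ?K" for t x
    using has_vector_derivative_matrix_vector[OF \<Phi>[OF that] has_vector_derivative_const[of "A0 *v x"]]
    by (simp add: A_def matrix_vector_mul_assoc matrix_mul_assoc)
  have velA: "velocity A t *v x = \<Lambda> t *v (A t *v x)" if "t \<in> ?K" for t x
    using has_vector_derivative_matrix_vector[OF velocity_works[OF sm_A that] has_vector_derivative_const[of x]]
      Ax[OF that, of x] vector_derivative_unique_at by fastforce
  have \<Gamma>s: "(\<Gamma> t *v x) \<bullet> y = x \<bullet> (\<Gamma> t *v y)" if "t \<in> J" for t x y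
    using inner_transpose_left[of "\<Gamma> t" x y] sym[OF that] by simp
  have \<Gamma>'s: "(\<Gamma>' t *v x) \<bullet> y = x \<bullet> (\<Gamma>' t *v y)" if "t \<in> J" for t x y
  proof -
    have "transpose (\<Gamma>' t) = \<Gamma>' t"
      unfolding \<Gamma>'_def
      by (rule velocity_linear_eq[OF smooth(1) that bounded_linear_transpose bounded_linear_ident]) (rule sym)
    then show ?thesis
      using inner_transpose_left[of "\<Gamma>' t" x y] by simp
  qed
  have \<Lambda>x: "\<Lambda> t *v x = L t *v x + (m t \<bullet> x) *\<^sub>R q t" for t x
    by (simp add: \<Lambda>_def outer_works matrix_vector_mult_add_rdistrib)
  have \<Gamma>L: "\<Gamma> t *v (L t *v x) = X t *v x" if "t \<in> J" for t x
    by (simp add: L_def matrix_vector_mul_assoc matrix_mul_assoc matrix_inv_works[OF inv[OF that]])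
  have Xx: "X t *v x = - (1 / 2) *\<^sub>R (\<Gamma>' t *v x) + (1 / 2) *\<^sub>R (C t *v x - transpose (C t) *v x)" for t x
    by (simp only: X_def matrix_vector_mult_add_rdistrib matrix_vector_mult_diff_rdistrib
        flip: scaleR_matrix_vector_assoc)
  have Ae0: "A t *v e0 = 0" for t
    by (simp add: A_def A0 flip: matrix_vector_mul_assoc)
  have A_init: "A 0 = A0"
    by (simp add: A_def \<Phi>0)
  have Aq: "(A t *v x) \<bullet> p t = 0" if "t \<in> ?K" for t x
  proof -
    have "((\<lambda>t. (A t *v x) \<bullet> p t) has_vector_derivative 0) (at t)" if t: "t \<in> ?K" for t
    proof -
      have "(\<Lambda> t *v (A t *v x)) \<bullet> p t = - ((A t *v x) \<bullet> velocity p t)"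
      proof -
        have "m t \<bullet> (A t *v x) = - (inverse (q t \<bullet> p t) * ((L t *v (A t *v x)) \<bullet> p t + (A t *v x) \<bullet> velocity p t))"
          by (simp add: m_def inner_transpose_left inner_commute[of "p t"] inner_commute[of "velocity p t"] inner_add_left)
        then show ?thesis
          using qp[OF KJ[OF t]] by (simp add: \<Lambda>x inner_add_left inner_diff_left field_simps)
      qed
      then show ?thesis
        using has_vector_derivative_inner[OF Ax[OF t, of x] velocity_works[OF sm_p KJ[OF t]]] by simp
    qed
    from constant_on_interval[OF this h(1) that] show ?thesis
      by (simp add: A_init A0 p_def)
  qed
  have AA: "(A t *v x) \<bullet> (\<Gamma> t *v (A t *v y)) = x \<bullet> y - x $ 0 * y $ 0" if "t \<in> ?K" for t x y
  proof -
    have "((\<lambda>t. (A t *v x) \<bullet> (\<Gamma> t *v (A t *v y))) has_vector_derivative 0) (at t)" if t: "t \<in> ?K" for t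
    proof -
      let ?a = "A t *v x" and ?b = "A t *v y"
      note tJ = KJ[OF t]
      have "?a \<bullet> (\<Gamma> t *v (\<Lambda> t *v ?b)) = ?a \<bullet> (X t *v ?b)"
        using Aq[OF t, of x]
        by (simp add: \<Lambda>x matrix_vector_right_distrib matrix_vector_mult_scaleR inner_add_right \<Gamma>L[OF tJ] flip: p_def)
      moreover have "(\<Lambda> t *v ?a) \<bullet> (\<Gamma> t *v ?b) = (X t *v ?a) \<bullet> ?b"
        using Aq[OF t, of y]
        by (simp add: \<Lambda>x matrix_vector_right_distrib matrix_vector_mult_scaleR inner_add_left \<Gamma>L[OF tJ]
            inner_commute[of "p t"] flip: p_def \<Gamma>s[OF tJ])
      moreover have "?a \<bullet> (X t *v ?b) + ?a \<bullet> (\<Gamma>' t *v ?b) + (X t *v ?a) \<bullet> ?b = 0"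
        by (simp add: Xx inner_add_left inner_add_right inner_diff_left inner_diff_right inner_transpose_left
            inner_transpose_right \<Gamma>'s[OF tJ] field_simps)
      moreover have "((\<lambda>t. (A t *v x) \<bullet> (\<Gamma> t *v (A t *v y))) has_vector_derivative
          ?a \<bullet> (\<Gamma> t *v (\<Lambda> t *v ?b) + \<Gamma>' t *v ?b) + (\<Lambda> t *v ?a) \<bullet> (\<Gamma> t *v ?b)) (at t)"
        unfolding \<Gamma>'_def
        by (intro has_vector_derivative_inner has_vector_derivative_matrix_vector Ax t velocity_works[OF smooth(1) tJ])
      ultimately show ?thesis
        by (simp add: inner_add_right)
    qed
    from constant_on_interval[OF this h(1) that] show ?thesis
      by (simp add: A_init A0)
  qed
  define B where "B t = - (1 / 2) *\<^sub>R (transpose (A t) ** (C t + transpose (C t) + \<Gamma>' t) ** A t)" for t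
  have sm_B: "smooth_on ?K B"
    unfolding B_def
    by (intro smooth_on_scaleR smooth_on_const smooth_on_matrix_matrix smooth_on_transpose smooth_on_add
        sm_A sm smooth sm_\<Gamma>') simp
  have Bxy: "(B t *v x) \<bullet> y = - (1 / 2) * ((C t *v (A t *v x)) \<bullet> (A t *v y)
      + (A t *v x) \<bullet> (C t *v (A t *v y)) + (\<Gamma>' t *v (A t *v x)) \<bullet> (A t *v y))" for t x y
    unfolding B_def
    by (simp only: matrix_vector_mult_add_rdistrib inner_transpose_left inner_scaleR_left inner_add_left
        flip: scaleR_matrix_vector_assoc matrix_vector_mul_assoc)
  show ?thesis
  proof (rule that[of h A B])
    fix t assume t: "t \<in> ?K"
    note tJ = KJ[OF t]
    show "(A t *v x) \<bullet> (\<Gamma> t *v q t) = 0" for x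
      using Aq[OF t] by (simp add: p_def)
    show "(A t *v x) \<bullet> (\<Gamma> t *v (A t *v y)) = x \<bullet> y - x $ 0 * y $ 0" for x y
      by (rule AA[OF t])
    have "(transpose (B t) *v x) \<bullet> y = (B t *v x) \<bullet> y" for x y
      using \<Gamma>'s[OF tJ, of "A t *v x" "A t *v y"]
      by (simp only: inner_transpose_left inner_commute[of x] Bxy) (simp add: inner_commute)
    then show "transpose (B t) = B t"
      by (metis matrix_eq vector_eq_rdot)
    fix x y
    have "(A t *v y) \<bullet> (\<Gamma> t *v (velocity A t *v x)) = (A t *v y) \<bullet> (X t *v (A t *v x))"
      using Aq[OF t, of y]
      by (simp add: velA[OF t] \<Lambda>x matrix_vector_right_distrib matrix_vector_mult_scaleR inner_add_right \<Gamma>L[OF tJ]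
          flip: p_def)
    then show "(B t *v x) \<bullet> y = - ((A t *v y) \<bullet> (C t *v (A t *v x) - \<Gamma> t *v (velocity A t *v x)))"
      by (simp add: Bxy inner_diff_right Xx inner_add_right inner_transpose_right inner_commute[of "A t *v y"]
          inner_commute[of "A t *v x"] field_simps)
  qed (use h sm_A sm_B Ae0 in auto)
qed

section \<open>Existence of the normal form\<close>

text \<open>The right-hand side of the equations of motion is a smooth function of the orbit. The interval \<open>I\<close> may
contain its end points, hence the restriction to its interior.\<close>

lemma hamiltonian_orbit_smooth:
  fixes H :: "'n::finite phase \<Rightarrow> real"
  assumes H: "smooth_on UNIV H" and orbit: "hamiltonian_orbit H I Q P"
  shows "smooth_on (interior I) Q" "smooth_on (interior I) P"
    "\<And>t. t \<in> interior I \<Longrightarrow> velocity Q t = grad_p H (Q t, P t)"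
proof -
  have D: "(Q has_vector_derivative grad_p H (Q t, P t)) (at t)"
    "(P has_vector_derivative - grad_q H (Q t, P t)) (at t)" if "t \<in> interior I" for t
    using orbit that interior_subset[of I] unfolding hamiltonian_orbit_def
    by (auto simp flip: at_within_interior[OF that])
  have sm: "smooth_on UNIV (\<lambda>z. (grad_p H z, - grad_q H z))"
    unfolding grad_p_def grad_q_def
    by (intro smooth_on_Pair smooth_on_minus smooth_on_vecI)
      (simp_all add: H smooth_on_dp dq_def partial_deriv_def smooth_on_directional_derivative)
  have "smooth_on (interior I) (\<lambda>t. (Q t, P t))"
  proof (rule smooth_onI_bootstrap)
    show "((\<lambda>t. (Q t, P t)) has_derivative
        (\<lambda>r. r *\<^sub>R (grad_p H (Q t, P t), - grad_q H (Q t, P t)))) (at t)" if "t \<in> interior I" for t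
      using has_derivative_Pair[OF D(1)[OF that, unfolded has_vector_derivative_def]
          D(2)[OF that, unfolded has_vector_derivative_def]] by simp
    show "Ck_on k (interior I) (\<lambda>t. r *\<^sub>R (grad_p H (Q t, P t), - grad_q H (Q t, P t)))"
      if "Ck_on k (interior I) (\<lambda>t. (Q t, P t))" for k r
      by (rule Ck_on_bilinear[OF bounded_bilinear_scaleR open_interior Ck_on_const[OF open_interior]
            Ck_on_compose[OF open_interior open_UNIV _ that smooth_on_Ck[OF sm]]]) simp
  qed simp
  from smooth_on_fst[OF this] smooth_on_snd[OF this]
  show "smooth_on (interior I) Q" "smooth_on (interior I) P"
    by simp_all
  show "velocity Q t = grad_p H (Q t, P t)" if "t \<in> interior I" for t
    by (rule velocity_eqI[OF D(1)[OF that]])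
qed

lemma smooth_on_first_coordinate:
  fixes F :: "real \<Rightarrow> 'b::euclidean_space"
  assumes "smooth_on K F"
  shows "smooth_on {x :: real ^ ('n::{finite,zero}). x $ 0 \<in> K} (\<lambda>x. F (x $ 0))"
proof -
  have op: "open {x :: real ^ ('n::{finite,zero}). x $ 0 \<in> K}"
    using open_vimage[OF smooth_on_open[OF assms], of "\<lambda>x :: real ^ ('n::{finite,zero}). x $ 0"]
    by (simp add: vimage_def continuous_intros)
  show ?thesis
    by (rule smooth_on_compose[OF assms smooth_on_vec_nth[OF smooth_on_id[OF op]]]) simp
qed

lemma has_derivative_first_coordinate:
  fixes F :: "real \<Rightarrow> 'b::euclidean_space" and x :: "real ^ ('n::{finite,zero})"
  assumes "smooth_on K F" "x $ 0 \<in> K"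
  shows "((\<lambda>x. F (x $ 0)) has_derivative (\<lambda>\<xi>. \<xi> $ 0 *\<^sub>R velocity F (x $ 0))) (at x)"
  using has_derivative_compose[OF bounded_linear.has_derivative[OF bounded_linear_vec_nth has_derivative_ident]
      velocity_works[OF assms, unfolded has_vector_derivative_def]] .

definition tube_map :: "(real \<Rightarrow> real ^ ('n::{finite,zero})) \<Rightarrow> (real \<Rightarrow> real ^ ('n::{finite,zero}) ^ ('n::{finite,zero})) \<Rightarrow> real ^ ('n::{finite,zero}) \<Rightarrow> real ^ ('n::{finite,zero})" where
  "tube_map Q A x = Q (x $ 0) + A (x $ 0) *v x"

text \<open>For symmetric \<open>B\<close> this is the differential of
  \<open>\<lambda>x. s (x $ 0) + c (x $ 0) \<bullet> x + x \<bullet> (B (x $ 0) *v x) / 2\<close>, where \<open>s\<close> is a primitive of \<open>b\<close>.\<close>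

definition gauge_form :: "(real \<Rightarrow> real) \<Rightarrow> (real \<Rightarrow> real ^ ('n::{finite,zero})) \<Rightarrow>
    (real \<Rightarrow> real ^ ('n::{finite,zero}) ^ ('n::{finite,zero})) \<Rightarrow> real ^ ('n::{finite,zero}) \<Rightarrow> real ^ ('n::{finite,zero})" where
  "gauge_form b c B x = B (x $ 0) *v x + c (x $ 0) +
    (b (x $ 0) + velocity c (x $ 0) \<bullet> x + (x \<bullet> (velocity B (x $ 0) *v x)) / 2) *\<^sub>R e0"

context
  fixes K :: "real set" and Q c :: "real \<Rightarrow> real ^ ('n::{finite,zero})"
    and A B :: "real \<Rightarrow> real ^ ('n::{finite,zero}) ^ ('n::{finite,zero})" and b :: "real \<Rightarrow> real"
  assumes Q: "smooth_on K Q" and A: "smooth_on K A" and B: "smooth_on K B" and c: "smooth_on K c"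
    and b: "smooth_on K b" and B_sym: "\<And>t. t \<in> K \<Longrightarrow> transpose (B t) = B t"
begin

abbreviation "strip \<equiv> {x :: real ^ ('n::{finite,zero}). x $ 0 \<in> K}"

lemma open_strip: "open strip"
  using smooth_on_open[OF smooth_on_first_coordinate[OF Q]] .

lemma smooth_on_tube_map: "smooth_on strip (tube_map Q A)"
  unfolding tube_map_def
  by (intro smooth_on_add smooth_on_matrix_vector smooth_on_first_coordinate Q A smooth_on_id open_strip)

lemma smooth_on_gauge_form: "smooth_on strip (gauge_form b c B)"
proof -
  have "smooth_on strip (\<lambda>x. B (x $ 0) *v x + c (x $ 0) +
    (b (x $ 0) + velocity c (x $ 0) \<bullet> x + (1 / 2) * (x \<bullet> (velocity B (x $ 0) *v x))) *\<^sub>R e0)"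
    by (intro smooth_on_add smooth_on_matrix_vector smooth_on_first_coordinate A B b c smooth_on_id open_strip
        smooth_on_scaleR smooth_on_inner smooth_on_mult smooth_on_const smooth_on_velocity)
  then show ?thesis
    by (simp add: gauge_form_def[abs_def])
qed

lemma derivative_tube_map:
  assumes "x \<in> strip"
  shows "frechet_derivative (tube_map Q A) (at x) \<xi> =
    \<xi> $ 0 *\<^sub>R (velocity Q (x $ 0) + velocity A (x $ 0) *v x) + A (x $ 0) *v \<xi>"
proof -
  have x: "x $ 0 \<in> K"
    using assms by simp
  have "((\<lambda>x. Q (x $ 0) + A (x $ 0) *v x) has_derivative
      (\<lambda>\<xi>. \<xi> $ 0 *\<^sub>R velocity Q (x $ 0) + (A (x $ 0) *v \<xi> + (\<xi> $ 0 *\<^sub>R velocity A (x $ 0)) *v x))) (at x)"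
    by (intro has_derivative_add has_derivative_first_coordinate[OF Q x]
        bounded_bilinear.FDERIV[OF bounded_bilinear_matrix_vector_mult has_derivative_first_coordinate[OF A x]
          has_derivative_ident])
  from fun_cong[OF frechet_derivative_at[OF this, symmetric], of \<xi>] show ?thesis
    by (simp add: tube_map_def[abs_def] scaleR_add_right add_ac flip: scaleR_matrix_vector_assoc)
qed

lemma derivative_gauge_form:
  assumes "x \<in> strip"
  shows "frechet_derivative (gauge_form b c B) (at x) \<xi> \<bullet> \<zeta> =
    (B (x $ 0) *v \<xi>) \<bullet> \<zeta> + \<xi> $ 0 * ((velocity B (x $ 0) *v x + velocity c (x $ 0)) \<bullet> \<zeta>)
    + \<zeta> $ 0 * ((velocity B (x $ 0) *v x + velocity c (x $ 0)) \<bullet> \<xi>)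
    + \<xi> $ 0 * \<zeta> $ 0 * (velocity b (x $ 0) + velocity (velocity c) (x $ 0) \<bullet> x
        + (x \<bullet> (velocity (velocity B) (x $ 0) *v x)) / 2)"
proof -
  have x: "x $ 0 \<in> K"
    using assms by simp
  note vB = smooth_on_velocity[OF B] and vc = smooth_on_velocity[OF c]
  note mv = bounded_bilinear.FDERIV[OF bounded_bilinear_matrix_vector_mult has_derivative_first_coordinate[OF _ x]
      has_derivative_ident]
  have "((\<lambda>x. B (x $ 0) *v x + c (x $ 0) +
      (b (x $ 0) + velocity c (x $ 0) \<bullet> x + (1 / 2) * (x \<bullet> (velocity B (x $ 0) *v x))) *\<^sub>R e0) has_derivative
    (\<lambda>\<xi>. (B (x $ 0) *v \<xi> + (\<xi> $ 0 *\<^sub>R velocity B (x $ 0)) *v x) + \<xi> $ 0 *\<^sub>R velocity c (x $ 0) +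
      (\<xi> $ 0 *\<^sub>R velocity b (x $ 0)
       + (velocity c (x $ 0) \<bullet> \<xi> + (\<xi> $ 0 *\<^sub>R velocity (velocity c) (x $ 0)) \<bullet> x)
       + (1 / 2) * (x \<bullet> (velocity B (x $ 0) *v \<xi> + (\<xi> $ 0 *\<^sub>R velocity (velocity B) (x $ 0)) *v x)
          + \<xi> \<bullet> (velocity B (x $ 0) *v x))) *\<^sub>R e0)) (at x)"
    by (intro has_derivative_add has_derivative_scaleR_left has_derivative_mult_right has_derivative_inner
        has_derivative_ident mv[OF B] mv[OF vB] has_derivative_first_coordinate[OF _ x] vB vc B b c)
  from fun_cong[OF frechet_derivative_at[OF this], of \<xi>] have
    "frechet_derivative (gauge_form b c B) (at x) \<xi> =
      (B (x $ 0) *v \<xi> + (\<xi> $ 0 *\<^sub>R velocity B (x $ 0)) *v x) + \<xi> $ 0 *\<^sub>R velocity c (x $ 0) +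
      (\<xi> $ 0 *\<^sub>R velocity b (x $ 0)
       + (velocity c (x $ 0) \<bullet> \<xi> + (\<xi> $ 0 *\<^sub>R velocity (velocity c) (x $ 0)) \<bullet> x)
       + (1 / 2) * (x \<bullet> (velocity B (x $ 0) *v \<xi> + (\<xi> $ 0 *\<^sub>R velocity (velocity B) (x $ 0)) *v x)
          + \<xi> \<bullet> (velocity B (x $ 0) *v x))) *\<^sub>R e0"
    by (simp add: gauge_form_def[abs_def])
  moreover have "x \<bullet> (velocity B (x $ 0) *v \<xi>) = \<xi> \<bullet> (velocity B (x $ 0) *v x)"
  proof -
    have "transpose (velocity B (x $ 0)) = velocity B (x $ 0)"
      by (rule velocity_linear_eq[OF B x bounded_linear_transpose bounded_linear_ident]) (rule B_sym)
    then show ?thesis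
      using inner_transpose_left[of "velocity B (x $ 0)" x \<xi>] by (simp add: inner_commute)
  qed
  moreover have "(velocity B (x $ 0) *v x) \<bullet> \<xi> = \<xi> \<bullet> (velocity B (x $ 0) *v x)"
    by (rule inner_commute)
  ultimately show ?thesis
    by (simp add: inner_add_left inner_add_right inner_e0 algebra_simps flip: scaleR_matrix_vector_assoc)
qed

text \<open>The derivative is the Hessian of the potential, written out explicitly.\<close>

lemma gauge_form_closed:
  assumes "x \<in> strip"
  shows "frechet_derivative (gauge_form b c B) (at x) \<xi> \<bullet> \<zeta> = frechet_derivative (gauge_form b c B) (at x) \<zeta> \<bullet> \<xi>"
proof -
  have "(B (x $ 0) *v \<xi>) \<bullet> \<zeta> = (B (x $ 0) *v \<zeta>) \<bullet> \<xi>"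
    using inner_transpose_left[of "B (x $ 0)" \<xi> \<zeta>] B_sym assms by (simp add: inner_commute)
  then show ?thesis
    by (simp add: derivative_gauge_form[OF assms])
qed

end

text \<open>The one-form has \<open>c = A\<^sup>T P\<close> and \<open>b = P \<bullet> q\<close>, which makes it agree with \<open>D\<phi>\<^sup>T P\<close> on the segment, and
the matrix \<open>B\<close> of the adapted frame, which cancels the transverse mixed derivatives.\<close>

lemma normal_form_exists:
  fixes H :: "'n::{finite,zero} phase \<Rightarrow> real"
  assumes H: "smooth_on UNIV H" and convex: "convex_in_p H" and orbit: "hamiltonian_orbit H I Q P"
    and moving: "vector_derivative Q (at 0) \<noteq> 0"
  shows "\<exists>W \<psi> \<delta>. 0 < \<delta> \<and> {0..\<delta>} \<subseteq> I \<and> normalizes \<delta> H (\<lambda>t. (Q t, P t)) W \<psi>"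
proof -
  note sm_orbit = hamiltonian_orbit_smooth[OF H orbit]
  define q where "q = velocity Q"
  have sm_q: "smooth_on (interior I) q"
    unfolding q_def by (rule smooth_on_velocity[OF sm_orbit(1)])
  \<comment> \<open>The velocity is the fibre gradient along the orbit; away from its zeros it can complete a frame.\<close>
  define J where "J = interior I \<inter> q -` (- {0})"
  have "open J"
    unfolding J_def by (rule continuous_open_preimage[OF smooth_on_continuous[OF sm_q]]) auto
  have "0 \<in> interior I"
    using orbit by (simp add: hamiltonian_orbit_def)
  then have "0 \<in> J"
    using moving vector_derivative_at[OF velocity_works[OF sm_orbit(1)]] by (simp add: J_def q_def)
  have sub: "smooth_on J F" if "smooth_on (interior I) F" for F :: "real \<Rightarrow> 'b::euclidean_space"
    by (rule smooth_on_subset[OF that \<open>open J\<close>]) (simp add: J_def)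
  define z where "z t = (Q t, P t)" for t
  have sm_z: "smooth_on J z"
    unfolding z_def by (intro smooth_on_Pair sub sm_orbit)
  have along: "smooth_on J (\<lambda>t. F (z t))" if "smooth_on UNIV F" for F :: "'n phase \<Rightarrow> real"
    by (rule smooth_on_compose[OF that sm_z]) simp
  define G where "G t = hess_pp H (z t)" for t
  define Hm where "Hm t = matrix (\<lambda>\<xi>. frechet_derivative (grad_p H) (at (z t)) (\<xi>, 0))" for t
  define \<Gamma> where "\<Gamma> t = matrix_inv (G t)" for t
  have sm_G: "smooth_on J G"
    unfolding G_def hess_pp_def by (intro smooth_on_vecI \<open>open J\<close>) (simp add: along smooth_on_dp H)
  have sm_Hm: "smooth_on J Hm"
  proof (intro smooth_on_vecI \<open>open J\<close>)
    fix i j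
    have "smooth_on J (\<lambda>t. frechet_derivative (grad_p H) (at (z t)) (axis j 1, 0) $ i)"
      by (rule along) (intro smooth_on_vec_nth smooth_on_directional_derivative smooth_on_grad_p H)
    then show "smooth_on J (\<lambda>t. Hm t $ i $ j)"
      by (simp add: Hm_def matrix_def)
  qed
  have G_pos: "0 < u \<bullet> (G t *v u)" if "u \<noteq> 0" for t u
    using convex that unfolding convex_in_p_def G_def by blast
  have G_inv: "invertible (G t)" for t
    by (rule posdef_invertible[OF G_pos])
  have G\<Gamma>: "G t *v (\<Gamma> t *v v) = v" "\<Gamma> t *v (G t *v v) = v" for t v
    by (simp_all add: \<Gamma>_def matrix_vector_mul_assoc matrix_inv_works[OF G_inv])
  have G_sym: "transpose (G t) = G t" for t
    unfolding G_def by (rule hess_pp_symmetric[OF H]) simp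
  have G_inner: "(G t *v u) \<bullet> v = u \<bullet> (G t *v v)" for t u v
    using inner_transpose_left[of "G t" u v] by (simp add: G_sym)
  have \<Gamma>_inner: "(\<Gamma> t *v u) \<bullet> v = u \<bullet> (\<Gamma> t *v v)" for t u v
    using G_inner[of t "\<Gamma> t *v u" "\<Gamma> t *v v"] by (simp add: G\<Gamma>)
  have \<Gamma>_sym: "transpose (\<Gamma> t) = \<Gamma> t" for t
    by (rule matrix_eq[THEN iffD2]) (metis \<Gamma>_inner inner_transpose_left vector_eq_rdot)
  have \<Gamma>_pos: "0 < u \<bullet> (\<Gamma> t *v u)" if "u \<noteq> 0" for t u
    using G_pos[of "\<Gamma> t *v u" t] that G\<Gamma>(1)[of t u] by (metis inner_commute matrix_vector_mult_0_right)
  have q_nz: "q t \<noteq> 0" if "t \<in> J" for t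
    using that by (simp add: J_def)
  have sm_\<Gamma>: "smooth_on J \<Gamma>"
    unfolding \<Gamma>_def by (rule smooth_on_matrix_inv[OF sm_G G_inv])
  obtain h and A B :: "real \<Rightarrow> real ^ ('n::{finite,zero}) ^ ('n::{finite,zero})" where h: "0 < h" "{-h<..<h} \<subseteq> J" and sm_A: "smooth_on {-h<..<h} A"
    and sm_B: "smooth_on {-h<..<h} B"
    and Ae0: "\<And>t. t \<in> {-h<..<h} \<Longrightarrow> A t *v e0 = 0"
    and Aq: "\<And>t x. t \<in> {-h<..<h} \<Longrightarrow> (A t *v x) \<bullet> (\<Gamma> t *v q t) = 0"
    and AA: "\<And>t x y. t \<in> {-h<..<h} \<Longrightarrow> (A t *v x) \<bullet> (\<Gamma> t *v (A t *v y)) = x \<bullet> y - x $ 0 * y $ 0"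
    and B_sym: "\<And>t. t \<in> {-h<..<h} \<Longrightarrow> transpose (B t) = B t"
    and BA: "\<And>t x y. t \<in> {-h<..<h} \<Longrightarrow> (B t *v x) \<bullet> y
      = - ((A t *v y) \<bullet> ((\<Gamma> t ** Hm t) *v (A t *v x) - \<Gamma> t *v (velocity A t *v x)))"
    by (rule adapted_frame_exists[OF \<open>open J\<close> \<open>0 \<in> J\<close> sm_\<Gamma> smooth_on_matrix_matrix[OF sm_\<Gamma> sm_Hm] sub[OF sm_q]
          \<Gamma>_pos \<Gamma>_sym q_nz]) (assumption, assumption, rule that)
  let ?K = "{-h<..<h}"
  have subK: "smooth_on ?K F" if "smooth_on J F" for F :: "real \<Rightarrow> 'b::euclidean_space"
    by (rule smooth_on_subset[OF that _ h(2)]) simp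
  have sm_Q: "smooth_on ?K Q" and sm_P: "smooth_on ?K P"
    by (intro subK sub sm_orbit)+
  define c where "c t = transpose (A t) *v P t" for t
  define b where "b t = P t \<bullet> q t" for t
  have sm_c: "smooth_on ?K c"
    unfolding c_def by (intro smooth_on_matrix_vector smooth_on_transpose sm_A sm_P)
  have sm_b: "smooth_on ?K b"
    unfolding b_def by (intro smooth_on_inner sm_P subK sub sm_q)
  have A'e0: "velocity A t *v e0 = 0" if "t \<in> ?K" for t
    by (rule velocity_linear_eq[OF sm_A that bounded_bilinear.bounded_linear_left[OF bounded_bilinear_matrix_vector_mult]
          bounded_linear_zero]) (rule Ae0)
  have Be0: "B t *v e0 = 0" if "t \<in> ?K" for t
    using BA[OF that, of e0 "B t *v e0"] by (simp add: Ae0[OF that] A'e0[OF that])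
  have B'e0: "velocity B t *v e0 = 0" if "t \<in> ?K" for t
    by (rule velocity_linear_eq[OF sm_B that bounded_bilinear.bounded_linear_left[OF bounded_bilinear_matrix_vector_mult]
          bounded_linear_zero]) (rule Be0)
  have c'e0: "velocity c t \<bullet> e0 = 0" if "t \<in> ?K" for t
    by (rule velocity_linear_eq[OF sm_c that bounded_linear_inner_left bounded_linear_zero])
      (simp add: c_def inner_transpose_left Ae0)
  define \<phi> where "\<phi> = tube_map Q A"
  define \<beta> where "\<beta> = gauge_form b c B"
  let ?S = "{x :: real ^ 'n::{finite,zero}. x $ 0 \<in> ?K}"
  note sm_\<phi> = smooth_on_tube_map[OF sm_Q sm_A sm_B sm_c sm_b B_sym, folded \<phi>_def]
    and sm_\<beta> = smooth_on_gauge_form[OF sm_Q sm_A sm_B sm_c sm_b B_sym, folded \<beta>_def]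
  have D\<phi>: "frechet_derivative \<phi> (at x) \<xi> = \<xi> $ 0 *\<^sub>R (q (x $ 0) + velocity A (x $ 0) *v x) + A (x $ 0) *v \<xi>"
    if "x \<in> ?S" for x \<xi>
    unfolding \<phi>_def q_def by (rule derivative_tube_map[OF sm_Q sm_A sm_B sm_c sm_b B_sym that])
  have jac: "jacobian \<phi> (t *\<^sub>R e0) *v \<xi> = \<xi> $ 0 *\<^sub>R q t + A t *v \<xi>" if "t \<in> ?K" for t \<xi>
    using D\<phi>[of "t *\<^sub>R e0" \<xi>] jacobian_works[OF sm_\<phi>, of "t *\<^sub>R e0" \<xi>] that
    by (simp add: e0_nth matrix_vector_mult_scaleR A'e0)
  \<comment> \<open>In the frame formed by \<open>q\<close> and the columns of \<open>A\<close>, the metric \<open>\<Gamma>\<close> is diagonal, with entry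
      \<open>q \<bullet> \<Gamma> q\<close> at \<open>0\<close> and \<open>1\<close> elsewhere.\<close>
  have metric: "(jacobian \<phi> (t *\<^sub>R e0) *v \<xi>) \<bullet> (\<Gamma> t *v (jacobian \<phi> (t *\<^sub>R e0) *v \<zeta>))
      = \<xi> $ 0 * \<zeta> $ 0 * (q t \<bullet> (\<Gamma> t *v q t)) + \<xi> \<bullet> \<zeta> - \<xi> $ 0 * \<zeta> $ 0" if "t \<in> ?K" for t \<xi> \<zeta>
  proof -
    have "q t \<bullet> (\<Gamma> t *v (A t *v \<zeta>)) = 0"
      using Aq[OF that, of \<zeta>] \<Gamma>_inner[of t "q t" "A t *v \<zeta>"] by (simp add: inner_commute)
    then show ?thesis
      by (simp add: jac[OF that] matrix_vector_right_distrib matrix_vector_mult_scaleR inner_add_left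
          inner_add_right Aq[OF that] AA[OF that])
  qed
  have "0 \<in> ?K"
    using h(1) by simp
  have inv0: "invertible (jacobian \<phi> 0)"
  proof -
    have "x = 0" if "jacobian \<phi> 0 *v x = 0" for x
    proof -
      have eq: "0 = x $ 0 * y $ 0 * (q 0 \<bullet> (\<Gamma> 0 *v q 0)) + x \<bullet> y - x $ 0 * y $ 0" for y
        using metric[OF \<open>0 \<in> ?K\<close>, of x y] that by simp
      have "x $ 0 = 0"
        using eq[of e0] \<Gamma>_pos[OF q_nz[OF \<open>0 \<in> J\<close>], of 0] by (auto simp: inner_e0 e0_nth)
      then show "x = 0"
        using eq[of x] by simp
    qed
    then show ?thesis
      using matrix_left_invertible_ker invertible_left_inverse by blast
  qed
  have "0 \<in> ?S"
    using h(1) by simp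
  obtain U V g where U: "open U" "U \<subseteq> ?S" "0 \<in> U" and sm_g: "smooth_on V g" and hom: "homeomorphism U V \<phi> g"
    and inv: "\<And>x. x \<in> U \<Longrightarrow> invertible (jacobian \<phi> x)"
    using smooth_local_inverse[OF sm_\<phi> \<open>0 \<in> ?S\<close> inv0] by blast
  have closed: "frechet_derivative \<beta> (at x) \<xi> \<bullet> \<zeta> = frechet_derivative \<beta> (at x) \<zeta> \<bullet> \<xi>" if "x \<in> U" for x \<xi> \<zeta>
    unfolding \<beta>_def by (rule gauge_form_closed[OF sm_Q sm_A sm_B sm_c sm_b B_sym]) (use that U in blast)+
  note lift_facts = smooth_on_subset[OF sm_\<phi> U(1,2)] smooth_on_subset[OF sm_\<beta> U(1,2)] sm_g hom inv closed
  define \<psi> where "\<psi> = cotangent_lift \<phi> \<beta>"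
  define W where "W = U \<times> (UNIV :: (real ^ 'n::{finite,zero}) set)"
  have fib: "fibered_symplectic_diffeo W \<psi>"
    unfolding W_def \<psi>_def by (rule fibered_symplectic_lift[OF lift_facts])
  obtain e where e: "e > 0" "ball 0 e \<subseteq> U"
    using U open_contains_ball by blast
  define \<delta> where "\<delta> = e / 2"
  have "\<delta> > 0"
    using e by (simp add: \<delta>_def)
  have tU: "t *\<^sub>R e0 \<in> U" if "t \<in> {0..\<delta>}" for t
    using that e by (intro subsetD[OF e(2)]) (auto simp: \<delta>_def e0_def)
  have tK: "t \<in> ?K" if "t \<in> {0..\<delta>}" for t
    using tU[OF that] U(2) by (auto simp: e0_nth)
  have tW: "(t *\<^sub>R e0, 0) \<in> W" if "t \<in> {0..\<delta>}" for t
    using tU[OF that] by (simp add: W_def)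
  have \<psi>z: "\<psi> (t *\<^sub>R e0, 0) = z t" if t: "t \<in> {0..\<delta>}" for t
  proof -
    let ?M = "jacobian \<phi> (t *\<^sub>R e0)"
    note tK = tK[OF t]
    have "transpose ?M *v snd (\<psi> (t *\<^sub>R e0, 0)) = \<beta> (t *\<^sub>R e0)"
      using transpose_jacobian_lift[OF lift_facts, of "(t *\<^sub>R e0, 0)"] tU[OF t] by (simp add: \<psi>_def)
    also have "\<dots> = c t + b t *\<^sub>R e0"
      using c'e0[OF tK] by (simp add: \<beta>_def gauge_form_def e0_nth matrix_vector_mult_scaleR Be0[OF tK] B'e0[OF tK])
    also have "\<dots> = transpose ?M *v P t"
      by (rule inner_eq_leftI)
        (simp add: inner_transpose_right jac[OF tK] inner_add_left inner_add_right c_def b_def inner_e0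
          inner_commute[of _ "P t"])
    finally have "transpose (matrix_inv ?M) *v (transpose ?M *v snd (\<psi> (t *\<^sub>R e0, 0)))
        = transpose (matrix_inv ?M) *v (transpose ?M *v P t)"
      by simp
    then have "snd (\<psi> (t *\<^sub>R e0, 0)) = P t"
      by (simp add: matrix_vector_mul_assoc matrix_inv_works[OF inv[OF tU[OF t]]] transpose_mat
          flip: matrix_transpose_mul)
    moreover have "fst (\<psi> (t *\<^sub>R e0, 0)) = Q t"
    proof -
      have "fst (\<psi> (t *\<^sub>R e0, 0)) = \<phi> (t *\<^sub>R e0)"
        by (simp add: \<psi>_def cotangent_lift_def)
      then show ?thesis
        by (simp add: \<phi>_def tube_map_def e0_nth matrix_vector_mult_scaleR Ae0[OF tK])
    qed
    ultimately show ?thesis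
      by (simp add: z_def prod_eq_iff)
  qed
  have vel: "((\<lambda>s. fst (z s)) has_vector_derivative grad_p H (z t)) (at t within {0..\<delta>})" if t: "t \<in> {0..\<delta>}" for t
  proof -
    have "t \<in> interior I"
      using tK[OF t] h(2) by (auto simp: J_def)
    then show ?thesis
      using has_vector_derivative_at_within[OF velocity_works[OF sm_orbit(1)]] sm_orbit(3) by (simp add: z_def)
  qed
  have K_vel: "grad_p (H \<circ> \<psi>) (t *\<^sub>R e0, 0) = e0" if t: "t \<in> {0..\<delta>}" for t
    by (rule velocity_along_segment[OF fib H \<open>0 < \<delta>\<close> t, of z]) (use tW \<psi>z vel[OF t] in auto)
  have K: "smooth_on W (H \<circ> \<psi>)"
    using smooth_on_comp_fibered[OF fib H] by simp
  have base: "base_jacobian \<psi> y = jacobian \<phi> (fst y)" if "y \<in> W" for y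
    using base_jacobian_works[OF fib that] fst_derivative_lift[OF lift_facts, of y] that
    by (simp add: matrix_eq W_def \<psi>_def)
  have hess: "hess_pp (H \<circ> \<psi>) (t *\<^sub>R e0, 0) *v axis j 1 = axis j 1" if t: "t \<in> {0..\<delta>}" and j: "j \<noteq> 0" for t j
  proof -
    let ?M = "base_jacobian \<psi> (t *\<^sub>R e0, 0)" and ?e = "axis j 1 :: real ^ 'n::{finite,zero}"
    have M: "?M = jacobian \<phi> (t *\<^sub>R e0)"
      using base[OF tW[OF t]] by simp
    have "\<xi> \<bullet> (transpose ?M *v (\<Gamma> t *v (?M *v ?e))) = \<xi> \<bullet> ?e" for \<xi>
      using metric[OF tK[OF t], of \<xi> ?e] j by (simp add: inner_transpose_right M axis_def)
    then have "transpose ?M *v (\<Gamma> t *v (?M *v ?e)) = ?e"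
      by (rule inner_eq_leftI)
    then have "?M *v (hess_pp (H \<circ> \<psi>) (t *\<^sub>R e0, 0) *v ?e)
        = (?M ** hess_pp (H \<circ> \<psi>) (t *\<^sub>R e0, 0) ** transpose ?M) *v (\<Gamma> t *v (?M *v ?e))"
      by (metis matrix_vector_mul_assoc)
    also have "\<dots> = ?M *v ?e"
      by (subst hess_pp_fibered[OF fib H tW[OF t]]) (simp_all add: \<psi>z[OF t] G\<Gamma> flip: G_def)
    finally show ?thesis
      by (rule base_jacobian_injective[OF fib tW[OF t]])
  qed
  have mixed0: "dq 0 (dp j (H \<circ> \<psi>)) (t *\<^sub>R e0, 0) = 0" if t: "t \<in> {0..\<delta>}" for t j
  proof -
    have "frechet_derivative (grad_p (H \<circ> \<psi>)) (at (t *\<^sub>R e0, 0)) (e0, 0) = 0"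
      by (rule derivative_along_segment[OF smooth_on_grad_p[OF K] tW[OF t] \<open>0 < \<delta>\<close> t K_vel has_vector_derivative_const])
    then show ?thesis
      using derivative_grad_p[OF K tW[OF t], of "(e0, 0)" j] by (simp add: dq_def partial_deriv_def e0_def)
  qed
  have mixed: "dq i (dp j (H \<circ> \<psi>)) (t *\<^sub>R e0, 0) = 0" if t: "t \<in> {0..\<delta>}" and ij: "i \<noteq> 0" "j \<noteq> 0" for t i j
  proof -
    let ?z = "(t *\<^sub>R e0, 0) :: 'n phase" and ?ei = "axis i 1 :: real ^ 'n::{finite,zero}"
      and ?ej = "axis j 1 :: real ^ 'n::{finite,zero}"
    let ?M = "base_jacobian \<psi> ?z" and ?k = "frechet_derivative (grad_p (H \<circ> \<psi>)) (at ?z) (?ei, 0)"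
    define w where "w = snd (frechet_derivative \<psi> (at ?z) (?ei, 0))"
    note tW = tW[OF t] and tK = tK[OF t] and tU = tU[OF t]
    have M: "?M = jacobian \<phi> (t *\<^sub>R e0)"
      using base[OF tW] by simp
    have Mi: "?M *v ?ei = A t *v ?ei" "?M *v ?ej = A t *v ?ej"
      using ij by (simp_all add: M jac[OF tK] axis_def)
    have nth0: "?ei $ 0 = 0" "?ej $ 0 = 0"
      using ij by (simp_all add: axis_def)
    \<comment> \<open>Near the segment the field \<open>\<lambda>x. D\<phi> x e\<^sub>k\<close> equals \<open>A (x $ 0) *v e\<^sub>k\<close>, so it is constant in the transverse directions.\<close>
    have D\<phi>k: "((\<lambda>x. frechet_derivative \<phi> (at x) (axis k 1)) has_derivative
        (\<lambda>\<xi>. \<xi> $ 0 *\<^sub>R (velocity A t *v axis k 1))) (at (t *\<^sub>R e0))" if "k \<noteq> 0" for k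
    proof -
      have L: "bounded_linear (\<lambda>M :: real ^ ('n::{finite,zero}) ^ ('n::{finite,zero}). M *v axis k 1)"
        by (rule bounded_bilinear.bounded_linear_left[OF bounded_bilinear_matrix_vector_mult])
      have "((\<lambda>x. A (x $ 0) *v axis k 1) has_derivative
          (\<lambda>\<xi>. (\<xi> $ 0 *\<^sub>R velocity A t) *v axis k 1)) (at (t *\<^sub>R e0))"
        using bounded_linear.has_derivative[OF L has_derivative_first_coordinate[OF sm_A, of "t *\<^sub>R e0"]] tK
        by (simp add: e0_nth)
      then have "((\<lambda>x. A (x $ 0) *v axis k 1) has_derivative
          (\<lambda>\<xi>. \<xi> $ 0 *\<^sub>R (velocity A t *v axis k 1))) (at (t *\<^sub>R e0))"
        by (simp flip: scaleR_matrix_vector_assoc)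
      then show ?thesis
        by (rule has_derivative_transform_within_open[OF _ U(1) tU])
          (use U(2) that in \<open>auto simp: D\<phi> axis_def subset_iff\<close>)
    qed
    have wA: "w \<bullet> (A t *v ?ej) = (B t *v ?ei) \<bullet> ?ej"
    proof -
      have "w \<bullet> (?M *v ?ej) = frechet_derivative \<beta> (at (t *\<^sub>R e0)) ?ei \<bullet> ?ej
          - snd (\<psi> ?z) \<bullet> frechet_derivative (\<lambda>x. frechet_derivative \<phi> (at x) ?ej) (at (t *\<^sub>R e0)) ?ei"
        using snd_derivative_lift[OF lift_facts, of ?z "(?ei, 0)" ?ej] tU by (simp add: w_def M[symmetric] flip: \<psi>_def)
      moreover have "frechet_derivative (\<lambda>x. frechet_derivative \<phi> (at x) ?ej) (at (t *\<^sub>R e0)) ?ei = 0"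
        using fun_cong[OF frechet_derivative_at[OF D\<phi>k[OF ij(2)]], of ?ei] by (simp add: nth0)
      moreover have "frechet_derivative \<beta> (at (t *\<^sub>R e0)) ?ei \<bullet> ?ej = (B t *v ?ei) \<bullet> ?ej"
        unfolding \<beta>_def
        by (subst derivative_gauge_form[OF sm_Q sm_A sm_B sm_c sm_b B_sym]) (use tK in \<open>auto simp: nth0 e0_nth\<close>)
      ultimately show ?thesis
        by (simp add: Mi)
    qed
    have DM: "frechet_derivative (base_jacobian \<psi>) (at ?z) (?ei, 0) *v e0 = velocity A t *v ?ei"
    proof -
      have "((\<lambda>y. frechet_derivative \<phi> (at (fst y)) ?ei) has_derivative
          (\<lambda>u. fst u $ 0 *\<^sub>R (velocity A t *v ?ei))) (at ?z)"
        using has_derivative_compose[OF has_derivative_fst[OF has_derivative_ident], of _ _ ?z] D\<phi>k[OF ij(1)] by simp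
      then have "((\<lambda>y. base_jacobian \<psi> y *v ?ei) has_derivative
          (\<lambda>u. fst u $ 0 *\<^sub>R (velocity A t *v ?ei))) (at ?z)"
        by (rule has_derivative_transform_within_open[OF _ smooth_on_open[OF K] tW])
          (use jacobian_works[OF lift_facts(1)] in \<open>auto simp: base W_def\<close>)
      then have "frechet_derivative (\<lambda>y. base_jacobian \<psi> y *v ?ei) (at ?z) (e0, 0) = velocity A t *v ?ei"
        using fun_cong[OF frechet_derivative_at, of _ _ ?z "(e0, 0)"] by (fastforce simp: e0_nth)
      moreover have "frechet_derivative (\<lambda>y. base_jacobian \<psi> y *v ?ei) (at ?z) (e0, 0)
          = frechet_derivative (base_jacobian \<psi>) (at ?z) (e0, 0) *v ?ei"
        by (rule frechet_derivative_linear_compose[OF bounded_bilinear.bounded_linear_left[OF bounded_bilinear_matrix_vector_mult]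
              smooth_on_differentiable[OF smooth_on_base_jacobian[OF fib] tW]])
      ultimately show ?thesis
        using derivative_base_jacobian_symmetric[OF fib tW, of ?ei e0] by simp
    qed
    have D\<psi>: "frechet_derivative \<psi> (at ?z) (?ei, 0) = (A t *v ?ei, w)"
      using base_jacobian_works[OF fib tW, of ?ei] by (simp add: w_def prod_eq_iff Mi)
    have Dh: "frechet_derivative (grad_p H) (at (z t)) (A t *v ?ei, w) = Hm t *v (A t *v ?ei) + G t *v w"
    proof -
      have lin: "linear (frechet_derivative (grad_p H) (at (z t)))"
        using has_derivative_linear[OF smooth_on_has_derivative[OF smooth_on_grad_p[OF H]]] by simp
      have "frechet_derivative (grad_p H) (at (z t)) (A t *v ?ei, 0) = Hm t *v (A t *v ?ei)"
        using linear_horizontal_vertical(1)[OF lin]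
        by (simp add: Hm_def matrix_works linear_matrix_vector_mul_eq)
      then show ?thesis
        using linear_add[OF lin, of "(A t *v ?ei, 0)" "(0, w)"] derivative_grad_p_vertical[OF H, of "z t" w]
        by (simp add: G_def)
    qed
    have "velocity A t *v ?ei + ?M *v ?k = Hm t *v (A t *v ?ei) + G t *v w"
      using derivative_grad_p_fibered[OF fib H tW, of "(?ei, 0)"]
      by (simp add: K_vel[OF t] DM D\<psi> \<psi>z[OF t] Dh)
    \<comment> \<open>The \<open>\<Gamma>\<close>-product with the \<open>j\<close>-th column of \<open>A\<close> extracts the \<open>j\<close>-th component of \<open>?k\<close>.\<close>
    from arg_cong[OF this, of "\<lambda>v. v \<bullet> (\<Gamma> t *v (A t *v ?ej))"]
    have "(velocity A t *v ?ei) \<bullet> (\<Gamma> t *v (A t *v ?ej)) + (?M *v ?k) \<bullet> (\<Gamma> t *v (A t *v ?ej))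
        = (Hm t *v (A t *v ?ei)) \<bullet> (\<Gamma> t *v (A t *v ?ej)) + (G t *v w) \<bullet> (\<Gamma> t *v (A t *v ?ej))"
      by (simp only: inner_add_left)
    moreover have "(G t *v w) \<bullet> (\<Gamma> t *v (A t *v ?ej)) = (B t *v ?ei) \<bullet> ?ej"
      by (simp add: G_inner G\<Gamma> wA)
    moreover have "(?M *v ?k) \<bullet> (\<Gamma> t *v (A t *v ?ej)) = ?k \<bullet> ?ej"
      using metric[OF tK, of ?k ?ej] Mi(2) by (simp add: M nth0)
    moreover have "(B t *v ?ei) \<bullet> ?ej = (velocity A t *v ?ei) \<bullet> (\<Gamma> t *v (A t *v ?ej))
        - (Hm t *v (A t *v ?ei)) \<bullet> (\<Gamma> t *v (A t *v ?ej))"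
      by (simp add: BA[OF tK] inner_diff_right inner_commute[of "A t *v ?ej"] \<Gamma>_inner flip: matrix_vector_mul_assoc)
    ultimately have "?k \<bullet> ?ej = 0"
      by simp
    then show ?thesis
      by (simp add: inner_axis derivative_grad_p[OF K tW] dq_def partial_deriv_def)
  qed
  have inv_z: "inv_into W \<psi> (z t) = (t *\<^sub>R e0, 0)" if "t \<in> {0..\<delta>}" for t
    using inj_on_lift[OF lift_facts] tW[OF that] \<psi>z[OF that]
    by (intro inv_into_f_eq) (simp_all add: W_def \<psi>_def)
  have "five_equalities \<delta> (H \<circ> \<psi>) (\<lambda>t. inv_into W \<psi> (z t))"
    unfolding five_equalities_def
  proof (intro ballI conjI allI impI)
    fix t assume t: "t \<in> {0..\<delta>}"
    show "fst (inv_into W \<psi> (z t)) = t *\<^sub>R e0" "snd (inv_into W \<psi> (z t)) = 0"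
      by (simp_all add: inv_z[OF t])
    show "dp 0 (dp j (H \<circ> \<psi>)) (t *\<^sub>R e0, snd (inv_into W \<psi> (z t))) = 0" if "j \<noteq> 0" for j
      using hess[OF t that] hess_pp_axis[of "H \<circ> \<psi>" "(t *\<^sub>R e0, 0)" j 0] that
      by (simp add: inv_z[OF t] axis_def)
    show "dp i (dp j (H \<circ> \<psi>)) (t *\<^sub>R e0, snd (inv_into W \<psi> (z t))) = (if i = j then 1 else 0)" if "j \<noteq> 0" for i j
      using hess[OF t that] hess_pp_axis[of "H \<circ> \<psi>" "(t *\<^sub>R e0, 0)" j i]
      by (simp add: inv_z[OF t] axis_def)
    show "dq i (dp j (H \<circ> \<psi>)) (t *\<^sub>R e0, snd (inv_into W \<psi> (z t))) = 0" if "j \<noteq> 0" for i j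
      using mixed0[OF t] mixed[OF t _ that] by (cases "i = 0") (simp_all add: inv_z[OF t])
  qed
  moreover have "\<forall>t\<in>{0..\<delta>}. z t \<in> \<psi> ` W"
    using tW \<psi>z by (metis image_eqI)
  moreover have "{0..\<delta>} \<subseteq> I"
    using tK h(2) interior_subset[of I] unfolding J_def by blast
  ultimately show ?thesis
    using fib \<open>0 < \<delta>\<close> unfolding normalizes_def z_def by blast
qed

section \<open>The normal form and its remaining invariant\<close>

theorem theorem1:
  fixes H :: "'n::{finite,zero} phase \<Rightarrow> real"
    and I :: "real set"
    and Q P :: "real \<Rightarrow> real ^ 'n::{finite,zero}"
  assumes "smooth_on UNIV H"
    and "convex_in_p H"
    and "hamiltonian_orbit H I Q P"
    and "vector_derivative Q (at 0) \<noteq> 0"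
  shows "(\<exists>W \<psi> \<delta>. 0 < \<delta> \<and> {0..\<delta>} \<subseteq> I \<and> normalizes \<delta> H (\<lambda>t. (Q t, P t)) W \<psi>) \<and>
    (\<forall>W \<psi> \<delta>. 0 < \<delta> \<and> {0..\<delta>} \<subseteq> I \<and> normalizes \<delta> H (\<lambda>t. (Q t, P t)) W \<psi> \<and>
        \<not> mixed_qstar_p0_vanishes \<delta> (H \<circ> \<psi>) \<longrightarrow>
      \<not> (\<exists>V \<eta>. admissible \<delta> V \<eta> \<and> normalizes \<delta> (H \<circ> \<psi>) (\<lambda>t. (t *\<^sub>R e0, 0)) V \<eta> \<and>
              mixed_qstar_p0_vanishes \<delta> (H \<circ> \<psi> \<circ> \<eta>)))"
proof (intro conjI allI impI notI)
  show "\<exists>W \<psi> \<delta>. 0 < \<delta> \<and> {0..\<delta>} \<subseteq> I \<and> normalizes \<delta> H (\<lambda>t. (Q t, P t)) W \<psi>"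
    by (rule normal_form_exists[OF assms])
  fix W \<psi> \<delta>
  assume *: "0 < \<delta> \<and> {0..\<delta>} \<subseteq> I \<and> normalizes \<delta> H (\<lambda>t. (Q t, P t)) W \<psi> \<and>
      \<not> mixed_qstar_p0_vanishes \<delta> (H \<circ> \<psi>)"
    and "\<exists>V \<eta>. admissible \<delta> V \<eta> \<and> normalizes \<delta> (H \<circ> \<psi>) (\<lambda>t. (t *\<^sub>R e0, 0)) V \<eta> \<and>
      mixed_qstar_p0_vanishes \<delta> (H \<circ> \<psi> \<circ> \<eta>)"
  then obtain V \<eta> where \<eta>: "normalizes \<delta> (H \<circ> \<psi>) (\<lambda>t. (t *\<^sub>R e0, 0)) V \<eta>"
    "mixed_qstar_p0_vanishes \<delta> ((H \<circ> \<psi>) \<circ> \<eta>)"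
    by auto
  have norm: "normalizes \<delta> H (\<lambda>t. (Q t, P t)) W \<psi>" and "0 < \<delta>"
    using * by auto
  note fib = normalizes_fibered[OF norm] and seg = normalizes_segment[OF norm]
  have "mixed_qstar_p0_vanishes \<delta> (H \<circ> \<psi>)"
  proof (rule mixed_derivatives_obstruction[OF _ \<open>0 < \<delta>\<close> seg(1) _ normalizes_hess_pp[OF norm] \<eta>])
    show "smooth_on W (H \<circ> \<psi>)"
      using smooth_on_comp_fibered[OF fib assms(1)] by simp
    fix t assume t: "t \<in> {0..\<delta>}"
    have "((\<lambda>s. fst (Q s, P s)) has_vector_derivative grad_p H (Q t, P t)) (at t within {0..\<delta>})"
      using assms(3) * t unfolding hamiltonian_orbit_def
      by (auto intro!: has_vector_derivative_within_subset[of Q _ t I "{0..\<delta>}"])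
    then show "grad_p (H \<circ> \<psi>) (t *\<^sub>R e0, 0) = e0"
      by (rule velocity_along_segment[OF fib assms(1) \<open>0 < \<delta>\<close> t, rotated 2]) (use seg in auto)
  qed
  then show False
    using * by blast
qed

end
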